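(* Let $d\ge2$, let $\Gamma$ be a lattice of $\mathbb{R}^d$, and let $A:\mathbb{R}^d\to\mathbf{Sym}_d^+$ be $\Gamma$-periodic with $A\in L^1(\mathbb{R}^d/\Gamma)$, such that $\mathrm{Div}\,A$ is a bounded (vector-valued) measure over the torus $\mathbb{R}^d/\Gamma$. Then $(\det A)^{\frac1{d-1}}\in L^1(\mathbb{R}^d/\Gamma)$.
   Context: $\mathbf{Sym}_d^+$ is the cone of real symmetric positive semi-definite $d\times d$ matrices. For a matrix-valued function $A=(a_{ij})$, $\mathrm{Div}\,A$ is the vector with components $\sum_{j}\partial_ja_{ij}$, taken in the sense of distributions. $L^1(\mathbb{R}^d/\Gamma)$ denotes $\Gamma$-periodic functions integrable over a fundamental domain. *)

theory Defs
  imports "HOL-Analysis.Analysis"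
begin

definition lattice_of :: "real^'n^'n \<Rightarrow> (real^'n) set" where
  "lattice_of B = {B *v (\<chi> i. real_of_int (z i)) | z. True}"

definition fund_cell :: "real^'n^'n \<Rightarrow> (real^'n) set" where
  "fund_cell B = (\<lambda>t. B *v t) ` {t. \<forall>i. 0 \<le> t $ i \<and> t $ i < 1}"

definition periodic_wrt :: "(real^'n) set \<Rightarrow> (real^'n \<Rightarrow> 'b) \<Rightarrow> bool" where
  "periodic_wrt G f \<longleftrightarrow> (\<forall>x. \<forall>g\<in>G. f (x + g) = f x)"

definition psd_sym :: "real^'n^'n \<Rightarrow> bool" where
  "psd_sym M \<longleftrightarrow> transpose M = M \<and> (\<forall>v. 0 \<le> v \<bullet> (M *v v))"

definition partial :: "'n::finite \<Rightarrow> (real^'n \<Rightarrow> real) \<Rightarrow> real^'n \<Rightarrow> real" where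
  "partial j f x = frechet_derivative f (at x) (axis j 1)"

fun iter_partial :: "'n::finite list \<Rightarrow> (real^'n \<Rightarrow> real) \<Rightarrow> real^'n \<Rightarrow> real" where
  "iter_partial [] f = f"
| "iter_partial (j # js) f = partial j (iter_partial js f)"

definition smooth_fun :: "(real^'n::finite \<Rightarrow> real) \<Rightarrow> bool" where
  "smooth_fun f \<longleftrightarrow> (\<forall>js. iter_partial js f differentiable_on UNIV
                         \<and> continuous_on UNIV (iter_partial js f))"

text \<open>A finite (nonnegative) Borel measure on the torus, represented on the
  fundamental cell Y.\<close>
definition torus_measure :: "(real^'n) set \<Rightarrow> (real^'n) measure \<Rightarrow> bool" where
  "torus_measure Y M \<longleftrightarrow> sets M = sets borel \<and> finite_measure M \<and> emeasure M (UNIV - Y) = 0"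

text \<open>Div A is a bounded (vector, signed) measure on the torus R^d / Gamma:
  each component is a difference of two finite measures mu_plus i - mu_minus i and,
  for every smooth Gamma-periodic test function phi,
  <(Div A)_i, phi> = - int_Y sum_j a_ij d_j phi = int phi d(mu_i).\<close>
definition div_is_bounded_measure ::
    "real^'n^'n \<Rightarrow> (real^'n \<Rightarrow> real^'n^'n) \<Rightarrow> bool" where
  "div_is_bounded_measure B A \<longleftrightarrow>
     (\<exists>mp mn :: 'n \<Rightarrow> (real^'n) measure.
        (\<forall>i. torus_measure (fund_cell B) (mp i) \<and> torus_measure (fund_cell B) (mn i)) \<and>
        (\<forall>\<phi> i. smooth_fun \<phi> \<and> periodic_wrt (lattice_of B) \<phi> \<longrightarrow>
            - integral (fund_cell B) (\<lambda>x. \<Sum>j\<in>UNIV. A x $ i $ j * partial j \<phi> x)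
              = (\<integral>x. \<phi> x \<partial>mp i) - (\<integral>x. \<phi> x \<partial>mn i)))"

end

theory Submission
  imports Defs "HOL-Library.Groups_Big_Fun"
begin

text \<open>
  Let \<open>d\<close> be the dimension. For smooth compactly supported \<open>W \<ge> 0\<close> and a convex \<open>u\<close> with bounded
  slopes, \<open>\<integral>W : D\<^sup>2u = - \<integral>\<nabla>u \<cdot> Div W\<close> is at most \<open>\<parallel>Div W\<parallel>\<^sub>1\<close>, whereas \<open>W : D\<^sup>2u \<ge> d (det W det D\<^sup>2u)\<^sup>1\<^sup>/\<^sup>d\<close>.
  Prescribing \<open>det D\<^sup>2u = f\<close> gives \<open>\<integral>(f det W)\<^sup>1\<^sup>/\<^sup>d \<le> C \<parallel>Div W\<parallel>\<^sub>1\<close> whenever \<open>\<integral>f \<le> 1\<close>.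
  Regularity theory for the Monge--Ampere equation is avoided by discretising \<open>f\<close> into atoms placed on
  fine lattices: there the potential comes from semi-discrete optimal transport, \<open>D\<^sup>2u\<close> is replaced by
  second differences, and only a multiplicative constant is lost.

  For the given \<open>A\<close> one takes \<open>W = \<zeta> (A * K\<^sub>n + I)\<close> with a cutoff \<open>\<zeta>\<close> and periodic kernels \<open>K\<^sub>n\<close> that are
  trigonometric polynomials. Since \<open>det\<^sup>1\<^sup>/\<^sup>d\<close> is concave, \<open>(det A)\<^sup>1\<^sup>/\<^sup>d * K\<^sub>n \<le> det (A * K\<^sub>n + I)\<^sup>1\<^sup>/\<^sup>d\<close>, so in
  the limit \<open>\<integral>(det A)\<^sup>1\<^sup>/\<^sup>d g \<le> C \<parallel>g\<parallel>\<^sub>d\<close> for all \<open>g \<ge> 0\<close>, and duality puts \<open>(det A)\<^sup>1\<^sup>/\<^sup>d\<close> into \<open>L\<^sup>p\<close> with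
  \<open>p = d / (d - 1)\<close>.
\<close>

section \<open>Positive semidefinite matrices\<close>

text \<open>One potential \<open>u\<close> has to serve every cube on which the tensor is frozen,
  and it is known only through the volumes of its subgradients at the atoms. Second differences at
  atoms see \<open>u\<close> only along lattice directions, so each frozen tensor dictates its own
  lattice; what ties the cubes together is the shared supply of slopes, the volume 2^d of a cube. As
  \<open>u\<close> is chosen after the mesh, each passage from lattice sums to integrals must be
  uniform over all convex potentials; derivatives therefore fall on fixed C2 functions and never on
  \<open>u\<close>. The L^d norm of \<open>g\<close> comes from taking the density f = g^d divided
  by its integral: then f^(1/d) is \<open>g\<close> divided by its norm. The kernels are
  trigonometric polynomials because the divergence may be tested only with smooth periodic
  functions, and this class is closed under derivatives. Integrated over the whole space, a periodic
  kernel also reproduces lattice translates, so convolutions with it are estimated from below only;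
  for an integral of nonnegative functions this is enough.\<close>

lemma psd_sym_diag_nonneg:
  fixes W :: "real^'n^'n"
  assumes "psd_sym W" shows "0 \<le> W $ i $ i"
proof -
  have "0 \<le> axis i 1 \<bullet> (W *v axis i 1)" using assms by (simp add: psd_sym_def)
  then show ?thesis by (simp add: inner_axis' matrix_vector_mul_component inner_axis)
qed

lemma psd_sym_entry_commute: "psd_sym W \<Longrightarrow> W $ i $ j = W $ j $ i"
  unfolding psd_sym_def by (metis transpose_def vec_lambda_beta)

lemma quadratic_form_sum:
  fixes W :: "real^'n^'n"
  shows "v \<bullet> (W *v v) = (\<Sum>i\<in>UNIV. \<Sum>j\<in>UNIV. W $ i $ j * v $ i * v $ j)"
  by (simp add: inner_vec_def matrix_vector_mult_def sum_distrib_left algebra_simps)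

text \<open>Along the line through the j-th unit vector in direction \<open>axis i 1\<close> the
  quadratic form is affine, with slope twice the (i, j) entry; it can stay nonnegative only if the
  slope vanishes.\<close>

lemma psd_sym_diag_zero:
  fixes W :: "real^'n^'n"
  assumes W: "psd_sym W" and z: "W $ i $ i = 0"
  shows "W $ i $ j = 0"
proof (rule ccontr)
  assume nz: "W $ i $ j \<noteq> 0"
  \<comment> \<open>Chosen so that the form takes the value -1.\<close>
  define s where "s = - (W $ j $ j + 1) / (2 * W $ i $ j)"
  define v where "v = s *\<^sub>R axis i 1 + axis j (1::real)"
  have "v \<bullet> (W *v v) = s * s * W $ i $ i + s * W $ i $ j + s * W $ j $ i + W $ j $ j"
    by (simp add: v_def matrix_vector_right_distrib matrix_vector_mult_scaleR inner_add_left inner_add_right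
        inner_axis' inner_axis matrix_vector_mul_component algebra_simps)
  also have "\<dots> = -1"
    using nz z psd_sym_entry_commute[OF W, of i j] by (simp add: s_def field_simps)
  finally show False using W unfolding psd_sym_def by (metis not_one_le_zero neg_0_le_iff_le)
qed

text \<open>Each step is one step of Cholesky elimination, applied to the coordinates outside \<open>S\<close>.\<close>

lemma psd_sym_factor:
  fixes W :: "real^'n^'n"
  assumes "psd_sym W"
  obtains T :: "real^'n^'n" where "W = T ** transpose T"
proof -
  have "\<exists>T::real^'n^'n. W = T ** transpose T \<and> (\<forall>i. \<forall>j\<in>-S. T $ i $ j = 0)"
    if "finite S" "psd_sym W" "\<And>i j. i \<notin> S \<Longrightarrow> W $ i $ j = 0" for S and W :: "real^'n^'n"
    using that
  proof (induction S arbitrary: W rule: finite_induct)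
    case empty
    then have "W = 0" by (simp add: vec_eq_iff)
    then show ?case by (intro exI[of _ 0]) (simp add: matrix_matrix_mult_def zero_vec_def vec_eq_iff)
  next
    case (insert k S)
    define w where "w = W $ k $ k"
    have w0: "w \<ge> 0" unfolding w_def by (rule psd_sym_diag_nonneg[OF insert.prems(1)])
    have comm: "W $ i $ j = W $ j $ i" for i j by (rule psd_sym_entry_commute[OF insert.prems(1)])
    have wz: "W $ k $ i = 0" if "w = 0" for i
      using psd_sym_diag_zero[OF insert.prems(1)] that by (simp add: w_def)
    \<comment> \<open>Schur complement of the pivot. For \<open>w = 0\<close> division by zero gives
      0, hence \<open>W' = W\<close>, which is right because row \<open>k\<close> of
      \<open>W\<close> then vanishes.\<close>
    define W' where "W' = (\<chi> i j. W $ i $ j - W $ i $ k * W $ j $ k / w)"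
    have form: "v \<bullet> (W' *v v) = v \<bullet> (W *v v) - (W $ k \<bullet> v)\<^sup>2 / w" for v
    proof -
      have "v \<bullet> (W' *v v) = (\<Sum>i\<in>UNIV. \<Sum>j\<in>UNIV. W $ i $ j * v $ i * v $ j)
          - (\<Sum>i\<in>UNIV. \<Sum>j\<in>UNIV. (W $ k $ i * v $ i) * (W $ k $ j * v $ j) / w)"
        unfolding quadratic_form_sum W'_def sum_subtractf[symmetric]
        by (intro sum.cong refl) (simp add: algebra_simps comm[of _ k] diff_divide_distrib)
      also have "(\<Sum>i\<in>UNIV. \<Sum>j\<in>UNIV. (W $ k $ i * v $ i) * (W $ k $ j * v $ j) / w) = (W $ k \<bullet> v)\<^sup>2 / w"
        by (simp add: inner_vec_def power2_eq_square sum_product sum_divide_distrib)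
      finally show ?thesis by (simp add: quadratic_form_sum)
    qed
    have "0 \<le> v \<bullet> (W' *v v)" for v
    proof (cases "w = 0")
      case True then show ?thesis using insert.prems(1) by (simp add: form psd_sym_def)
    next
      case False
      \<comment> \<open>Minimiser of the form along \<open>axis k 1\<close>; the minimum is the form
        of \<open>W'\<close>.\<close>
      define t where "t = - (W $ k \<bullet> v) / w"
      have k1: "axis k 1 \<bullet> (W *v v) = W $ k \<bullet> v" by (simp add: inner_axis' matrix_vector_mul_component)
      have k2: "v \<bullet> (W *v axis k 1) = W $ k \<bullet> v"
        by (simp add: inner_vec_def matrix_vector_mult_basis column_def comm[of k] mult.commute)
      have k3: "axis k 1 \<bullet> (W *v axis k 1) = w"
        by (simp add: inner_axis' matrix_vector_mul_component inner_axis w_def)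
      have "0 \<le> (v + t *\<^sub>R axis k 1) \<bullet> (W *v (v + t *\<^sub>R axis k 1))"
        using insert.prems(1) by (simp add: psd_sym_def)
      also have "\<dots> = v \<bullet> (W *v v) + 2 * t * (W $ k \<bullet> v) + t\<^sup>2 * w"
        by (simp add: matrix_vector_right_distrib matrix_vector_mult_scaleR inner_add_left inner_add_right
            k1 k2 k3 power2_eq_square algebra_simps)
      also have "\<dots> = v \<bullet> (W' *v v)"
        using False by (simp add: form t_def power2_eq_square field_simps)
      finally show ?thesis .
    qed
    moreover have "transpose W' = W'"
      by (simp add: W'_def transpose_def vec_eq_iff comm algebra_simps)
    ultimately have psd': "psd_sym W'" by (simp add: psd_sym_def)
    have z': "W' $ i $ j = 0" if "i \<notin> S" for i j
    proof (cases "i = k")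
      case True
      have "W' $ k $ j = W $ k $ j - w * W $ k $ j / w"
        unfolding W'_def using comm[of j k] by (simp add: w_def)
      then show ?thesis using wz[of j] True by (cases "w = 0") auto
    next
      case False then show ?thesis using insert.prems(2) that by (simp add: W'_def)
    qed
    obtain T :: "real^'n^'n" where T: "W' = T ** transpose T" "\<And>i j. j \<notin> S \<Longrightarrow> T $ i $ j = 0"
      using insert.IH[OF psd' z'] by blast
    \<comment> \<open>Column \<open>k\<close> of \<open>T\<close> is zero because \<open>k\<close>
      lies outside \<open>S\<close>, so it is free to carry the pivot; for \<open>w = 0\<close> it
      remains zero.\<close>
    define T' where "T' = (\<chi> i j. if j = k then W $ i $ k / sqrt w else T $ i $ j)"
    have "(T' ** transpose T') $ i $ j = W $ i $ j" for i j
    proof -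
      have "(T' ** transpose T') $ i $ j
          = T' $ i $ k * T' $ j $ k + (\<Sum>l\<in>UNIV - {k}. T' $ i $ l * T' $ j $ l)"
        by (simp add: matrix_matrix_mult_def transpose_def sum.remove[of _ k])
      also have "(\<Sum>l\<in>UNIV - {k}. T' $ i $ l * T' $ j $ l) = (\<Sum>l\<in>UNIV - {k}. T $ i $ l * T $ j $ l)"
        by (intro sum.cong) (auto simp: T'_def)
      also have "\<dots> = (\<Sum>l\<in>UNIV. T $ i $ l * T $ j $ l)"
        using T(2)[OF insert.hyps(2)] by (simp add: sum.remove[of UNIV k])
      also have "\<dots> = W' $ i $ j"
        by (simp add: T(1) matrix_matrix_mult_def transpose_def)
      also have "T' $ i $ k * T' $ j $ k = W $ i $ k * W $ j $ k / w"
        using w0 by (simp add: T'_def)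
      finally show ?thesis by (simp add: W'_def)
    qed
    then have "W = T' ** transpose T'" by (simp add: vec_eq_iff)
    moreover have "\<forall>i. \<forall>j\<in>-insert k S. T' $ i $ j = 0" using T(2) by (auto simp: T'_def)
    ultimately show ?case by blast
  qed
  from this[of UNIV W] assms that show ?thesis by auto
qed

lemma psd_sym_mult_transpose: "psd_sym (T ** transpose T)" for T :: "real^'n^'n"
proof -
  have "v \<bullet> ((T ** transpose T) *v v) = (transpose T *v v) \<bullet> (transpose T *v v)" for v
    by (simp add: dot_lmul_matrix transpose_matrix_vector flip: matrix_vector_mul_assoc)
  then show ?thesis by (simp add: psd_sym_def matrix_transpose_mul)
qed

text \<open>The factorisation writes \<open>W\<close> as a sum of rank-one matrices built from the
  columns of \<open>T\<close>, so the pairing with \<open>H\<close> is a sum of values of the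
  quadratic form of \<open>H\<close>.\<close>

lemma frobenius_psd_nonneg:
  fixes W :: "real^'n^'n"
  assumes W: "psd_sym W"
    and H: "\<And>v::real^'n. 0 \<le> (\<Sum>i\<in>UNIV. \<Sum>j\<in>UNIV. v $ i * v $ j * H i j)"
  shows "0 \<le> (\<Sum>i\<in>UNIV. \<Sum>j\<in>UNIV. W $ i $ j * H i j)"
proof -
  obtain T :: "real^'n^'n" where T: "W = T ** transpose T" using psd_sym_factor[OF W] .
  have "(\<Sum>i\<in>UNIV. \<Sum>j\<in>UNIV. W $ i $ j * H i j)
      = (\<Sum>i\<in>UNIV. \<Sum>j\<in>UNIV. \<Sum>k\<in>UNIV. column k T $ i * column k T $ j * H i j)"
    by (simp add: T matrix_matrix_mult_def transpose_def column_def sum_distrib_right)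
  also have "\<dots> = (\<Sum>k\<in>UNIV. \<Sum>i\<in>UNIV. \<Sum>j\<in>UNIV. column k T $ i * column k T $ j * H i j)"
    by (subst (2) sum.swap, subst sum.swap, rule refl)
  also have "\<dots> \<ge> 0" by (intro sum_nonneg H)
  finally show ?thesis .
qed

text \<open>Hadamard's inequality by Gram-Schmidt: replacing a row by its component orthogonal to
  all other rows keeps the determinant and does not lengthen the row. The invariant makes a treated
  row orthogonal to every other row, treated or not, so later replacements preserve it and the rows
  may be treated in any order.\<close>

lemma det_le_prod_norm_rows:
  fixes M :: "real^'n^'n"
  shows "\<bar>det M\<bar> \<le> (\<Prod>i\<in>UNIV. norm (M $ i))"
proof -
  have "\<exists>N::real^'n^'n. \<bar>det N\<bar> = \<bar>det M\<bar> \<and> (\<forall>i. norm (N $ i) \<le> norm (M $ i)) \<and>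
      (\<forall>i\<in>S. \<forall>j. j \<noteq> i \<longrightarrow> N $ i \<bullet> N $ j = 0)" for S
  proof (induction S rule: finite_induct[OF finite])
    case 1 then show ?case by auto
  next
    case (2 k S)
    then obtain N :: "real^'n^'n" where N: "\<bar>det N\<bar> = \<bar>det M\<bar>" "\<And>i. norm (N $ i) \<le> norm (M $ i)"
      "\<And>i j. i \<in> S \<Longrightarrow> j \<noteq> i \<Longrightarrow> N $ i \<bullet> N $ j = 0" by blast
    \<comment> \<open>All rows other than \<open>k\<close>, the untreated ones included.\<close>
    define V where "V = {row j N |j. j \<noteq> k}"
    obtain y z where yz: "y \<in> span V" "\<And>w. w \<in> span V \<Longrightarrow> orthogonal z w" "N $ k = y + z"
      using orthogonal_subspace_decomp_exists[of V "N $ k"] by metis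
    define N' where "N' = (\<chi> i. if i = k then row k N + (- y) else row i N)"
    have "det N' = det N" unfolding N'_def
      by (rule det_row_span) (use span_neg[OF yz(1)] in \<open>simp add: V_def span_vec_eq\<close>)
    moreover have k: "N' $ k = z" by (simp add: N'_def row_def yz(3) vec_eq_iff)
    moreover have o: "N' $ i = N $ i" if "i \<noteq> k" for i using that by (simp add: N'_def row_def vec_eq_iff)
    moreover have "norm z \<le> norm (N $ k)"
    proof -
      have "orthogonal z y" using yz by blast
      then have "(norm (N $ k))\<^sup>2 = (norm y)\<^sup>2 + (norm z)\<^sup>2"
        unfolding yz(3) by (intro norm_add_Pythagorean) (simp add: orthogonal_commute)
      then have "(norm z)\<^sup>2 \<le> (norm (N $ k))\<^sup>2" by simp
      then show ?thesis by (simp add: power2_le_iff_abs_le)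
    qed
    moreover have zo: "z \<bullet> N $ j = 0" if "j \<noteq> k" for j
    proof -
      have "N $ j \<in> V" using that by (auto simp: V_def row_def vec_eq_iff)
      then show ?thesis using yz(2) span_base unfolding orthogonal_def by blast
    qed
    ultimately have "\<bar>det N'\<bar> = \<bar>det M\<bar>" "\<forall>i. norm (N' $ i) \<le> norm (M $ i)"
      using N(1,2) order_trans by metis+
    moreover have "N' $ i \<bullet> N' $ j = 0" if "i \<in> insert k S" "j \<noteq> i" for i j
      using that N(3)[of i j] zo[of i] zo[of j] k o[of i] o[of j] by (cases "i = k"; cases "j = k") (auto simp: inner_commute)
    ultimately show ?case by blast
  qed
  from this[of UNIV] obtain N :: "real^'n^'n" where N: "\<bar>det N\<bar> = \<bar>det M\<bar>" "\<And>i. norm (N $ i) \<le> norm (M $ i)"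
    "\<And>i j. j \<noteq> i \<Longrightarrow> N $ i \<bullet> N $ j = 0" by auto
  have "(det N)\<^sup>2 = det (N ** transpose N)" by (simp add: det_mul det_transpose power2_eq_square)
  also have "\<dots> = (\<Prod>i\<in>UNIV. (N ** transpose N) $ i $ i)"
    by (rule det_diagonal) (use N(3) in \<open>auto simp: matrix_matrix_mult_def transpose_def inner_vec_def\<close>)
  also have "\<dots> = (\<Prod>i\<in>UNIV. norm (N $ i))\<^sup>2"
    unfolding prod_power_distrib
    by (intro prod.cong) (simp_all add: power2_norm_eq_inner matrix_matrix_mult_def transpose_def inner_vec_def)
  finally have "\<bar>det N\<bar> = (\<Prod>i\<in>UNIV. norm (N $ i))"
    by (metis abs_of_nonneg norm_ge_zero power2_eq_iff_nonneg prod_nonneg abs_ge_zero power2_abs)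
  also have "\<dots> \<le> (\<Prod>i\<in>UNIV. norm (M $ i))" by (intro prod_mono) (simp add: N(2))
  finally show ?thesis using N(1) by simp
qed

lemma psd_sym_det_nonneg: "psd_sym W \<Longrightarrow> 0 \<le> det W"
  by (metis psd_sym_factor det_mul det_transpose zero_le_square)

text \<open>Hadamard's inequality for the factor \<open>T\<close>, whose squared row lengths are the
  diagonal entries of \<open>W\<close>.\<close>

lemma psd_sym_det_le_prod_diag:
  fixes W :: "real^'n^'n"
  assumes "psd_sym W" shows "det W \<le> (\<Prod>i\<in>UNIV. W $ i $ i)"
proof -
  obtain T :: "real^'n^'n" where T: "W = T ** transpose T" using psd_sym_factor[OF assms] .
  have "det W = \<bar>det T\<bar>\<^sup>2" by (simp add: T det_mul det_transpose power2_eq_square)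
  also have "\<dots> \<le> (\<Prod>i\<in>UNIV. norm (T $ i))\<^sup>2"
    by (intro power_mono det_le_prod_norm_rows) simp
  also have "\<dots> = (\<Prod>i\<in>UNIV. W $ i $ i)"
    unfolding prod_power_distrib
    by (intro prod.cong) (simp_all add: T power2_norm_eq_inner matrix_matrix_mult_def transpose_def inner_vec_def)
  finally show ?thesis .
qed

lemma card_times_geometric_mean_le_sum:
  fixes a :: "'n::finite \<Rightarrow> real"
  assumes "\<And>i. 0 \<le> a i"
  shows "real CARD('n) * (\<Prod>i\<in>UNIV. a i) powr (1 / real CARD('n)) \<le> (\<Sum>i\<in>UNIV. a i)"
proof -
  have "(\<Prod>i\<in>UNIV. a i) powr (1 / real CARD('n)) \<le> (\<Sum>i\<in>UNIV. a i / real CARD('n))"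
    using arith_geom_mean[of UNIV a] assms by simp
  also have "\<dots> = (\<Sum>i\<in>UNIV. a i) / real CARD('n)" by (simp add: sum_divide_distrib)
  finally have "(\<Prod>i\<in>UNIV. a i) powr (1 / real CARD('n)) \<le> (\<Sum>i\<in>UNIV. a i) / real CARD('n)" .
  then show ?thesis by (simp add: field_simps)
qed

text \<open>A linear majorant of the d-th root of the determinant; after a change of coordinates it
  yields the concavity of that root.\<close>

lemma psd_sym_det_le_trace:
  fixes W :: "real^'n^'n"
  assumes "psd_sym W"
  shows "real CARD('n) * det W powr (1 / real CARD('n)) \<le> (\<Sum>i\<in>UNIV. W $ i $ i)"
proof -
  have "real CARD('n) * det W powr (1 / real CARD('n))
      \<le> real CARD('n) * (\<Prod>i\<in>UNIV. W $ i $ i) powr (1 / real CARD('n))"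
    by (intro mult_left_mono powr_mono2 psd_sym_det_le_prod_diag psd_sym_det_nonneg assms) auto
  also have "\<dots> \<le> (\<Sum>i\<in>UNIV. W $ i $ i)"
    by (rule card_times_geometric_mean_le_sum) (rule psd_sym_diag_nonneg[OF assms])
  finally show ?thesis .
qed

section \<open>Linear images and lattice sums\<close>

text \<open>The permutation case of the change of variables: boxes go to boxes with the same side
  lengths in another order.\<close>

lemma cbox_permute_measure:
  fixes a b :: "real^'n"
  assumes p: "p permutes UNIV"
  shows "measure lebesgue ((\<lambda>v. \<chi> i. v $ p i) ` cbox a b) = measure lebesgue (cbox a b)"
proof (cases "cbox a b = {}")
  case False
  have eq: "(\<lambda>v::real^'n. \<chi> i. v $ p i) ` cbox a b = cbox (\<chi> i. a $ p i) (\<chi> i. b $ p i)"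
  proof (intro equalityI subsetI)
    fix x assume x: "x \<in> cbox (\<chi> i. a $ p i) (\<chi> i. b $ p i)"
    have "a $ i \<le> x $ inv p i \<and> x $ inv p i \<le> b $ i" for i
      using x[unfolded mem_box_cart, rule_format, of "inv p i"] permutes_inverses(1)[OF p] by simp
    then have "(\<chi> i. x $ inv p i) \<in> cbox a b" by (simp add: mem_box_cart)
    moreover have "x = (\<chi> i. (\<chi> i. x $ inv p i) $ p i)"
      using permutes_inverses(2)[OF p] by (simp add: vec_eq_iff)
    ultimately show "x \<in> (\<lambda>v. \<chi> i. v $ p i) ` cbox a b" by blast
  qed (auto simp: mem_box_cart)
  have ne: "cbox (\<chi> i. a $ p i) (\<chi> i. b $ p i) \<noteq> {}" using False eq by (metis image_is_empty)
  show ?thesis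
    using prod.permute[OF p, of "\<lambda>i. b $ i - a $ i"] False ne
    by (simp add: eq content_cbox_cart)
qed auto

text \<open>The library has this result only for well-ordered index types.\<close>

lemma measure_matrix_image:
  fixes M :: "real^'n^'n"
  assumes "S \<in> lmeasurable"
  shows "(*v) M ` S \<in> lmeasurable \<and> measure lebesgue ((*v) M ` S) = \<bar>det M\<bar> * measure lebesgue S"
proof -
  let ?Q = "\<lambda>M::real^'n^'n. \<forall>S\<in>lmeasurable. (*v) M ` S \<in> lmeasurable \<and>
              measure lebesgue ((*v) M ` S) = \<bar>det M\<bar> * measure lebesgue S"
  have boxes: "?Q M" if "\<And>a b. measure lebesgue ((*v) M ` cbox a b) = \<bar>det M\<bar> * measure lebesgue (cbox a b)"
    for M :: "real^'n^'n"
    using measure_linear_sufficient[OF matrix_vector_mul_linear _ that] by metis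
  have "?Q M"
  proof (rule induct_matrix_elementary_alt)
    fix A B :: "real^'n^'n" assume AB: "?Q A" "?Q B"
    have "(*v) (A ** B) ` S = (*v) A ` (*v) B ` S" for S
      by (simp add: image_comp comp_def matrix_vector_mul_assoc)
    then show "?Q (A ** B)" using AB by (simp add: det_mul abs_mult)
  next
    fix A :: "real^'n^'n" and i assume z: "row i A = 0"
    have "negligible ((*v) A ` S)" for S
      by (rule negligible_subset[OF negligible_standard_hyperplane_cart[of i]])
        (use z in \<open>auto simp: matrix_vector_mul_component row_def vec_eq_iff inner_vec_def\<close>)
    moreover have "det A = 0" using z by (rule det_zero_row)
    ultimately show "?Q A" by (simp add: negligible_imp_measurable negligible_imp_measure0)
  next
    fix A :: "real^'n^'n" assume d: "\<And>i j. i \<noteq> j \<Longrightarrow> A $ i $ j = 0"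
    have "A *v x = (\<chi> i. A $ i $ i * x $ i)" for x
    proof -
      have "(\<Sum>j\<in>UNIV. A $ i $ j * x $ j) = (\<Sum>j\<in>UNIV. if j = i then A $ i $ i * x $ i else 0)" for i
        using d by (intro sum.cong) auto
      then show ?thesis by (simp add: vec_eq_iff matrix_vector_mult_def)
    qed
    then have "(*v) A = (\<lambda>x. \<chi> i. A $ i $ i * x $ i)" by auto
    then show "?Q A"
      using measurable_stretch[where m="\<lambda>i. A $ i $ i"] measure_stretch[where m="\<lambda>i. A $ i $ i"] d
      by (simp add: det_diagonal)
  next
    fix m n :: 'n assume mn: "m \<noteq> n"
    let ?M = "(\<chi> i j. mat 1 $ i $ Transposition.transpose m n j) :: real^'n^'n"
    have "?M *v x = (\<chi> i. x $ Transposition.transpose m n i)" for x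
    proof -
      have "(if i = Transposition.transpose m n j then 1 else 0) * x $ j
          = (if j = Transposition.transpose m n i then x $ j else 0)" for i j
        by (auto simp: transpose_involutory)
      then show ?thesis by (simp add: vec_eq_iff matrix_vector_mult_def mat_def)
    qed
    then have "(*v) ?M = (\<lambda>x. \<chi> i. x $ Transposition.transpose m n i)" by auto
    moreover have "\<bar>det ?M\<bar> = 1"
      by (simp add: det_permute_columns permutes_swap_id sign_swap_id abs_mult)
    ultimately show "?Q ?M"
      using boxes[of ?M] cbox_permute_measure[OF permutes_swap_id[of m UNIV n]] by simp
  next
    fix m n :: 'n assume mn: "m \<noteq> n"
    let ?M = "(\<chi> i j. of_bool (i = m \<and> j = n \<or> i = j)) :: real^'n^'n"
    let ?h = "\<lambda>x::real^'n. \<chi> i. if i = m then x $ m + x $ n else x $ i"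
    have "?M *v x = ?h x" for x
    proof -
      have 1: "of_bool (i = m \<and> j = n \<or> i = j) * x $ j
         = (if j = i then x $ j else 0) + (if j = n then if i = m then x $ n else 0 else 0)" for i j
        using mn by auto
      have "(?M *v x) $ i = (\<Sum>j\<in>UNIV. of_bool (i = m \<and> j = n \<or> i = j) * x $ j)" for i
        by (simp add: matrix_vector_mult_def)
      then show ?thesis unfolding vec_eq_iff by (simp only: 1 sum.distrib) simp
    qed
    then have M: "(*v) ?M = ?h" by auto
    have "?M = (\<chi> k. if k = m then row m (mat 1) + 1 *s row n (mat 1) else row k (mat 1))"
      using mn by (auto simp: vec_eq_iff row_def mat_def)
    then have det: "det ?M = 1" using det_row_operation[OF mn, of "mat 1 :: real^'n^'n" 1] by simp
    have "measure lebesgue (?h ` cbox a b) = measure lebesgue (cbox a b)" for a b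
    proof (cases "cbox a b = {}")
      case False
      \<comment> \<open>The shear formula wants a nonnegative lower bound in coordinate
        \<open>n\<close>; the shift by \<open>v\<close> makes that bound 0 and changes no
        volume.\<close>
      define v where "v = a $ n *\<^sub>R (axis n 1 :: real^'n)"
      define w where "w = ?h v"
      have "cbox a b = (+) v ` cbox (a - v) (b - v)" using cbox_translation[of v "a - v" "b - v"] by simp
      moreover have "?h (v + x) = w + ?h x" for x by (simp add: w_def vec_eq_iff)
      ultimately have "?h ` cbox a b = (+) w ` ?h ` cbox (a - v) (b - v)"
        by (auto simp: image_image)
      then have "measure lebesgue (?h ` cbox a b) = measure lebesgue (?h ` cbox (a - v) (b - v))"
        by (simp only: measure_translation)
      also have "\<dots> = measure lebesgue (cbox (a - v) (b - v))"
      proof (rule measure_shear_interval[OF mn])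
        show "cbox (a - v) (b - v) \<noteq> {}" using False
          by (simp add: interval_ne_empty_cart)
        show "0 \<le> (a - v) $ n" by (simp add: v_def axis_def)
      qed
      also have "\<dots> = measure lebesgue ((+) v ` cbox (a - v) (b - v))" by (simp only: measure_translation)
      also have "(+) v ` cbox (a - v) (b - v) = cbox a b" using cbox_translation[of v "a - v" "b - v"] by simp
      finally show ?thesis .
    qed simp
    then show "?Q ?M" using boxes[of ?M] det M by simp
  qed
  then show ?thesis using assms by blast
qed

section \<open>Lattices and their cells\<close>

definition ivec :: "int^'n \<Rightarrow> real^'n" where "ivec z = (\<chi> i. of_int (z $ i))"

lemma ivec_add: "ivec (z + w) = ivec z + ivec w" by (simp add: ivec_def vec_eq_iff)

text \<open>Half-open in every coordinate, so that the integer translates partition space; the image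
  under \<open>B\<close> is \<open>fund_cell B\<close>.\<close>

definition unit_cell :: "(real^'n) set" where "unit_cell = {t. \<forall>i. 0 \<le> t $ i \<and> t $ i < 1}"

lemma unit_cell_decompose:
  fixes x :: "real^'n"
  shows "x - ivec (\<chi> i. \<lfloor>x $ i\<rfloor>) \<in> unit_cell"
  by (simp add: unit_cell_def ivec_def) linarith

lemma ivec_eq_if_unit_cell:
  assumes "t \<in> unit_cell" "s \<in> unit_cell" "ivec z + t = ivec w + s"
  shows "z = w"
proof -
  have "z $ i = w $ i" for i
  proof -
    have "of_int (z $ i) + t $ i = of_int (w $ i) + s $ i"
      using assms(3) by (auto simp: vec_eq_iff ivec_def)
    moreover have "0 \<le> t $ i" "t $ i < 1" "0 \<le> s $ i" "s $ i < 1"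
      using assms(1,2) by (auto simp: unit_cell_def)
    ultimately have "\<bar>of_int (z $ i) - of_int (w $ i) :: real\<bar> < 1" by linarith
    then show ?thesis by linarith
  qed
  then show ?thesis by (simp add: vec_eq_iff)
qed

lemma unit_cell_measurable:
  shows "(unit_cell :: (real^'n) set) \<in> lmeasurable" "measure lebesgue (unit_cell :: (real^'n) set) = 1"
proof -
  have bx: "box 0 1 \<subseteq> unit_cell" "(unit_cell :: (real^'n) set) \<subseteq> cbox 0 1"
    by (auto simp: unit_cell_def mem_box_cart less_imp_le)
  have neg: "negligible (cbox 0 1 - box 0 (1::real^'n))"
    by (rule negligible_frontier_interval)
  have sd: "sym_diff unit_cell (cbox 0 1) \<subseteq> cbox 0 1 - box 0 (1::real^'n)" using bx by auto
  have neg': "negligible (sym_diff unit_cell (cbox 0 (1::real^'n)))" by (rule negligible_subset[OF neg sd])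
  then have neg'': "negligible (sym_diff (cbox 0 (1::real^'n)) unit_cell)" by (simp add: Un_commute)
  show "(unit_cell :: (real^'n) set) \<in> lmeasurable"
    by (rule lmeasurable_negligible_symdiff[OF lmeasurable_cbox[of 0 1] neg''])
  have "measure lebesgue (unit_cell :: (real^'n) set) = measure lebesgue (cbox 0 (1::real^'n))"
    using measure_negligible_symdiff[OF lmeasurable_cbox neg''] .
  also have "\<dots> = 1" by (simp add: content_cbox_cart interval_ne_empty_cart)
  finally show "measure lebesgue (unit_cell :: (real^'n) set) = 1" .
qed

definition lattice_cell :: "real^'n^'n \<Rightarrow> int^'n \<Rightarrow> (real^'n) set" where
  "lattice_cell M z = (\<lambda>t. M *v (ivec z + t)) ` unit_cell"

lemma lattice_cell_measure:
  "lattice_cell M z \<in> lmeasurable" "measure lebesgue (lattice_cell M z) = \<bar>det M\<bar>"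
proof -
  have eq: "lattice_cell M z = (+) (M *v ivec z) ` (*v) M ` unit_cell"
    by (simp add: lattice_cell_def image_image matrix_vector_right_distrib)
  show "lattice_cell M z \<in> lmeasurable" unfolding eq
    using measure_matrix_image[OF unit_cell_measurable(1), of M] by (simp add: measurable_translation)
  show "measure lebesgue (lattice_cell M z) = \<bar>det M\<bar>" unfolding eq measure_translation
    using measure_matrix_image[OF unit_cell_measurable(1), of M] by (simp add: unit_cell_measurable)
qed

lemma det_nonzero_inverse:
  fixes M :: "real^'n^'n"
  assumes "det M \<noteq> 0"
  obtains N where "M ** N = mat 1" "N ** M = mat 1"
  using assms invertible_det_nz unfolding invertible_def by blast

lemma invertible_matrix_inj: "det M \<noteq> 0 \<Longrightarrow> M *v x = M *v y \<Longrightarrow> x = y" for M :: "real^'n^'n"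
  by (metis inj_def inj_matrix_vector_mult invertible_det_nz)

lemma lattice_cell_disjoint:
  assumes "det M \<noteq> 0" "z \<noteq> w"
  shows "lattice_cell M z \<inter> lattice_cell M w = {}"
proof (rule ccontr)
  assume "lattice_cell M z \<inter> lattice_cell M w \<noteq> {}"
  then obtain t s where "t \<in> unit_cell" "s \<in> unit_cell" "M *v (ivec z + t) = M *v (ivec w + s)"
    unfolding lattice_cell_def by auto
  then show False using ivec_eq_if_unit_cell invertible_matrix_inj[OF assms(1)] assms(2) by metis
qed

lemma lattice_cell_cover:
  assumes "det M \<noteq> 0" obtains z where "x \<in> lattice_cell M z"
proof -
  obtain N where "M ** N = mat 1" using det_nonzero_inverse[OF assms] by blast
  then obtain y where y: "M *v y = x" by (metis matrix_vector_mul_assoc matrix_vector_mul_lid)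
  have "M *v (ivec (\<chi> i. \<lfloor>y $ i\<rfloor>) + (y - ivec (\<chi> i. \<lfloor>y $ i\<rfloor>))) = x" by (simp add: y)
  then show ?thesis using that unit_cell_decompose[of y] unfolding lattice_cell_def by (metis image_eqI)
qed

lemma finite_lattice_points:
  fixes M :: "real^'n^'n"
  assumes "det M \<noteq> 0" "bounded S"
  shows "finite {z. M *v ivec z \<in> S}"
proof -
  obtain N where "N ** M = mat 1" using det_nonzero_inverse[OF assms(1)] by blast
  then have inv: "N *v (M *v x) = x" for x by (metis matrix_vector_mul_assoc matrix_vector_mul_lid)
  have "bounded ((*v) N ` S)" by (simp add: assms(2) bounded_linear_image matrix_vector_mul_bounded_linear)
  then obtain b where b: "\<And>y. y \<in> (*v) N ` S \<Longrightarrow> norm y \<le> b" unfolding bounded_iff by blast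
  have "z \<in> (\<lambda>f. \<chi> i. f i) ` (UNIV \<rightarrow>\<^sub>E {- \<lceil>b\<rceil>..\<lceil>b\<rceil>})" if "M *v ivec z \<in> S" for z
  proof -
    have "norm (ivec z) \<le> b" using b[of "ivec z"] that inv[of "ivec z"] by (metis image_eqI)
    then have "\<bar>ivec z $ i\<bar> \<le> b" for i using component_le_norm_cart order_trans by blast
    then have zb: "\<bar>real_of_int (z $ i)\<bar> \<le> b" for i by (simp add: ivec_def)
    then have "z $ i \<in> {- \<lceil>b\<rceil>..\<lceil>b\<rceil>}" for i
    proof -
      have "real_of_int (z $ i) \<le> b" "real_of_int (- (z $ i)) \<le> b" using zb[of i] by auto
      then have "z $ i \<le> \<lceil>b\<rceil>" "- (z $ i) \<le> \<lceil>b\<rceil>" by linarith+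
      then show ?thesis by simp
    qed
    then show ?thesis by (intro image_eqI[of _ _ "($) z"]) (auto simp: vec_eq_iff)
  qed
  then have "{z. M *v ivec z \<in> S} \<subseteq> (\<lambda>f. \<chi> i. f i) ` (UNIV \<rightarrow>\<^sub>E {- \<lceil>b\<rceil>..\<lceil>b\<rceil>})" by blast
  then show ?thesis by (rule finite_subset) (simp add: finite_PiE)
qed

text \<open>Disjoint cells of volume |det M| are packed into \<open>U\<close>; the counts of lattice
  points below all rest on this packing bound.\<close>

lemma card_lattice_cells_le:
  fixes M :: "real^'n^'n"
  assumes "det M \<noteq> 0" "finite F" "\<And>z. z \<in> F \<Longrightarrow> lattice_cell M z \<subseteq> U" "U \<in> lmeasurable"
  shows "\<bar>det M\<bar> * real (card F) \<le> measure lebesgue U"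
proof -
  have "measure lebesgue (\<Union>z\<in>F. lattice_cell M z) = (\<Sum>z\<in>F. measure lebesgue (lattice_cell M z))"
  proof (rule measure_finite_Union[OF assms(2)])
    show "lattice_cell M ` F \<subseteq> sets lebesgue" using lattice_cell_measure(1) fmeasurableD by blast
    show "disjoint_family_on (lattice_cell M) F"
      using lattice_cell_disjoint[OF assms(1)] by (auto simp: disjoint_family_on_def)
    show "emeasure lebesgue (lattice_cell M z) \<noteq> \<infinity>" for z
      using fmeasurableD2[OF lattice_cell_measure(1)] by (metis infinity_ennreal_def)
  qed
  also have "\<dots> = \<bar>det M\<bar> * real (card F)" by (simp add: lattice_cell_measure)
  finally have "\<bar>det M\<bar> * real (card F) = measure lebesgue (\<Union>z\<in>F. lattice_cell M z)" by simp
  also have "\<dots> \<le> measure lebesgue U"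
    by (rule measure_mono_fmeasurable) (use assms in \<open>auto simp: lattice_cell_measure fmeasurableD\<close>)
  finally show ?thesis .
qed

section \<open>Functions of bounded support and Riemann sums over lattices\<close>

definition supp_ball :: "real \<Rightarrow> ('a::real_normed_vector \<Rightarrow> real) \<Rightarrow> bool" where
  "supp_ball R f \<longleftrightarrow> (\<forall>x. R < norm x \<longrightarrow> f x = 0)"

lemma integrable_continuous_supp_ball:
  fixes f :: "'a::euclidean_space \<Rightarrow> real"
  assumes "continuous_on UNIV f" "supp_ball R f"
  shows "integrable lborel f"
proof -
  have "integrable lborel (\<lambda>x. indicator (cball 0 R) x *\<^sub>R f x)"
    by (rule borel_integrable_compact) (use assms(1) continuous_on_subset in auto)
  moreover have "(\<lambda>x. indicator (cball 0 R) x *\<^sub>R f x) = f"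
    using assms(2) by (auto simp: indicator_def fun_eq_iff supp_ball_def)
  ultimately show ?thesis by simp
qed

lemma integral_bound_supp_ball:
  fixes f :: "'a::euclidean_space \<Rightarrow> real"
  assumes "continuous_on UNIV f" "supp_ball R f" "\<And>x. \<bar>f x\<bar> \<le> c"
  shows "\<bar>\<integral>x. f x \<partial>lborel\<bar> \<le> c * measure lebesgue (cball (0::'a) R)"
proof -
  have ci: "integrable lborel (\<lambda>x. indicator (cball (0::'a) R) x *\<^sub>R c)"
    using emeasure_bounded_finite[OF bounded_cball, of "0::'a" R]
    by (intro integrable_scaleR_left integrable_real_indicator) auto
  have "\<bar>\<integral>x. f x \<partial>lborel\<bar> \<le> (\<integral>x. \<bar>f x\<bar> \<partial>lborel)" by (rule integral_abs_bound)
  also have "\<dots> \<le> (\<integral>x. indicator (cball (0::'a) R) x *\<^sub>R c \<partial>lborel)"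
    by (rule Bochner_Integration.integral_mono)
      (use ci integrable_continuous_supp_ball[OF assms(1,2)] assms(2,3) in
        \<open>auto simp: indicator_def supp_ball_def\<close>)
  finally have "\<bar>\<integral>x. f x \<partial>lborel\<bar> \<le> (\<integral>x. indicator (cball (0::'a) R) x *\<^sub>R c \<partial>lborel)" .
  then show ?thesis by (simp add: mult.commute)
qed

text \<open>A Riemann sum weighted by the covolume. \<open>Sum_any\<close> carries no index set, so
  a shift by a lattice vector is a mere reindexing; for bounded support and nonsingular
  \<open>M\<close> only finitely many terms are nonzero.\<close>

definition lattice_sum :: "real^'n^'n \<Rightarrow> (real^'n \<Rightarrow> real) \<Rightarrow> real" where
  "lattice_sum M f = \<bar>det M\<bar> * Sum_any (\<lambda>z. f (M *v ivec z))"

lemma lattice_sum_eq: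
  assumes "finite F" "\<And>z. z \<notin> F \<Longrightarrow> f (M *v ivec z) = 0"
  shows "lattice_sum M f = \<bar>det M\<bar> * (\<Sum>z\<in>F. f (M *v ivec z))"
  unfolding lattice_sum_def using Sum_any.expand_superset[OF assms(1), of "\<lambda>z. f (M *v ivec z)"] assms(2) by fastforce

text \<open>The error depends on \<open>f\<close> only through its support and its oscillation at
  the scale of a cell, which later allows one bound for a whole family of functions. Lattice points
  within R + 1 suffice, and their cells fit into the ball of radius R + 3.\<close>

lemma lattice_sum_approx_integral:
  fixes M :: "real^'n^'n"
  assumes det: "det M \<noteq> 0" and cont: "continuous_on UNIV f" and supp: "supp_ball R f"
    and mod: "\<And>x y. dist x y \<le> \<eta> \<Longrightarrow> \<bar>f x - f y\<bar> \<le> \<epsilon>"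
    and cell: "\<And>t. t \<in> unit_cell \<Longrightarrow> norm (M *v t) \<le> \<eta>" and "\<eta> \<le> 1"
  shows "\<bar>lattice_sum M f - (\<integral>x. f x \<partial>lborel)\<bar> \<le> \<epsilon> * measure lebesgue (ball (0::real^'n) (R + 3))"
proof -
  define F where "F = {z. M *v ivec z \<in> cball 0 (R + 1)}"
  have fin: "finite F" unfolding F_def by (rule finite_lattice_points[OF det bounded_cball])
  have cdist: "dist (M *v ivec z) x \<le> \<eta>" if "x \<in> lattice_cell M z" for x z
    using that cell by (auto simp: lattice_cell_def matrix_vector_right_distrib dist_norm)
  have zero: "f x = 0" if "x \<in> lattice_cell M z" "z \<notin> F" for x z
  proof -
    have "norm (M *v ivec z) \<le> norm x + dist (M *v ivec z) x"
      using norm_triangle_sub[of "M *v ivec z" x] by (simp add: dist_norm)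
    then have "R < norm x" using that(2) cdist[OF that(1)] \<open>\<eta> \<le> 1\<close> by (simp add: F_def)
    then show ?thesis using supp by (simp add: supp_ball_def)
  qed
  have eps: "0 \<le> \<epsilon>"
  proof -
    have "0 \<in> unit_cell" by (simp add: unit_cell_def)
    then have "0 \<le> \<eta>" using cell[of 0] by simp
    then show ?thesis using mod[of 0 0] by simp
  qed
  have int: "integrable lebesgue f"
    using integrable_continuous_supp_ball[OF cont supp] by (simp add: integrable_completion)
  have m: "lattice_cell M z \<in> sets lebesgue" for z using lattice_cell_measure(1) by blast
  have disj: "disjoint_family_on (lattice_cell M) F"
    using lattice_cell_disjoint[OF det] by (auto simp: disjoint_family_on_def)
  have "(\<integral>x. f x \<partial>lborel) = (\<integral>x. f x \<partial>lebesgue)"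
    using cont by (simp add: integral_completion borel_measurable_continuous_onI)
  also have "\<dots> = (\<integral>x. (\<Sum>z\<in>F. indicator (lattice_cell M z) x *\<^sub>R f x) \<partial>lebesgue)"
  proof (rule Bochner_Integration.integral_cong[OF refl])
    fix x
    obtain w where w: "x \<in> lattice_cell M w" using lattice_cell_cover[OF det] .
    have ind: "indicator (lattice_cell M z) x = (if z = w then 1 else 0 :: real)" for z
      using w lattice_cell_disjoint[OF det, of z w] by (auto simp: indicator_def)
    show "f x = (\<Sum>z\<in>F. indicator (lattice_cell M z) x *\<^sub>R f x)"
      using zero[OF w] fin by (auto simp: ind if_distrib[of "\<lambda>c. c * _"] cong: if_cong)
  qed
  also have "\<dots> = (\<Sum>z\<in>F. \<integral>x. indicator (lattice_cell M z) x *\<^sub>R f x \<partial>lebesgue)"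
    by (rule Bochner_Integration.integral_sum) (use int m integrable_mult_indicator in blast)
  finally have I: "(\<integral>x. f x \<partial>lborel) = (\<Sum>z\<in>F. \<integral>x. indicator (lattice_cell M z) x *\<^sub>R f x \<partial>lebesgue)" .
  have cellerr: "\<bar>\<bar>det M\<bar> * f (M *v ivec z) - (\<integral>x. indicator (lattice_cell M z) x *\<^sub>R f x \<partial>lebesgue)\<bar> \<le> \<epsilon> * \<bar>det M\<bar>" for z
  proof -
    have ci: "integrable lebesgue (\<lambda>x. indicator (lattice_cell M z) x *\<^sub>R c)" for c :: real
      using lattice_cell_measure(1)[of M z] by (intro integrable_scaleR_left integrable_real_indicator) (auto simp: fmeasurable_def)
    have fi: "integrable lebesgue (\<lambda>x. indicator (lattice_cell M z) x *\<^sub>R f x)"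
      using int m integrable_mult_indicator by blast
    have "\<bar>det M\<bar> * c = (\<integral>x. indicator (lattice_cell M z) x *\<^sub>R c \<partial>lebesgue)" for c
      by (simp add: lattice_cell_measure)
    then have "\<bar>det M\<bar> * f (M *v ivec z) - (\<integral>x. indicator (lattice_cell M z) x *\<^sub>R f x \<partial>lebesgue)
      = (\<integral>x. indicator (lattice_cell M z) x *\<^sub>R f (M *v ivec z) - indicator (lattice_cell M z) x *\<^sub>R f x \<partial>lebesgue)"
      using Bochner_Integration.integral_diff[OF ci fi] by simp
    also have "\<bar>\<dots>\<bar> \<le> (\<integral>x. indicator (lattice_cell M z) x *\<^sub>R \<epsilon> \<partial>lebesgue)"
      by (rule order_trans[OF integral_abs_bound integral_mono])
        (use ci fi mod cdist in \<open>auto simp: indicator_def split: if_splits\<close>)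
    also have "\<dots> = \<epsilon> * \<bar>det M\<bar>" by (simp add: lattice_cell_measure)
    finally show ?thesis .
  qed
  have "lattice_sum M f = (\<Sum>z\<in>F. \<bar>det M\<bar> * f (M *v ivec z))"
    using supp by (subst lattice_sum_eq[OF fin]) (auto simp: F_def sum_distrib_left supp_ball_def)
  then have "\<bar>lattice_sum M f - (\<integral>x. f x \<partial>lborel)\<bar> \<le> (\<Sum>z\<in>F. \<epsilon> * \<bar>det M\<bar>)"
    unfolding I by (simp only: flip: sum_subtractf) (rule order_trans[OF sum_abs sum_mono[OF cellerr]])
  also have "\<dots> = \<epsilon> * (\<bar>det M\<bar> * real (card F))" by simp
  also have "\<dots> \<le> \<epsilon> * measure lebesgue (ball (0::real^'n) (R + 3))"
  proof (intro mult_left_mono eps card_lattice_cells_le det fin)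
    fix z assume z: "z \<in> F"
    show "lattice_cell M z \<subseteq> ball 0 (R + 3)"
    proof
      fix x assume x: "x \<in> lattice_cell M z"
      have "norm x \<le> norm (M *v ivec z) + dist (M *v ivec z) x"
        using norm_triangle_sub[of x "M *v ivec z"] by (simp add: dist_norm norm_minus_commute)
      then show "x \<in> ball 0 (R + 3)" using z cdist[OF x] \<open>\<eta> \<le> 1\<close> by (simp add: F_def)
    qed
  qed simp
  finally show ?thesis .
qed

lemma lattice_sum_shift:
  "lattice_sum M (\<lambda>x. f (x + M *v ivec e)) = lattice_sum M f"
proof -
  have "Sum_any (\<lambda>z. f (M *v ivec z)) = Sum_any (\<lambda>z. f (M *v ivec (z + e)))"
    by (rule Sum_any.reindex_cong[of "\<lambda>z. z + e"]) (auto simp: bij_plus_right fun_eq_iff)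
  then show ?thesis by (simp add: lattice_sum_def ivec_add matrix_vector_right_distrib)
qed

section \<open>Functions with two continuous derivatives\<close>

text \<open>Two continuous derivatives are the working regularity: the bump used for localisation
  has no more, and second differences ask for no more. The derivative is \<open>partial\<close>, in
  which the divergence hypothesis is phrased.\<close>

definition C1 :: "(real^'n \<Rightarrow> real) \<Rightarrow> bool" where
  "C1 f \<longleftrightarrow> (\<forall>x. f differentiable at x) \<and> (\<forall>j. continuous_on UNIV (partial j f))"

definition C2 :: "(real^'n \<Rightarrow> real) \<Rightarrow> bool" where
  "C2 f \<longleftrightarrow> C1 f \<and> (\<forall>j. C1 (partial j f))"

lemma partial_eqI: "(f has_derivative f') (at x) \<Longrightarrow> partial j f x = f' (axis j 1)"
  unfolding partial_def by (metis frechet_derivative_at)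

lemma has_derivative_partial:
  fixes f :: "real^'n \<Rightarrow> real"
  assumes "f differentiable at x"
  shows "(f has_derivative (\<lambda>v. \<Sum>j\<in>UNIV. v $ j * partial j f x)) (at x)"
proof -
  have D: "(f has_derivative frechet_derivative f (at x)) (at x)"
    using assms frechet_derivative_works by blast
  have "frechet_derivative f (at x) v = (\<Sum>j\<in>UNIV. v $ j * partial j f x)" for v
  proof -
    have lin: "linear (frechet_derivative f (at x))" using D has_derivative_linear by blast
    have "v = (\<Sum>j\<in>UNIV. v $ j *\<^sub>R axis j 1)" using basis_expansion[of v] by (simp add: scalar_mult_eq_scaleR)
    then have "frechet_derivative f (at x) v = frechet_derivative f (at x) (\<Sum>j\<in>UNIV. v $ j *\<^sub>R axis j 1)" by simp
    then show ?thesis by (simp add: linear_sum[OF lin] linear_scale[OF lin] partial_def)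
  qed
  then show ?thesis using D by presburger
qed

lemma C1I:
  assumes "\<And>x. (f has_derivative (\<lambda>v. \<Sum>j\<in>UNIV. v $ j * D j x)) (at x)"
    and "\<And>j. continuous_on UNIV (D j)"
  shows "C1 f" "partial j f = D j"
proof -
  have p: "partial j f = D j" for j
    by (rule ext, subst partial_eqI[OF assms(1)]) (simp add: axis_def if_distrib[of "\<lambda>c. c * _"] cong: if_cong)
  then show "partial j f = D j" .
  show "C1 f" unfolding C1_def p using assms differentiableI by blast
qed

lemma C1_D: "C1 f \<Longrightarrow> (f has_derivative (\<lambda>v. \<Sum>j\<in>UNIV. v $ j * partial j f x)) (at x)"
  by (simp add: C1_def has_derivative_partial)

lemma C1_continuous_partial: "C1 f \<Longrightarrow> continuous_on UNIV (partial j f)" by (simp add: C1_def)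

lemma C1_continuous: "C1 f \<Longrightarrow> continuous_on UNIV f"
  by (meson C1_def continuous_at_imp_continuous_on differentiable_imp_continuous_within)

lemma C1_const: "C1 (\<lambda>x. c)" "partial j (\<lambda>x. c) = (\<lambda>x. 0)"
  using C1I[of "\<lambda>x. c" "\<lambda>j x. 0"] by simp_all

lemma C1_add:
  assumes "C1 f" "C1 g"
  shows "C1 (\<lambda>x. f x + g x)" "partial j (\<lambda>x. f x + g x) = (\<lambda>x. partial j f x + partial j g x)"
proof -
  have "((\<lambda>x. f x + g x) has_derivative (\<lambda>v. \<Sum>j\<in>UNIV. v $ j * (partial j f x + partial j g x))) (at x)" for x
    using has_derivative_add[OF C1_D[OF assms(1)] C1_D[OF assms(2)], of x] by (simp add: algebra_simps sum.distrib)
  note C = C1I[OF this continuous_on_add[OF C1_continuous_partial[OF assms(1)] C1_continuous_partial[OF assms(2)]]]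
  show "C1 (\<lambda>x. f x + g x)" "partial j (\<lambda>x. f x + g x) = (\<lambda>x. partial j f x + partial j g x)"
    using C by auto
qed

lemma C1_mult:
  assumes "C1 f" "C1 g"
  shows "C1 (\<lambda>x. f x * g x)"
    "partial j (\<lambda>x. f x * g x) = (\<lambda>x. f x * partial j g x + partial j f x * g x)"
proof -
  have "((\<lambda>x. f x * g x) has_derivative (\<lambda>v. \<Sum>j\<in>UNIV. v $ j * (f x * partial j g x + partial j f x * g x))) (at x)" for x
    using has_derivative_mult[OF C1_D[OF assms(1)] C1_D[OF assms(2)], of x]
    by (simp add: algebra_simps sum.distrib sum_distrib_left)
  note C = C1I[OF this continuous_on_add[OF continuous_on_mult[OF C1_continuous[OF assms(1)] C1_continuous_partial[OF assms(2)]]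
        continuous_on_mult[OF C1_continuous_partial[OF assms(1)] C1_continuous[OF assms(2)]]]]
  show "C1 (\<lambda>x. f x * g x)"
    "partial j (\<lambda>x. f x * g x) = (\<lambda>x. f x * partial j g x + partial j f x * g x)"
    using C by auto
qed

lemma C1_affine:
  assumes "C1 f"
  shows "C1 (\<lambda>x. f (c *\<^sub>R x + b))" "partial j (\<lambda>x. f (c *\<^sub>R x + b)) = (\<lambda>x. c * partial j f (c *\<^sub>R x + b))"
proof -
  have "((\<lambda>x. f (c *\<^sub>R x + b)) has_derivative (\<lambda>v. \<Sum>j\<in>UNIV. v $ j * (c * partial j f (c *\<^sub>R x + b)))) (at x)" for x
  proof -
    have "((\<lambda>x. c *\<^sub>R x + b) has_derivative (\<lambda>v. c *\<^sub>R v)) (at x)"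
      by (auto intro!: derivative_eq_intros)
    from has_derivative_compose[OF this C1_D[OF assms]] show ?thesis
      by (simp add: algebra_simps)
  qed
  moreover have "continuous_on UNIV (\<lambda>x. c * partial j f (c *\<^sub>R x + b))" for j
    by (intro continuous_intros continuous_on_compose2[OF C1_continuous_partial[OF assms]]) auto
  ultimately show "C1 (\<lambda>x. f (c *\<^sub>R x + b))"
    "partial j (\<lambda>x. f (c *\<^sub>R x + b)) = (\<lambda>x. c * partial j f (c *\<^sub>R x + b))"
    using C1I[of "\<lambda>x. f (c *\<^sub>R x + b)" "\<lambda>j x. c * partial j f (c *\<^sub>R x + b)"] by auto
qed

lemma C1_compose_inner:
  assumes "\<And>t. (\<phi> has_real_derivative \<phi>' t) (at t)" "continuous_on UNIV \<phi>'"
  shows "C1 (\<lambda>x. \<phi> (v \<bullet> x + c))" "partial j (\<lambda>x. \<phi> (v \<bullet> x + c)) = (\<lambda>x. \<phi>' (v \<bullet> x + c) * v $ j)"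
proof -
  have "((\<lambda>x. \<phi> (v \<bullet> x + c)) has_derivative (\<lambda>w. \<Sum>j\<in>UNIV. w $ j * (\<phi>' (v \<bullet> x + c) * v $ j))) (at x)" for x
  proof -
    have "((\<lambda>x. v \<bullet> x + c) has_derivative (\<lambda>w. v \<bullet> w)) (at x)"
      by (auto intro!: derivative_eq_intros)
    from has_derivative_compose[OF this assms(1)[of "v \<bullet> x + c", unfolded has_field_derivative_def]]
    have "((\<lambda>x. \<phi> (v \<bullet> x + c)) has_derivative (\<lambda>w. \<phi>' (v \<bullet> x + c) * (v \<bullet> w))) (at x)" .
    moreover have "\<phi>' (v \<bullet> x + c) * (v \<bullet> w) = (\<Sum>j\<in>UNIV. w $ j * (\<phi>' (v \<bullet> x + c) * v $ j))" for w
      unfolding inner_vec_def[of v w] sum_distrib_left by (intro sum.cong) simp_all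
    ultimately show ?thesis by (simp only:)
  qed
  moreover have "continuous_on UNIV (\<lambda>x. \<phi>' (v \<bullet> x + c) * v $ j)" for j
    by (intro continuous_intros continuous_on_compose2[OF assms(2)]) auto
  ultimately show "C1 (\<lambda>x. \<phi> (v \<bullet> x + c))" "partial j (\<lambda>x. \<phi> (v \<bullet> x + c)) = (\<lambda>x. \<phi>' (v \<bullet> x + c) * v $ j)"
    using C1I[of "\<lambda>x. \<phi> (v \<bullet> x + c)" "\<lambda>j x. \<phi>' (v \<bullet> x + c) * v $ j"] by auto
qed

lemma C1_cmult:
  assumes "C1 f"
  shows "C1 (\<lambda>x. c * f x)" "partial j (\<lambda>x. c * f x) = (\<lambda>x. c * partial j f x)"
  using C1_mult[OF C1_const(1) assms] by (simp_all add: C1_const)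

lemma C1_sum:
  assumes "\<And>i. i \<in> S \<Longrightarrow> C1 (f i)"
  shows "C1 (\<lambda>x. \<Sum>i\<in>S. f i x) \<and> partial j (\<lambda>x. \<Sum>i\<in>S. f i x) = (\<lambda>x. \<Sum>i\<in>S. partial j (f i) x)"
  using assms by (induction S rule: infinite_finite_induct) (simp_all add: C1_const C1_add)

lemma C2_C1: "C2 f \<Longrightarrow> C1 f" "C2 f \<Longrightarrow> C1 (partial j f)" by (simp_all add: C2_def)

lemma C2_continuous: "C2 f \<Longrightarrow> continuous_on UNIV f" by (simp add: C2_C1 C1_continuous)

lemma C2_const: "C2 (\<lambda>x. c)" by (simp add: C2_def C1_const)

lemma C2_add: "C2 f \<Longrightarrow> C2 g \<Longrightarrow> C2 (\<lambda>x. f x + g x)"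
  by (simp add: C2_def C1_add)

lemma C2_mult: "C2 f \<Longrightarrow> C2 g \<Longrightarrow> C2 (\<lambda>x. f x * g x)"
  by (simp add: C2_def C1_add C1_mult)

lemma C2_cmult: "C2 f \<Longrightarrow> C2 (\<lambda>x. c * f x)"
  by (intro C2_mult C2_const)

lemma C2_diff: "C2 f \<Longrightarrow> C2 g \<Longrightarrow> C2 (\<lambda>x. f x - g x)"
  using C2_add[OF _ C2_cmult[of g "-1"], of f] by simp

lemma C2_sum: "(\<And>i. i \<in> S \<Longrightarrow> C2 (f i)) \<Longrightarrow> C2 (\<lambda>x. \<Sum>i\<in>S. f i x)"
  by (induction S rule: infinite_finite_induct) (simp_all add: C2_const C2_add)

lemma C2_prod: "(\<And>i. i \<in> S \<Longrightarrow> C2 (f i)) \<Longrightarrow> C2 (\<lambda>x. \<Prod>i\<in>S. f i x)"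
  by (induction S rule: infinite_finite_induct) (simp_all add: C2_const C2_mult)

lemma C2_affine: "C2 f \<Longrightarrow> C2 (\<lambda>x. f (c *\<^sub>R x + b))"
  by (simp add: C2_def C1_affine C1_cmult)

lemma C2_compose_inner:
  assumes "\<And>t. (\<phi> has_real_derivative \<phi>' t) (at t)" "\<And>t. (\<phi>' has_real_derivative \<phi>'' t) (at t)"
    "continuous_on UNIV \<phi>''"
  shows "C2 (\<lambda>x. \<phi> (v \<bullet> x + c))"
proof -
  have c: "continuous_on UNIV \<phi>'"
    using assms(2) by (intro continuous_at_imp_continuous_on) (auto intro: DERIV_isCont)
  have 1: "C1 (\<lambda>x. \<phi>' (v \<bullet> x + c) * v $ j)" for j
    using C1_mult(1)[OF C1_compose_inner(1)[OF assms(2,3)] C1_const(1)] .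
  show ?thesis unfolding C2_def using C1_compose_inner[OF assms(1) c, where v=v and c=c] 1 by simp
qed

section \<open>Calculus of functions supported in a ball\<close>

lemma supp_ball_mono: "supp_ball R f \<Longrightarrow> R \<le> S \<Longrightarrow> supp_ball S f" by (simp add: supp_ball_def)

lemma supp_ball_mult: "supp_ball R f \<Longrightarrow> supp_ball R (\<lambda>x. f x * g x)"
  "supp_ball R f \<Longrightarrow> supp_ball R (\<lambda>x. g x * f x)"
  by (simp_all add: supp_ball_def)

lemma supp_ball_add: "supp_ball R f \<Longrightarrow> supp_ball R g \<Longrightarrow> supp_ball R (\<lambda>x. f x + g x)"
  by (simp add: supp_ball_def)

lemma supp_ball_diff: "supp_ball R f \<Longrightarrow> supp_ball R g \<Longrightarrow> supp_ball R (\<lambda>x. f x - g x)"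
  by (simp add: supp_ball_def)

lemma supp_ball_sum: "(\<And>i. i \<in> S \<Longrightarrow> supp_ball R (f i)) \<Longrightarrow> supp_ball R (\<lambda>x. \<Sum>i\<in>S. f i x)"
  by (auto simp: supp_ball_def intro: sum.neutral)

lemma supp_ball_partial:
  assumes "supp_ball R f" shows "supp_ball R (partial j f)"
  unfolding supp_ball_def
proof (intro allI impI)
  fix x :: "real^'a" assume x: "R < norm x"
  have "open {x :: real^'a. R < norm x}" by (intro open_Collect_less continuous_intros)
  moreover have "((\<lambda>x. 0::real) has_derivative (\<lambda>v. 0)) (at x)" by simp
  ultimately have "(f has_derivative (\<lambda>v. 0)) (at x)"
    using x assms by (rule_tac has_derivative_transform_within_open[where f="\<lambda>x. 0"]) (auto simp: supp_ball_def)
  then show "partial j f x = 0" using partial_eqI by fastforce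
qed

text \<open>Compactness is used on the ball of radius R + 1 only: if one of two points at distance
  below 1 leaves it, both lie outside the support.\<close>

lemma supp_ball_uniformly_continuous:
  fixes f :: "real^'n \<Rightarrow> real"
  assumes c: "continuous_on UNIV f" and s: "supp_ball R f" and "0 < e"
  obtains d where "0 < d" "\<And>x y. dist x y < d \<Longrightarrow> \<bar>f x - f y\<bar> < e"
proof -
  have "uniformly_continuous_on (cball 0 (R + 1)) f"
    using c by (intro compact_uniformly_continuous) (auto intro: continuous_on_subset)
  then obtain d where d: "d > 0" "\<And>x y. x \<in> cball 0 (R + 1) \<Longrightarrow> y \<in> cball 0 (R + 1) \<Longrightarrow> dist x y < d \<Longrightarrow> \<bar>f x - f y\<bar> < e"
    using \<open>0 < e\<close> unfolding uniformly_continuous_on_def dist_real_def by (metis dist_commute)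
  have "\<bar>f x - f y\<bar> < e" if "dist x y < min d 1" for x y
  proof (cases "norm x \<le> R + 1 \<and> norm y \<le> R + 1")
    case True then show ?thesis using d(2)[of x y] that by auto
  next
    case False
    have "norm x \<le> norm y + dist x y" "norm y \<le> norm x + dist x y"
      using norm_triangle_sub[of x y] norm_triangle_sub[of y x] by (auto simp: dist_norm norm_minus_commute)
    then have "R < norm x" "R < norm y" using False that by auto
    then show ?thesis using s \<open>0 < e\<close> by (simp add: supp_ball_def)
  qed
  then show ?thesis using that[of "min d 1"] d(1) by auto
qed

lemma supp_ball_bounded:
  fixes f :: "real^'n \<Rightarrow> real"
  assumes c: "continuous_on UNIV f" and s: "supp_ball R f"
  obtains b where "0 < b" "\<And>x. \<bar>f x\<bar> \<le> b"
proof -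
  have "compact (f ` cball 0 R)" using c by (intro compact_continuous_image) (auto intro: continuous_on_subset)
  then have "bounded (f ` cball 0 R)" by (rule compact_imp_bounded)
  then obtain b where b: "0 < b" "\<And>x. x \<in> cball 0 R \<Longrightarrow> \<bar>f x\<bar> \<le> b" unfolding bounded_pos by auto
  have "\<bar>f x\<bar> \<le> b" for x using b s by (cases "norm x \<le> R") (auto simp: supp_ball_def)
  then show ?thesis using b(1) that by blast
qed

section \<open>Directional derivatives and uniform difference quotients\<close>

definition dir1 :: "real^'n \<Rightarrow> (real^'n \<Rightarrow> real) \<Rightarrow> real^'n \<Rightarrow> real" where
  "dir1 e f x = (\<Sum>j\<in>UNIV. e $ j * partial j f x)"

definition dir2 :: "real^'n \<Rightarrow> (real^'n \<Rightarrow> real) \<Rightarrow> real^'n \<Rightarrow> real" where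
  "dir2 e f x = (\<Sum>i\<in>UNIV. \<Sum>j\<in>UNIV. e $ i * e $ j * partial j (partial i f) x)"

lemma dir1_line:
  assumes "C1 f"
  shows "((\<lambda>t. f (x + t *\<^sub>R e)) has_real_derivative dir1 e f (x + t *\<^sub>R e)) (at t)"
proof -
  have "((\<lambda>t. x + t *\<^sub>R e) has_derivative (\<lambda>s. s *\<^sub>R e)) (at t)"
    by (auto intro!: derivative_eq_intros)
  from has_derivative_compose[OF this C1_D[OF assms]]
  have "((\<lambda>t. f (x + t *\<^sub>R e)) has_derivative
      (\<lambda>s. \<Sum>j\<in>UNIV. (s *\<^sub>R e) $ j * partial j f (x + t *\<^sub>R e))) (at t)" .
  moreover have "(\<Sum>j\<in>UNIV. (s *\<^sub>R e) $ j * partial j f (x + t *\<^sub>R e)) = dir1 e f (x + t *\<^sub>R e) * s" for s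
    unfolding dir1_def sum_distrib_right by (intro sum.cong) simp_all
  ultimately show ?thesis unfolding has_field_derivative_def by (simp only:)
qed

lemma dir2_line:
  assumes "C2 f"
  shows "((\<lambda>t. dir1 e f (x + t *\<^sub>R e)) has_real_derivative dir2 e f (x + t *\<^sub>R e)) (at t)"
proof -
  have "((\<lambda>t. \<Sum>i\<in>UNIV. e $ i * partial i f (x + t *\<^sub>R e)) has_real_derivative
      (\<Sum>i\<in>UNIV. e $ i * dir1 e (partial i f) (x + t *\<^sub>R e))) (at t)"
    by (intro DERIV_sum DERIV_cmult dir1_line C2_C1(2) assms)
  then show ?thesis unfolding dir1_def dir2_def by (simp add: sum_distrib_left algebra_simps)
qed

lemma continuous_on_dir1: "C1 f \<Longrightarrow> continuous_on UNIV (dir1 e f)"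
  unfolding dir1_def by (intro continuous_intros C1_continuous_partial)

lemma continuous_on_dir2: "C2 f \<Longrightarrow> continuous_on UNIV (dir2 e f)"
  unfolding dir2_def by (intro continuous_intros C1_continuous_partial C2_C1(2))

lemma supp_ball_dir1: "supp_ball R f \<Longrightarrow> supp_ball R (dir1 e f)"
  unfolding dir1_def by (intro supp_ball_sum supp_ball_mult supp_ball_partial)

lemma supp_ball_dir2: "supp_ball R f \<Longrightarrow> supp_ball R (dir2 e f)"
  unfolding dir2_def by (intro supp_ball_sum supp_ball_mult supp_ball_partial)

text \<open>The mean value theorem turns the quotient into \<open>dir1\<close> at a nearby point,
  and \<open>dir1\<close> is uniformly continuous; hence one \<delta> works for all
  \<open>x\<close>.\<close>

lemma difference_quotient_uniform:
  assumes f: "C1 f" "supp_ball R f" and "0 < \<epsilon>"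
  obtains \<delta> where "0 < \<delta>"
    "\<And>h x. 0 < h \<Longrightarrow> h < \<delta> \<Longrightarrow> \<bar>(f (x + h *\<^sub>R e) - f x) / h - dir1 e f x\<bar> < \<epsilon>"
proof -
  obtain d where d: "0 < d" "\<And>x y. dist x y < d \<Longrightarrow> \<bar>dir1 e f x - dir1 e f y\<bar> < \<epsilon>"
    using supp_ball_uniformly_continuous[OF continuous_on_dir1[OF f(1)] supp_ball_dir1[OF f(2)] \<open>0 < \<epsilon>\<close>] by blast
  \<comment> \<open>The added 1 keeps the threshold meaningful for \<open>e = 0\<close>.\<close>
  have "\<bar>(f (x + h *\<^sub>R e) - f x) / h - dir1 e f x\<bar> < \<epsilon>" if h: "0 < h" "h < d / (norm e + 1)" for h x
  proof -
    have "\<exists>t>0. t < h \<and> f (x + h *\<^sub>R e) - f (x + 0 *\<^sub>R e) = (h - 0) * dir1 e f (x + t *\<^sub>R e)"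
      by (rule MVT2[OF h(1)]) (rule dir1_line[OF f(1)])
    then obtain t where t: "0 < t" "t < h" "f (x + h *\<^sub>R e) - f (x + 0 *\<^sub>R e) = (h - 0) * dir1 e f (x + t *\<^sub>R e)"
      by blast
    have "t * norm e \<le> h * (norm e + 1)" using t by (intro mult_mono) auto
    also have "\<dots> < d" using h pos_less_divide_eq[of "norm e + 1" h d] by (simp add: add_nonneg_pos)
    finally have "dist (x + t *\<^sub>R e) x < d" using t by (simp add: dist_norm)
    moreover have "(f (x + h *\<^sub>R e) - f x) / h = dir1 e f (x + t *\<^sub>R e)" using t(3) h(1) by simp
    ultimately show ?thesis using d(2) by simp
  qed
  moreover have "0 < d / (norm e + 1)" using d(1) by (simp add: add_nonneg_pos)
  ultimately show ?thesis using that by blast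
qed

text \<open>Taylor's formula of order two for the sum of the values of \<open>f\<close> at x + te
  and x - te, which is even in t and so has vanishing first derivative at t = 0. The remainder is a
  mean of two values of \<open>dir2\<close> near \<open>x\<close>.\<close>

lemma second_difference_uniform:
  assumes f: "C2 f" "supp_ball R f" and "0 < \<epsilon>"
  obtains \<delta> where "0 < \<delta>"
    "\<And>h x. 0 < h \<Longrightarrow> h < \<delta> \<Longrightarrow> \<bar>(f (x + h *\<^sub>R e) + f (x - h *\<^sub>R e) - 2 * f x) / h\<^sup>2 - dir2 e f x\<bar> < \<epsilon>"
proof -
  obtain d where d: "0 < d" "\<And>x y. dist x y < d \<Longrightarrow> \<bar>dir2 e f x - dir2 e f y\<bar> < \<epsilon>"
    using supp_ball_uniformly_continuous[OF continuous_on_dir2[OF f(1)] supp_ball_dir2[OF f(2)] \<open>0 < \<epsilon>\<close>] by blast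
  have "\<bar>(f (x + h *\<^sub>R e) + f (x - h *\<^sub>R e) - 2 * f x) / h\<^sup>2 - dir2 e f x\<bar> < \<epsilon>" if h: "0 < h" "h < d / (norm e + 1)" for h x
  proof -
    \<comment> \<open>Writing the backward half as a forward half in direction \<open>- e\<close>
      lets both halves share the derivative formulas.\<close>
    have flip: "dir1 (- e) f y = - dir1 e f y" "dir2 (- e) f y = dir2 e f y" for y
      by (simp_all add: dir1_def dir2_def sum_negf)
    define D where "D m t = (if m = 0 then f (x + t *\<^sub>R e) + f (x + t *\<^sub>R (- e))
        else if m = 1 then dir1 e f (x + t *\<^sub>R e) + dir1 (- e) f (x + t *\<^sub>R (- e))
        else dir2 e f (x + t *\<^sub>R e) + dir2 (- e) f (x + t *\<^sub>R (- e)))" for m :: nat and t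
    have "(D m has_real_derivative D (Suc m) t) (at t)" if "m < 2" for m t
    proof (cases "m = 0")
      case True
      then show ?thesis unfolding D_def using DERIV_add[OF dir1_line[OF C2_C1(1)[OF f(1)], of x e t] dir1_line[OF C2_C1(1)[OF f(1)], of x "- e" t]]
        by simp
    next
      case False
      then have "m = 1" using that by simp
      then show ?thesis unfolding D_def using DERIV_add[OF dir2_line[OF f(1), of e x t] dir2_line[OF f(1), of "- e" x t]]
        by simp
    qed
    then have "\<forall>m t. m < 2 \<and> 0 \<le> t \<and> t \<le> h \<longrightarrow> (D m has_real_derivative D (Suc m) t) (at t)" by blast
    from Maclaurin[OF h(1) _ refl this]
    obtain t where t: "0 < t" "t < h" "D 0 h = (\<Sum>m<2. D m 0 / fact m * h ^ m) + D 2 t / fact 2 * h ^ 2"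
      by auto
    have "(\<Sum>m<2. D m 0 / fact m * h ^ m) = D 0 0 + D 1 0 * h" by (simp add: numeral_2_eq_2)
    then have "D 0 h = D 0 0 + D 1 0 * h + D 2 t / 2 * h\<^sup>2" using t(3) by simp
    then have "f (x + h *\<^sub>R e) + f (x - h *\<^sub>R e) - 2 * f x = (dir2 e f (x + t *\<^sub>R e) + dir2 e f (x - t *\<^sub>R e)) / 2 * h\<^sup>2"
      by (simp add: D_def flip field_simps)
    then have eq: "(f (x + h *\<^sub>R e) + f (x - h *\<^sub>R e) - 2 * f x) / h\<^sup>2
        = (dir2 e f (x + t *\<^sub>R e) + dir2 e f (x - t *\<^sub>R e)) / 2" using h by simp
    have "t * norm e \<le> h * (norm e + 1)" using t by (intro mult_mono) auto
    also have "\<dots> < d" using h pos_less_divide_eq[of "norm e + 1" h d] by (simp add: add_nonneg_pos)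
    finally have "dist (x + t *\<^sub>R e) x < d" "dist (x - t *\<^sub>R e) x < d" using t by (simp_all add: dist_norm)
    then show ?thesis unfolding eq using d(2)[of "x + t *\<^sub>R e" x] d(2)[of "x - t *\<^sub>R e" x] by (simp add: abs_less_iff field_simps)
  qed
  moreover have "0 < d / (norm e + 1)" using d(1) by (simp add: add_nonneg_pos)
  ultimately show ?thesis using that by blast
qed

section \<open>Translation invariance and integration by parts\<close>

lemma lborel_integral_translate_measurable:
  fixes f :: "'a::euclidean_space \<Rightarrow> real"
  assumes "f \<in> borel_measurable borel"
  shows "(\<integral>x. f (x + a) \<partial>lborel) = (\<integral>x. f x \<partial>lborel)"
proof -
  have "(\<integral>x. f x \<partial>lborel) = (\<integral>x. f x \<partial>distr lborel borel ((+) a))"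
    by (simp only: lborel_distr_plus)
  also have "\<dots> = (\<integral>x. f (a + x) \<partial>lborel)" by (rule integral_distr) (use assms in auto)
  finally show ?thesis by (simp add: add.commute)
qed

lemma lborel_integral_translate:
  fixes f :: "'a::euclidean_space \<Rightarrow> real"
  assumes "continuous_on UNIV f"
  shows "(\<integral>x. f (x + a) \<partial>lborel) = (\<integral>x. f x \<partial>lborel)"
  by (rule lborel_integral_translate_measurable[OF borel_measurable_continuous_onI[OF assms]])

text \<open>Translation invariance makes the integral of every difference quotient zero, and the
  quotients converge uniformly with supports in a fixed ball.\<close>

lemma integral_partial_eq_0:
  fixes f :: "real^'n \<Rightarrow> real"
  assumes f: "C1 f" "supp_ball R f"
  shows "(\<integral>x. partial j f x \<partial>lborel) = 0"
proof (rule ccontr)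
  let ?V = "measure lebesgue (cball (0::real^'n) (R + 1))"
  assume "(\<integral>x. partial j f x \<partial>lborel) \<noteq> 0"
  then have pos: "0 < \<bar>\<integral>x. partial j f x \<partial>lborel\<bar>" by simp
  \<comment> \<open>Small enough that an error \<epsilon> over the ball of radius R + 1 stays below
    the supposed nonzero value.\<close>
  define \<epsilon> where "\<epsilon> = \<bar>\<integral>x. partial j f x \<partial>lborel\<bar> / (?V + 1)"
  have e: "0 < \<epsilon>" unfolding \<epsilon>_def using pos by (intro divide_pos_pos) (auto intro: add_nonneg_pos)
  have d1: "dir1 (axis j 1) f = partial j f"
    by (rule ext) (simp add: dir1_def axis_def if_distrib[of "\<lambda>c. c * _"] cong: if_cong)
  obtain d where d: "0 < d" "\<And>h x. 0 < h \<Longrightarrow> h < d \<Longrightarrow> \<bar>(f (x + h *\<^sub>R axis j 1) - f x) / h - partial j f x\<bar> < \<epsilon>"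
    using difference_quotient_uniform[OF f e, of "axis j 1"] unfolding d1 by metis
  define h where "h = min (d / 2) 1"
  have h: "0 < h" "h < d" "h \<le> 1" using d(1) by (auto simp: h_def)
  have c: "continuous_on UNIV f" using f C1_continuous by blast
  have c': "continuous_on UNIV (\<lambda>x. f (x + h *\<^sub>R axis j 1))"
    by (intro continuous_on_compose2[OF c] continuous_intros) auto
  have s': "supp_ball (R + 1) (\<lambda>x. f (x + h *\<^sub>R axis j 1))" unfolding supp_ball_def
  proof (intro allI impI)
    fix x :: "real^'n" assume "R + 1 < norm x"
    moreover have "norm x \<le> norm (x + h *\<^sub>R axis j 1) + norm (h *\<^sub>R axis j 1 :: real^'n)"
      by (metis add_diff_cancel norm_triangle_ineq4)
    ultimately have "R < norm (x + h *\<^sub>R axis j 1)" using h by simp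
    then show "f (x + h *\<^sub>R axis j 1) = 0" using f(2) by (simp add: supp_ball_def)
  qed
  have s: "supp_ball (R + 1) f" "supp_ball (R + 1) (partial j f)"
    using supp_ball_mono[OF f(2), of "R + 1"] supp_ball_mono[OF supp_ball_partial[OF f(2)], of "R + 1"] by simp_all
  note i = integrable_continuous_supp_ball[OF c s(1)] integrable_continuous_supp_ball[OF c' s']
    integrable_continuous_supp_ball[OF C1_continuous_partial[OF f(1)] s(2)]
  have "(\<integral>x. (f (x + h *\<^sub>R axis j 1) - f x) / h - partial j f x \<partial>lborel)
      = - (\<integral>x. partial j f x \<partial>lborel)"
    using i by (simp add: lborel_integral_translate[OF c])
  moreover have "\<bar>\<integral>x. (f (x + h *\<^sub>R axis j 1) - f x) / h - partial j f x \<partial>lborel\<bar> \<le> \<epsilon> * ?V"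
  proof (rule integral_bound_supp_ball)
    show "continuous_on UNIV (\<lambda>x. (f (x + h *\<^sub>R axis j 1) - f x) / h - partial j f x)"
      using h by (intro continuous_intros c c' C1_continuous_partial f) auto
    show "supp_ball (R + 1) (\<lambda>x. (f (x + h *\<^sub>R axis j 1) - f x) / h - partial j f x)"
      using s s' by (simp add: supp_ball_def)
  qed (use d(2)[OF h(1,2)] in \<open>auto intro: less_imp_le\<close>)
  ultimately have "\<bar>\<integral>x. partial j f x \<partial>lborel\<bar> \<le> \<epsilon> * ?V" by simp
  also have "\<dots> < \<epsilon> * (?V + 1)" using e by simp
  also have "\<dots> = \<bar>\<integral>x. partial j f x \<partial>lborel\<bar>"
    unfolding \<epsilon>_def by (simp add: add_nonneg_eq_0_iff)
  finally show False by simp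
qed

lemma integral_by_parts_supp_ball:
  fixes f g :: "real^'n \<Rightarrow> real"
  assumes f: "C1 f" "supp_ball R f" and g: "C1 g"
  shows "(\<integral>x. f x * partial j g x \<partial>lborel) = - (\<integral>x. partial j f x * g x \<partial>lborel)"
proof -
  have "integrable lborel (\<lambda>x. f x * partial j g x)" "integrable lborel (\<lambda>x. partial j f x * g x)"
    by (rule integrable_continuous_supp_ball[where R=R];
        intro continuous_intros C1_continuous C1_continuous_partial supp_ball_mult supp_ball_partial f g)+
  then show ?thesis
    using integral_partial_eq_0[OF C1_mult(1)[OF f(1) g] supp_ball_mult(1)[OF f(2)], of j]
    by (simp add: C1_mult(2)[OF f(1) g])
qed

section \<open>Semi-discrete Monge--Ampere\<close>

lemma continuous_on_Max_image:
  fixes \<phi> :: "'a \<Rightarrow> 'b::topological_space \<Rightarrow> real"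
  assumes "finite X" "X \<noteq> {}" "\<And>x. x \<in> X \<Longrightarrow> continuous_on S (\<phi> x)"
  shows "continuous_on S (\<lambda>p. Max ((\<lambda>x. \<phi> x p) ` X))"
  using assms
proof (induction X rule: finite_ne_induct)
  case (insert x F)
  then have "continuous_on S (\<lambda>p. max (\<phi> x p) (Max ((\<lambda>x. \<phi> x p) ` F)))"
    by (intro continuous_on_max) auto
  then show ?case using insert.hyps by simp
qed simp

definition unit_cube :: "(real^'n) set" where "unit_cube = cbox (-1) 1"

lemma unit_cube_measure: "measure lebesgue (unit_cube :: (real^'n) set) = 2 ^ CARD('n)"
  by (simp add: unit_cube_def content_cbox_cart interval_ne_empty_cart)

lemma inner_le_unit_cube:
  fixes x :: "real^'n"
  assumes "p \<in> unit_cube" shows "\<bar>p \<bullet> x\<bar> \<le> (\<Sum>i\<in>UNIV. \<bar>x $ i\<bar>)"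
proof -
  have "\<bar>p \<bullet> x\<bar> \<le> (\<Sum>i\<in>UNIV. \<bar>p $ i * x $ i\<bar>)" by (simp add: inner_vec_def sum_abs)
  also have "\<dots> \<le> (\<Sum>i\<in>UNIV. \<bar>x $ i\<bar>)"
  proof (rule sum_mono)
    fix i
    have "\<bar>p $ i\<bar> \<le> 1" using assms by (auto simp: unit_cube_def mem_box_cart abs_le_iff minus_le_iff)
    then show "\<bar>p $ i * x $ i\<bar> \<le> \<bar>x $ i\<bar>" by (simp add: abs_mult mult_left_le_one_le)
  qed
  finally show ?thesis .
qed

text \<open>The minimiser of the convex function \<open>E\<close> below is the dual potential of semi-discrete
  optimal transport; its first-order condition says that the Laguerre cell of each \<open>x\<close> has at
  least the prescribed volume.\<close>

lemma semidiscrete_monge_ampere: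
  fixes X :: "(real^'n) set" and f :: "real^'n \<Rightarrow> real"
  assumes X: "finite X" "X \<noteq> {}" and fpos: "\<And>x. x \<in> X \<Longrightarrow> 0 < f x"
    and fsum: "(\<Sum>x\<in>X. f x) \<le> 2 ^ CARD('n)"
  obtains u where "u 0 = 0" "\<And>x y. \<bar>u x - u y\<bar> \<le> (\<Sum>i\<in>UNIV. \<bar>x $ i - y $ i\<bar>)"
    "\<And>x e. 2 * u x \<le> u (x + e) + u (x - e)"
    "\<And>x. x \<in> X \<Longrightarrow> f x \<le> measure lebesgue {p \<in> unit_cube. \<forall>y. u x + p \<bullet> (y - x) \<le> u y}"
proof -
  let ?V = "2 ^ CARD('n) :: real"
  let ?K = "unit_cube :: (real^'n) set"
  have Kc: "compact ?K" by (simp add: unit_cube_def)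
  have K0: "0 \<in> ?K" by (simp add: unit_cube_def mem_box_cart)
  define S where "S = (\<Sum>x\<in>X. f x)"
  have S: "0 < S" "S \<le> ?V" unfolding S_def using X fpos fsum by (auto intro: sum_pos)
  \<comment> \<open>The masses are scaled up to total exactly the volume 2^d of the cube of slopes.
    This balance makes \<open>E\<close> invariant under adding constants to \<open>h\<close>, and
    the bound for \<open>g\<close> implies the one for \<open>f\<close>.\<close>
  define g where "g x = f x * (?V / S)" for x
  have gpos: "0 < g x" "f x \<le> g x" if "x \<in> X" for x
    using fpos[OF that] S by (auto simp: g_def field_simps)
  have gsum: "(\<Sum>x\<in>X. g x) = ?V"
    unfolding g_def sum_distrib_right[symmetric] S_def[symmetric] using S by simp
  \<comment> \<open>Legendre transform of the finite datum \<open>h\<close> on \<open>X\<close>: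
    convex and piecewise affine in the slope, with one piece per atom.\<close>
  define M where "M h p = Max ((\<lambda>x. p \<bullet> x - h x) ` X)" for h and p :: "real^'n"
  have Mge: "p \<bullet> x - h x \<le> M h p" if "x \<in> X" for h p x
    unfolding M_def using X(1) that by auto
  have Mle: "M h p \<le> c" if "\<And>x. x \<in> X \<Longrightarrow> p \<bullet> x - h x \<le> c" for h p c
    unfolding M_def using X that by auto
  have Mcont: "continuous_on T (M h)" for T h
    unfolding M_def by (intro continuous_on_Max_image X continuous_intros)
  have Mint: "M h integrable_on ?K" for h
    unfolding unit_cube_def by (rule integrable_continuous[OF Mcont])
  define E where "E h = integral ?K (M h) + (\<Sum>x\<in>X. g x * h x)" for h
  have const: "integral ?K (\<lambda>p. c) = c * ?V" "(\<lambda>p. c) integrable_on ?K" for c :: real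
    using unit_cube_measure[where 'n='n] integrable_const[of c "-1" "1::real^'n"] by (simp_all add: unit_cube_def)
  have Emono: "integral ?K (M h) \<le> integral ?K (M h') + c * ?V"
    if "\<And>p. p \<in> ?K \<Longrightarrow> M h p \<le> M h' p + c" for h h' c
  proof -
    have "integral ?K (M h) \<le> integral ?K (\<lambda>p. M h' p + c)"
      by (rule integral_le) (use that Mint const in \<open>auto intro: integrable_add\<close>)
    then show ?thesis using Mint const by (simp add: Henstock_Kurzweil_Integration.integral_add)
  qed
  have Eshift: "E (\<lambda>x. h x - c) = E h" for h c
  proof -
    have "M (\<lambda>x. h x - c) = (\<lambda>p. M h p + c)"
    proof
      fix p show "M (\<lambda>x. h x - c) p = M h p + c"
      by (intro antisym Mle) (use Mge[of _ p h] Mge[of _ p "\<lambda>x. h x - c"] Mle[of p h "M (\<lambda>x. h x - c) p - c"] in force)+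
    qed
    then show ?thesis unfolding E_def using Mint const gsum
      by (simp add: Henstock_Kurzweil_Integration.integral_add algebra_simps sum_subtractf sum_distrib_left[symmetric])
  qed
  have Econg: "E h = E h'" if "\<And>x. x \<in> X \<Longrightarrow> h x = h' x" for h h'
  proof -
    have "M h = M h'" unfolding M_def using that by (intro ext arg_cong[of _ _ Max] image_cong) auto
    then show ?thesis unfolding E_def using that by simp
  qed
  define c1 where "c1 = (\<Sum>x\<in>X. \<Sum>i\<in>UNIV. \<bar>x $ i\<bar>)"
  have c1: "\<bar>p \<bullet> x\<bar> \<le> c1" if "p \<in> ?K" "x \<in> X" for p x
    using inner_le_unit_cube[OF that(1), of x] member_le_sum[of x X "\<lambda>x. \<Sum>i\<in>UNIV. \<bar>x $ i\<bar>"] X(1) that(2)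
    by (force simp: c1_def intro: sum_nonneg)
  \<comment> \<open>Coercivity after normalisation: once the least value of \<open>h\<close> is 0,
    the integral part is bounded below, and a large value at any atom makes \<open>E\<close>
    large.\<close>
  have Elow: "E h \<ge> g x * h x - c1 * ?V" if h: "\<And>x. x \<in> X \<Longrightarrow> 0 \<le> h x" "z \<in> X" "h z = 0" and x: "x \<in> X" for h z x
  proof -
    have "integral ?K (\<lambda>p. - c1) \<le> integral ?K (M h)"
    proof (rule integral_le[OF const(2) Mint])
      fix p assume "p \<in> ?K"
      then show "- c1 \<le> M h p" using c1[OF _ h(2), of p] Mge[OF h(2), of p h] h(3) by linarith
    qed
    then have "- c1 * ?V \<le> integral ?K (M h)" by (simp only: const)
    moreover have "g x * h x \<le> (\<Sum>x\<in>X. g x * h x)"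
      using X(1) x h(1) gpos by (intro member_le_sum) (auto intro: mult_nonneg_nonneg less_imp_le)
    ultimately show ?thesis by (simp add: E_def)
  qed
  \<comment> \<open>Beyond the level \<open>b\<close> coercivity pushes \<open>E\<close> above its
    value at 0, so a minimiser over the box with sides [0, b] is a global one.\<close>
  define b where "b = (\<Sum>x\<in>X. (\<bar>E (\<lambda>x. 0)\<bar> + c1 * ?V) / g x)"
  have c10: "0 \<le> c1" by (simp add: c1_def sum_nonneg)
  have bge: "\<bar>E (\<lambda>x. 0)\<bar> + c1 * ?V \<le> g x * b" if "x \<in> X" for x
  proof -
    have "(\<bar>E (\<lambda>x. 0)\<bar> + c1 * ?V) / g x \<le> b"
      unfolding b_def using X(1) that gpos c10 by (intro member_le_sum) (auto intro!: divide_nonneg_pos)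
    then show ?thesis using gpos[OF that] by (simp add: pos_divide_le_eq mult.commute)
  qed
  have b0: "0 \<le> b" unfolding b_def using gpos c10 by (intro sum_nonneg divide_nonneg_pos) auto
  \<comment> \<open>Coordinates outside \<open>X\<close> are frozen at 0, which makes the box
    compact in the product topology on all functions.\<close>
  let ?S = "\<lambda>x. if x \<in> X then {0..b} else {0::real}"
  define Hs where "Hs = PiE UNIV ?S"
  have "compactin (product_topology (\<lambda>i. euclidean) UNIV) Hs"
    unfolding Hs_def compactin_PiE by auto
  then have "compact Hs" by (simp add: euclidean_product_topology)
  moreover have "Hs \<noteq> {}" unfolding Hs_def using b0 by (auto simp: PiE_eq_empty_iff)
  moreover have "continuous_on Hs E"
  proof -
    have diff: "\<bar>E h - E h'\<bar> \<le> (\<Sum>x\<in>X. (?V + g x) * \<bar>h x - h' x\<bar>)" for h h'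
    proof -
      have 1: "integral ?K (M h) \<le> integral ?K (M h') + (\<Sum>x\<in>X. \<bar>h x - h' x\<bar>) * ?V" for h h'
      proof (rule Emono, rule Mle)
        fix p x assume x: "x \<in> X"
        have "\<bar>h x - h' x\<bar> \<le> (\<Sum>x\<in>X. \<bar>h x - h' x\<bar>)" using X(1) x by (intro member_le_sum) auto
        then show "p \<bullet> x - h x \<le> M h' p + (\<Sum>x\<in>X. \<bar>h x - h' x\<bar>)" using Mge[OF x, of p h'] by linarith
      qed
      have "\<bar>(\<Sum>x\<in>X. g x * h x) - (\<Sum>x\<in>X. g x * h' x)\<bar> \<le> (\<Sum>x\<in>X. \<bar>g x * h x - g x * h' x\<bar>)"
        unfolding sum_subtractf[symmetric] by (rule sum_abs)
      also have "\<dots> = (\<Sum>x\<in>X. g x * \<bar>h x - h' x\<bar>)"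
        using gpos(1) by (intro sum.cong) (auto simp: abs_mult right_diff_distrib[symmetric] less_imp_le)
      finally have 2: "\<bar>(\<Sum>x\<in>X. g x * h x) - (\<Sum>x\<in>X. g x * h' x)\<bar> \<le> (\<Sum>x\<in>X. g x * \<bar>h x - h' x\<bar>)" .
      have 3: "(\<Sum>x\<in>X. (?V + g x) * \<bar>h x - h' x\<bar>) = (\<Sum>x\<in>X. \<bar>h x - h' x\<bar>) * ?V + (\<Sum>x\<in>X. g x * \<bar>h x - h' x\<bar>)"
        unfolding sum_distrib_right sum.distrib[symmetric] by (intro sum.cong refl) algebra
      have 4: "(\<Sum>x\<in>X. \<bar>h' x - h x\<bar>) = (\<Sum>x\<in>X. \<bar>h x - h' x\<bar>)" by (simp add: abs_minus_commute)
      show ?thesis using 1[of h h'] 1[of h' h, unfolded 4] 2 unfolding 3 E_def by linarith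
    qed
    show ?thesis unfolding continuous_on_def
    proof
      fix h assume "h \<in> Hs"
      have "((\<lambda>h'. \<Sum>x\<in>X. (?V + g x) * \<bar>h' x - h x\<bar>) \<longlongrightarrow> (\<Sum>x\<in>X. (?V + g x) * \<bar>h x - h x\<bar>)) (at h within Hs)"
      proof (intro tendsto_intros)
        fix x
        have "continuous_on Hs (\<lambda>h. h x)" by (rule continuous_on_subset[OF continuous_on_product_coordinates]) simp
        then show "((\<lambda>h. h x) \<longlongrightarrow> h x) (at h within Hs)" using \<open>h \<in> Hs\<close> by (simp add: continuous_on_def)
      qed
      then have lim: "((\<lambda>h'. \<Sum>x\<in>X. (?V + g x) * \<bar>h' x - h x\<bar>) \<longlongrightarrow> 0) (at h within Hs)" by simp
      have "((\<lambda>h'. E h' - E h) \<longlongrightarrow> 0) (at h within Hs)"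
        by (rule Lim_null_comparison[OF _ lim]) (use diff in auto)
      then show "(E \<longlongrightarrow> E h) (at h within Hs)" using LIM_zero_iff by blast
    qed
  qed
  ultimately obtain h where h: "h \<in> Hs" "\<And>h'. h' \<in> Hs \<Longrightarrow> E h \<le> E h'"
    using continuous_attains_inf[of Hs E] by blast
  have Emin: "E h \<le> E h'" for h'
  proof -
    define c where "c = Min (h' ` X)"
    define h'' where "h'' x = (if x \<in> X then h' x - c else 0)" for x
    have "c \<in> h' ` X" unfolding c_def using X by (intro Min_in) auto
    then obtain z where z: "z \<in> X" "h'' z = 0" by (auto simp: h''_def)
    have nn: "0 \<le> h'' x" if "x \<in> X" for x using that X(1) by (simp add: h''_def c_def)
    have E': "E h'' = E h'"
      using Econg[of h'' "\<lambda>x. h' x - c"] Eshift[of h' c] by (simp add: h''_def)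
    show ?thesis
    proof (cases "\<forall>x\<in>X. h'' x \<le> b")
      case True
      then have "h'' \<in> Hs" unfolding Hs_def using nn by (auto simp: h''_def)
      then show ?thesis using h(2) E' by fastforce
    next
      case False
      then obtain x where x: "x \<in> X" "b < h'' x" by force
      have "(\<lambda>x. 0) \<in> Hs" unfolding Hs_def using b0 by auto
      then have "E h \<le> \<bar>E (\<lambda>x. 0)\<bar>" using h(2) by fastforce
      also have "\<dots> \<le> g x * b - c1 * ?V" using bge[OF x(1)] by simp
      also have "\<dots> \<le> g x * h'' x - c1 * ?V" using x gpos[OF x(1)] by simp
      also have "\<dots> \<le> E h''" by (rule Elow[of h'' z x]) (use nn z x(1) in auto)
      finally show ?thesis using E' by simp
    qed
  qed
  \<comment> \<open>Slopes at which \<open>x\<close> is optimal up to \<open>t\<close>;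
    \<open>C x 0\<close> is the Laguerre cell of \<open>x\<close>.\<close>
  define C where "C x t = {p \<in> ?K. M h p \<le> p \<bullet> x - h x + t}" for x t
  have Cc: "compact (C x t)" for x t
  proof -
    have "C x t = ?K \<inter> {p. M h p \<le> p \<bullet> x - h x + t}" by (auto simp: C_def)
    moreover have "closed {p. M h p \<le> p \<bullet> x - h x + t}"
      by (intro closed_Collect_le Mcont continuous_intros)
    ultimately show ?thesis using Kc by (simp add: compact_Int_closed)
  qed
  have Ct: "g x \<le> measure lebesgue (C x t)" if x: "x \<in> X" and t: "0 < t" for x t
  proof -
    \<comment> \<open>Lowering \<open>h x\<close> by \<open>t\<close> raises the maximum by at most
      \<open>t\<close>, and only for slopes in \<open>C x t\<close>, while the linear term drops by
      \<open>t * g x\<close>. Minimality under this finite variation gives the volume bound, and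
      \<open>E\<close> is never differentiated.\<close>
    define h' where "h' = h(x := h x - t)"
    have CK: "C x t \<inter> ?K = C x t" by (auto simp: C_def)
    have ind: "indicat_real (C x t) integrable_on ?K" "integral ?K (indicat_real (C x t)) = measure lebesgue (C x t)"
      using lmeasurable_compact[OF Cc, of x t] by (simp_all add: integrable_on_indicator integral_indicator CK)
    have "M h' p \<le> M h p + t * indicat_real (C x t) p" if p: "p \<in> ?K" for p
    proof (rule Mle)
      fix y assume y: "y \<in> X"
      show "p \<bullet> y - h' y \<le> M h p + t * indicat_real (C x t) p"
        using Mge[OF y, of p h] t p by (auto simp: h'_def C_def indicator_def)
    qed
    then have "integral ?K (M h') \<le> integral ?K (\<lambda>p. M h p + t * indicat_real (C x t) p)"
      by (intro integral_le Mint integrable_add integrable_on_mult_right ind)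
    also have "\<dots> = integral ?K (M h) + t * measure lebesgue (C x t)"
      using Mint ind by (simp add: Henstock_Kurzweil_Integration.integral_add integrable_on_mult_right)
    finally have 1: "integral ?K (M h') \<le> integral ?K (M h) + t * measure lebesgue (C x t)" .
    have "(\<Sum>y\<in>X. g y * h' y) = (\<Sum>y\<in>X. g y * h y - (if y = x then g x * t else 0))"
      by (intro sum.cong) (auto simp: h'_def algebra_simps)
    also have "\<dots> = (\<Sum>y\<in>X. g y * h y) - g x * t" using x X(1) by (simp add: sum_subtractf)
    finally have "t * g x \<le> t * measure lebesgue (C x t)" using 1 Emin[of h'] by (simp add: E_def mult.commute)
    then show ?thesis using t by simp
  qed
  have C0: "g x \<le> measure lebesgue (C x 0)" if x: "x \<in> X" for x
  proof -
    \<comment> \<open>Continuity of the measure from above lets the tolerance shrink to 0.\<close>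
    have "(\<lambda>n. measure lebesgue (C x (1 / real (Suc n)))) \<longlonglongrightarrow> measure lebesgue (\<Inter>n. C x (1 / real (Suc n)))"
    proof (rule Lim_measure_decseq)
      show "range (\<lambda>n. C x (1 / real (Suc n))) \<subseteq> sets lebesgue"
        using lmeasurable_compact[OF Cc] fmeasurableD by blast
      show "decseq (\<lambda>n. C x (1 / real (Suc n)))"
        unfolding decseq_def C_def by (auto intro: order_trans simp: frac_le)
      show "emeasure lebesgue (C x (1 / real (Suc n))) \<noteq> \<infinity>" for n
        using fmeasurableD2[OF lmeasurable_compact[OF Cc]] by (metis infinity_ennreal_def)
    qed
    moreover have "(\<Inter>n. C x (1 / real (Suc n))) = C x 0"
    proof (intro equalityI subsetI)
      fix p assume p: "p \<in> (\<Inter>n. C x (1 / real (Suc n)))"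
      have lim: "(\<lambda>n. p \<bullet> x - h x + 1 / real (Suc n)) \<longlonglongrightarrow> p \<bullet> x - h x + 0"
        by (intro tendsto_intros LIMSEQ_Suc[OF lim_1_over_n])
      have "M h p \<le> p \<bullet> x - h x + 0"
        by (rule LIMSEQ_le_const[OF lim]) (use p in \<open>auto simp: C_def\<close>)
      then show "p \<in> C x 0" using p by (auto simp: C_def)
    qed (auto simp: C_def intro: order_trans)
    ultimately have "(\<lambda>n. measure lebesgue (C x (1 / real (Suc n)))) \<longlonglongrightarrow> measure lebesgue (C x 0)" by simp
    then show ?thesis by (rule LIMSEQ_le_const) (use Ct[OF x] in auto)
  qed
  \<comment> \<open>Transforming back over the cube gives a convex function with slopes in the cube.
    It lies below \<open>h\<close> on \<open>X\<close>, so every slope in the Laguerre cell of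
    \<open>x\<close> supports it at \<open>x\<close>.\<close>
  define u where "u y = (SUP p\<in>?K. p \<bullet> y - M h p)" for y
  have bdd: "bdd_above ((\<lambda>p. p \<bullet> y - M h p) ` ?K)" for y
    by (intro bounded_imp_bdd_above compact_imp_bounded compact_continuous_image continuous_intros Mcont Kc)
  have uge: "p \<bullet> y - M h p \<le> u y" if "p \<in> ?K" for p y
    unfolding u_def using bdd that by (intro cSUP_upper2) auto
  have ule: "u y \<le> c" if "\<And>p. p \<in> ?K \<Longrightarrow> p \<bullet> y - M h p \<le> c" for y c
    unfolding u_def using K0 that by (intro cSUP_least) auto
  have lip: "u x \<le> u y + (\<Sum>i\<in>UNIV. \<bar>x $ i - y $ i\<bar>)" for x y
  proof (rule ule)
    fix p assume p: "p \<in> ?K"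
    have "p \<bullet> x = p \<bullet> y + p \<bullet> (x - y)" by (simp add: inner_diff_right)
    then show "p \<bullet> x - M h p \<le> u y + (\<Sum>i\<in>UNIV. \<bar>x $ i - y $ i\<bar>)"
      using uge[OF p, of y] inner_le_unit_cube[OF p, of "x - y"] by (simp add: abs_le_iff)
  qed
  have mid: "2 * u x \<le> u (x + e) + u (x - e)" for x e
  proof -
    have "u x \<le> (u (x + e) + u (x - e)) / 2"
    proof (rule ule)
      fix p assume p: "p \<in> ?K"
      show "p \<bullet> x - M h p \<le> (u (x + e) + u (x - e)) / 2"
        using uge[OF p, of "x + e"] uge[OF p, of "x - e"] by (simp add: inner_add_right inner_diff_right)
    qed
    then show ?thesis by simp
  qed
  have sub: "f x \<le> measure lebesgue {p \<in> ?K. \<forall>y. u x + p \<bullet> (y - x) \<le> u y}" if x: "x \<in> X" for x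
  proof -
    have "C x 0 \<subseteq> {p \<in> ?K. \<forall>y. u x + p \<bullet> (y - x) \<le> u y}"
    proof (intro subsetI CollectI conjI allI)
      fix p y assume p: "p \<in> C x 0"
      have "u x \<le> h x" using Mge[OF x, of _ h] by (intro ule) (simp add: algebra_simps)
      moreover have "p \<bullet> y - M h p \<le> u y" using p uge by (auto simp: C_def)
      ultimately show "u x + p \<bullet> (y - x) \<le> u y" using p by (auto simp: C_def inner_diff_right)
    qed (auto simp: C_def)
    moreover have "closed (\<Inter>y. {p. u x + p \<bullet> (y - x) \<le> u y})"
      by (intro closed_INT ballI closed_Collect_le continuous_intros)
    then have "compact (?K \<inter> (\<Inter>y. {p. u x + p \<bullet> (y - x) \<le> u y}))" using Kc by (rule compact_Int_closed[rotated])
    moreover have "?K \<inter> (\<Inter>y. {p. u x + p \<bullet> (y - x) \<le> u y}) = {p \<in> ?K. \<forall>y. u x + p \<bullet> (y - x) \<le> u y}" by auto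
    ultimately have "measure lebesgue (C x 0) \<le> measure lebesgue {p \<in> ?K. \<forall>y. u x + p \<bullet> (y - x) \<le> u y}"
      using lmeasurable_compact by (intro measure_mono_fmeasurable fmeasurableD lmeasurable_compact Cc) auto
    then show ?thesis using C0[OF x] gpos(2)[OF x] by simp
  qed
  show thesis
  proof (rule that[of "\<lambda>x. u x - u 0"])
    show "\<bar>(u x - u 0) - (u y - u 0)\<bar> \<le> (\<Sum>i\<in>UNIV. \<bar>x $ i - y $ i\<bar>)" for x y
      using lip[of x y] lip[of y x] by (simp add: abs_le_iff abs_minus_commute)
    show "2 * (u x - u 0) \<le> u (x + e) - u 0 + (u (x - e) - u 0)" for x e using mid[of x e] by simp
    show "f x \<le> measure lebesgue {p \<in> ?K. \<forall>y. u x - u 0 + p \<bullet> (y - x) \<le> u y - u 0}" if "x \<in> X" for x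
      using sub[OF that] by (simp add: algebra_simps)
  qed simp
qed

section \<open>Convex potentials\<close>

text \<open>The l1 Lipschitz bound expresses that all slopes lie in \<open>unit_cube\<close>, and
  convexity is kept in the midpoint form that second differences use. The value at 0 bounds all
  potentials simultaneously on bounded sets.\<close>

definition convex_potential :: "(real^'n \<Rightarrow> real) \<Rightarrow> bool" where
  "convex_potential u \<longleftrightarrow> u 0 = 0 \<and> (\<forall>x y. \<bar>u x - u y\<bar> \<le> (\<Sum>i\<in>UNIV. \<bar>x $ i - y $ i\<bar>)) \<and>
     (\<forall>x e. 2 * u x \<le> u (x + e) + u (x - e))"

lemma sum_abs_le_norm: "(\<Sum>i\<in>UNIV. \<bar>x $ i\<bar>) \<le> real CARD('n) * norm (x :: real^'n)"
  using sum_bounded_above[of UNIV "\<lambda>i. \<bar>x $ i\<bar>" "norm x"] component_le_norm_cart[of x] by simp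

lemma convex_potential_lipschitz:
  assumes "convex_potential u" shows "\<bar>u x - u y\<bar> \<le> real CARD('n) * dist x (y :: real^'n)"
  using assms sum_abs_le_norm[of "x - y"] unfolding convex_potential_def dist_norm
  by (force intro: order_trans)

lemma convex_potential_bound:
  assumes "convex_potential u" shows "\<bar>u x\<bar> \<le> real CARD('n) * norm (x :: real^'n)"
  using convex_potential_lipschitz[OF assms, of x 0] assms by (simp add: convex_potential_def)

lemma convex_potential_continuous: "convex_potential u \<Longrightarrow> continuous_on S u"
  by (rule lipschitz_on_continuous_on[OF lipschitz_onI, of _ u "real CARD('a)"])
    (auto simp: dist_real_def intro: convex_potential_lipschitz)

lemma convex_potential_pairing_bound:
  fixes u :: "real^'n \<Rightarrow> real"
  assumes u: "convex_potential u" and q: "continuous_on UNIV q" "supp_ball R q" "\<And>x. \<bar>q x\<bar> \<le> \<epsilon>" and "0 \<le> R"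
  shows "\<bar>\<integral>x. u x * q x \<partial>lborel\<bar> \<le> \<epsilon> * (real CARD('n) * R * measure lebesgue (cball (0::real^'n) R))"
proof -
  have "\<bar>\<integral>x. u x * q x \<partial>lborel\<bar> \<le> (real CARD('n) * R * \<epsilon>) * measure lebesgue (cball (0::real^'n) R)"
  proof (rule integral_bound_supp_ball)
    fix x
    show "\<bar>u x * q x\<bar> \<le> real CARD('n) * R * \<epsilon>"
    proof (cases "norm x \<le> R")
      case True
      have "\<bar>u x\<bar> \<le> real CARD('n) * R"
        by (rule order_trans[OF convex_potential_bound[OF u] mult_left_mono[OF True]]) simp
      then show ?thesis using q(3)[of x] \<open>0 \<le> R\<close> by (simp add: abs_mult mult_mono)
    next
      case False
      then show ?thesis using q(2) q(3)[of x] \<open>0 \<le> R\<close> by (simp add: supp_ball_def)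
    qed
  qed (use q convex_potential_continuous[OF u] in \<open>auto intro: continuous_intros supp_ball_mult\<close>)
  then show ?thesis by (simp add: algebra_simps)
qed

lemma supp_ball_translate:
  fixes a :: "'a::real_normed_vector"
  assumes "supp_ball R f" "norm a \<le> s" shows "supp_ball (R + s) (\<lambda>x. f (x + a))"
  unfolding supp_ball_def
proof (intro allI impI)
  fix x :: 'a assume "R + s < norm x"
  moreover have "norm x \<le> norm (x + a) + norm a" by (metis add_diff_cancel norm_triangle_ineq4)
  ultimately have "R < norm (x + a)" using assms(2) by simp
  then show "f (x + a) = 0" using assms(1) by (simp add: supp_ball_def)
qed

lemma le_if_le_add_eps_mult:
  fixes a b C :: real
  assumes "\<And>\<epsilon>. 0 < \<epsilon> \<Longrightarrow> a \<le> b + \<epsilon> * C" "0 \<le> C"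
  shows "a \<le> b"
proof (rule field_le_epsilon)
  fix e :: real assume e: "0 < e"
  have "a \<le> b + e / (C + 1) * C" using e assms(2) by (intro assms(1)) simp
  also have "\<dots> \<le> b + e" using e assms(2) by (simp add: field_simps)
  finally show "a \<le> b + e" .
qed

text \<open>Weak form of the bound 1 on each partial derivative of \<open>u\<close>: translation
  moves the difference quotient from \<open>b\<close> to \<open>u\<close>, where its size is at most
  1.\<close>

lemma convex_potential_partial_le:
  fixes u :: "real^'n \<Rightarrow> real"
  assumes u: "convex_potential u" and b: "C1 b" "supp_ball R b" "0 \<le> R"
  shows "(\<integral>x. u x * partial j b x \<partial>lborel) \<le> (\<integral>x. \<bar>b x\<bar> \<partial>lborel)"
proof (rule le_if_le_add_eps_mult)
  fix \<epsilon> :: real assume e: "0 < \<epsilon>"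
  let ?e = "axis j 1 :: real^'n"
  have d1: "dir1 ?e b = partial j b"
    by (rule ext) (simp add: dir1_def axis_def if_distrib[of "\<lambda>c. c * _"] cong: if_cong)
  obtain d where d: "0 < d" "\<And>h x. 0 < h \<Longrightarrow> h < d \<Longrightarrow> \<bar>(b (x + h *\<^sub>R ?e) - b x) / h - partial j b x\<bar> < \<epsilon>"
    using difference_quotient_uniform[OF b(1,2) e, of ?e] unfolding d1 by metis
  define h where "h = min (d / 2) 1"
  have h: "0 < h" "h < d" "h \<le> 1" using d(1) by (auto simp: h_def)
  note cu = convex_potential_continuous[OF u]
  have cb: "continuous_on S b" for S using C1_continuous[OF b(1)] continuous_on_subset by blast
  have cs: "continuous_on UNIV (\<lambda>x. b (x + h *\<^sub>R ?e))" "continuous_on UNIV (\<lambda>x. u (x - h *\<^sub>R ?e))"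
    by (rule continuous_on_compose2[OF cb] continuous_on_compose2[OF cu]; auto intro!: continuous_intros)+
  have s: "supp_ball (R + 1) (\<lambda>x. b (x + h *\<^sub>R ?e))" "supp_ball (R + 1) b" "supp_ball (R + 1) (partial j b)"
    using supp_ball_translate[OF b(2), of "h *\<^sub>R ?e" 1] h supp_ball_mono[OF b(2)] supp_ball_mono[OF supp_ball_partial[OF b(2)]] by auto
  define q where "q x = (b (x + h *\<^sub>R ?e) - b x) / h" for x
  have cq: "continuous_on UNIV q" unfolding q_def using h by (intro continuous_intros cs cb) auto
  have sq: "supp_ball (R + 1) q" using s by (simp add: q_def supp_ball_def)
  have cp: "continuous_on UNIV (partial j b)" by (rule C1_continuous_partial[OF b(1)])
  note int = integrable_continuous_supp_ball[OF _ supp_ball_mult(2)]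
  have i: "integrable lborel (\<lambda>x. u x * b x)" "integrable lborel (\<lambda>x. u x * b (x + h *\<^sub>R ?e))"
    "integrable lborel (\<lambda>x. u x * q x)" "integrable lborel (\<lambda>x. u x * partial j b x)"
    "integrable lborel (\<lambda>x. u (x - h *\<^sub>R ?e) * b x)"
    by (rule int[OF _ s(2)] int[OF _ s(1)] int[OF _ sq] int[OF _ s(3)], intro continuous_intros cu cb cs cq cp)+
  have ib: "integrable lborel b" by (rule integrable_continuous_supp_ball[OF cb s(2)])
  have "\<bar>\<integral>x. u x * (partial j b x - q x) \<partial>lborel\<bar>
      \<le> \<epsilon> * (real CARD('n) * (R + 1) * measure lebesgue (cball (0::real^'n) (R + 1)))"
    by (rule convex_potential_pairing_bound[OF u])
      (use d(2)[OF h(1,2)] \<open>0 \<le> R\<close> s(3) sq cp cq in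
        \<open>auto simp: q_def[symmetric] abs_minus_commute intro: less_imp_le continuous_intros supp_ball_diff\<close>)
  moreover have "(\<integral>x. u x * (partial j b x - q x) \<partial>lborel) = (\<integral>x. u x * partial j b x \<partial>lborel) - (\<integral>x. u x * q x \<partial>lborel)"
    using i by (simp add: right_diff_distrib)
  moreover have "(\<integral>x. u x * q x \<partial>lborel) \<le> (\<integral>x. \<bar>b x\<bar> \<partial>lborel)"
  proof -
    have "(\<integral>x. u x * q x \<partial>lborel) = (\<integral>x. (u x * b (x + h *\<^sub>R ?e) - u x * b x) / h \<partial>lborel)"
      by (simp add: q_def algebra_simps)
    also have "\<dots> = ((\<integral>x. u x * b (x + h *\<^sub>R ?e) \<partial>lborel) - (\<integral>x. u x * b x \<partial>lborel)) / h"
      using i by simp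
    also have "(\<integral>x. u x * b (x + h *\<^sub>R ?e) \<partial>lborel) = (\<integral>x. u (x - h *\<^sub>R ?e) * b x \<partial>lborel)"
      using lborel_integral_translate[of "\<lambda>x. u (x - h *\<^sub>R ?e) * b x" "h *\<^sub>R ?e"] cs cb
      by (simp add: continuous_on_mult)
    also have "((\<integral>x. u (x - h *\<^sub>R ?e) * b x \<partial>lborel) - (\<integral>x. u x * b x \<partial>lborel)) / h
        = (\<integral>x. (u (x - h *\<^sub>R ?e) * b x - u x * b x) / h \<partial>lborel)" using i by simp
    also have "\<dots> \<le> (\<integral>x. \<bar>b x\<bar> \<partial>lborel)"
    proof (rule Bochner_Integration.integral_mono)
      fix x
      have "\<bar>u (x - h *\<^sub>R ?e) - u x\<bar> \<le> (\<Sum>i\<in>UNIV. \<bar>(x - h *\<^sub>R ?e) $ i - x $ i\<bar>)"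
        using u unfolding convex_potential_def by blast
      also have "\<dots> = h" using h(1) by (simp add: axis_def if_distrib[of abs] if_distrib[of "\<lambda>c. h * c"] abs_mult cong: if_cong)
      finally have "\<bar>(u (x - h *\<^sub>R ?e) - u x) * b x\<bar> \<le> h * \<bar>b x\<bar>" by (simp add: abs_mult mult_right_mono)
      then have "(u (x - h *\<^sub>R ?e) - u x) * b x \<le> h * \<bar>b x\<bar>" by linarith
      then show "(u (x - h *\<^sub>R ?e) * b x - u x * b x) / h \<le> \<bar>b x\<bar>"
        using h(1) by (simp add: pos_divide_le_eq algebra_simps)
    qed (use i ib in auto)
    finally show ?thesis .
  qed
  ultimately show "(\<integral>x. u x * partial j b x \<partial>lborel) \<le> (\<integral>x. \<bar>b x\<bar> \<partial>lborel)
      + \<epsilon> * (real CARD('n) * (R + 1) * measure lebesgue (cball (0::real^'n) (R + 1)))" by linarith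
qed (use \<open>0 \<le> R\<close> in simp)

text \<open>Weak form of the positivity of the second derivative of \<open>u\<close> along
  \<open>e\<close>: translation moves the second difference from \<open>b\<close> to
  \<open>u\<close>, where midpoint convexity gives its sign.\<close>

lemma convex_potential_dir2_nonneg:
  fixes u :: "real^'n \<Rightarrow> real"
  assumes u: "convex_potential u" and b: "C2 b" "supp_ball R b" "0 \<le> R" "\<And>x. 0 \<le> b x"
  shows "0 \<le> (\<integral>x. u x * dir2 e b x \<partial>lborel)"
proof (rule le_if_le_add_eps_mult)
  fix \<epsilon> :: real assume eps: "0 < \<epsilon>"
  obtain d where d: "0 < d" "\<And>h x. 0 < h \<Longrightarrow> h < d \<Longrightarrow> \<bar>(b (x + h *\<^sub>R e) + b (x - h *\<^sub>R e) - 2 * b x) / h\<^sup>2 - dir2 e b x\<bar> < \<epsilon>"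
    using second_difference_uniform[OF b(1,2) eps, of e] by metis
  \<comment> \<open>Besides lying below \<open>d\<close>, the step satisfies
    \<open>h * norm e \<le> 1\<close>, so both translates of \<open>b\<close> are supported in
    radius R + 1.\<close>
  define h where "h = min (d / 2) (1 / (norm e + 1))"
  have ne: "0 < norm e + 1" by (simp add: add_nonneg_pos)
  have h: "0 < h" "h < d" using d(1) ne by (auto simp: h_def)
  have "h * norm e \<le> 1 / (norm e + 1) * (norm e + 1)" using h by (intro mult_mono) (auto simp: h_def)
  then have he: "norm (h *\<^sub>R e) \<le> 1" "norm (- (h *\<^sub>R e)) \<le> 1" using h ne by auto
  note cu = convex_potential_continuous[OF u]
  have cb: "continuous_on S b" for S using C2_continuous[OF b(1)] continuous_on_subset by blast
  have ct: "continuous_on UNIV (\<lambda>x. b (x + a))" "continuous_on UNIV (\<lambda>x. u (x + a))" for a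
    by (rule continuous_on_compose2[OF cb] continuous_on_compose2[OF cu]; auto intro!: continuous_intros)+
  have st: "supp_ball (R + 1) (\<lambda>x. b (x + h *\<^sub>R e))" "supp_ball (R + 1) (\<lambda>x. b (x + - (h *\<^sub>R e)))"
    "supp_ball (R + 1) b" "supp_ball (R + 1) (dir2 e b)"
    using supp_ball_translate[OF b(2) he(1)] supp_ball_translate[OF b(2) he(2)] supp_ball_mono[OF b(2)]
      supp_ball_mono[OF supp_ball_dir2[OF b(2)]] by auto
  define q where "q x = (b (x + h *\<^sub>R e) + b (x + - (h *\<^sub>R e)) - 2 * b x) / h\<^sup>2" for x
  have cq: "continuous_on UNIV q" unfolding q_def using h by (intro continuous_intros ct cb) auto
  have sq: "supp_ball (R + 1) q" using st by (simp add: q_def supp_ball_def)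
  have cp: "continuous_on UNIV (dir2 e b)" by (rule continuous_on_dir2[OF b(1)])
  note int = integrable_continuous_supp_ball[OF _ supp_ball_mult(2)]
  have i: "integrable lborel (\<lambda>x. u x * b x)" "integrable lborel (\<lambda>x. u x * b (x + h *\<^sub>R e))"
    "integrable lborel (\<lambda>x. u x * b (x + - (h *\<^sub>R e)))" "integrable lborel (\<lambda>x. u x * q x)"
    "integrable lborel (\<lambda>x. u x * dir2 e b x)"
    by (rule int[OF _ st(3)] int[OF _ st(1)] int[OF _ st(2)] int[OF _ sq] int[OF _ st(4)], intro continuous_intros cu cb ct cq cp)+
  have i2: "integrable lborel (\<lambda>x. u (x + a) * b x)" for a
    by (rule int[OF _ st(3)], intro continuous_intros cb ct)
  have "\<bar>\<integral>x. u x * (dir2 e b x - q x) \<partial>lborel\<bar>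
      \<le> \<epsilon> * (real CARD('n) * (R + 1) * measure lebesgue (cball (0::real^'n) (R + 1)))"
    by (rule convex_potential_pairing_bound[OF u])
      (use d(2)[OF h(1,2)] \<open>0 \<le> R\<close> st(4) sq cp cq in
        \<open>auto simp: q_def[simplified, symmetric] abs_minus_commute intro: less_imp_le continuous_intros supp_ball_diff\<close>)
  moreover have "(\<integral>x. u x * (dir2 e b x - q x) \<partial>lborel) = (\<integral>x. u x * dir2 e b x \<partial>lborel) - (\<integral>x. u x * q x \<partial>lborel)"
    using i by (simp add: right_diff_distrib)
  moreover have "0 \<le> (\<integral>x. u x * q x \<partial>lborel)"
  proof -
    have tr: "(\<integral>x. u x * b (x + a) \<partial>lborel) = (\<integral>x. u (x + - a) * b x \<partial>lborel)" for a
      using lborel_integral_translate[OF continuous_on_mult[OF ct(2)[of "- a"] cb], of a] by simp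
    have "(\<integral>x. u x * q x \<partial>lborel) = (\<integral>x. (u x * b (x + h *\<^sub>R e) + u x * b (x + - (h *\<^sub>R e)) - 2 * (u x * b x)) / h\<^sup>2 \<partial>lborel)"
      by (simp add: q_def algebra_simps)
    also have "\<dots> = ((\<integral>x. u x * b (x + h *\<^sub>R e) \<partial>lborel) + (\<integral>x. u x * b (x + - (h *\<^sub>R e)) \<partial>lborel) - 2 * (\<integral>x. u x * b x \<partial>lborel)) / h\<^sup>2"
      using i(1-3) by simp
    also have "\<dots> = (\<integral>x. (u (x + - (h *\<^sub>R e)) * b x + u (x + h *\<^sub>R e) * b x - 2 * (u x * b x)) / h\<^sup>2 \<partial>lborel)"
      unfolding tr using i2[of "h *\<^sub>R e"] i2[of "- (h *\<^sub>R e)"] i(1) by simp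
    also have "\<dots> \<ge> 0"
    proof (rule Bochner_Integration.integral_nonneg)
      fix x
      have "0 \<le> u (x + h *\<^sub>R e) + u (x + - (h *\<^sub>R e)) - 2 * u x"
        using u unfolding convex_potential_def by (simp add: algebra_simps)
      then have "0 \<le> b x * (u (x + h *\<^sub>R e) + u (x + - (h *\<^sub>R e)) - 2 * u x) / h\<^sup>2"
        using b(4) by (intro divide_nonneg_nonneg mult_nonneg_nonneg) auto
      then show "0 \<le> (u (x + - (h *\<^sub>R e)) * b x + u (x + h *\<^sub>R e) * b x - 2 * (u x * b x)) / h\<^sup>2"
        by (simp add: algebra_simps)
    qed
    finally show ?thesis .
  qed
  ultimately show "0 \<le> (\<integral>x. u x * dir2 e b x \<partial>lborel)
      + \<epsilon> * (real CARD('n) * (R + 1) * measure lebesgue (cball (0::real^'n) (R + 1)))" by linarith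
qed (use \<open>0 \<le> R\<close> in simp)

section \<open>A bump function and the double divergence\<close>

text \<open>At t = 0 the quotient still contains a positive power of t because at least two powers
  are present. Each derivative costs one power.\<close>

lemma DERIV_max_0_power:
  "((\<lambda>t::real. max 0 t ^ Suc (Suc k)) has_real_derivative real (Suc (Suc k)) * max 0 t ^ Suc k) (at t)"
proof -
  consider "t < 0" | "t = 0" | "0 < t" by linarith
  then show ?thesis
  proof cases
    case 1
    have "((\<lambda>t::real. 0::real) has_real_derivative 0) (at t)" by simp
    then have "((\<lambda>t::real. max 0 t ^ Suc (Suc k)) has_real_derivative 0) (at t)"
      by (rule has_field_derivative_transform_within_open[where S="{..<0}"]) (use 1 in auto)
    then show ?thesis using 1 by simp
  next
    case 2
    have "(\<lambda>h::real. max 0 h ^ Suc (Suc k) / h) \<midarrow>0\<rightarrow> 0"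
    proof (rule Lim_null_comparison)
      have "((\<lambda>h::real. \<bar>h\<bar> ^ Suc k) \<longlongrightarrow> \<bar>0\<bar> ^ Suc k) (at 0)" by (intro tendsto_intros)
      then show "((\<lambda>h::real. \<bar>h\<bar> ^ Suc k) \<longlongrightarrow> 0) (at 0)" by simp
      show "\<forall>\<^sub>F h::real in at 0. norm (max 0 h ^ Suc (Suc k) / h) \<le> \<bar>h\<bar> ^ Suc k"
      proof (intro always_eventually allI)
        fix h :: real
        show "norm (max 0 h ^ Suc (Suc k) / h) \<le> \<bar>h\<bar> ^ Suc k"
        proof (cases "h \<le> 0")
          case True
          then have "max 0 h = 0" by simp
          then show ?thesis by (simp only:) (simp add: zero_le_power del: power_Suc)
        qed (simp add: abs_mult)
      qed
    qed
    then show ?thesis using 2 by (simp add: DERIV_def)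
  next
    case 3
    have "((\<lambda>t::real. t ^ Suc (Suc k)) has_real_derivative real (Suc (Suc k)) * t ^ Suc k) (at t)"
      by (rule derivative_eq_intros refl)+ simp
    then have "((\<lambda>t::real. max 0 t ^ Suc (Suc k)) has_real_derivative real (Suc (Suc k)) * t ^ Suc k) (at t)"
      by (rule has_field_derivative_transform_within_open[where S="{0<..}"]) (use 3 in auto)
    then show ?thesis using 3 by simp
  qed
qed

text \<open>The third powers of the positive parts give two continuous derivatives. Positivity holds
  exactly on the open cube of side 1 about 0, so bumps centred at distinct integer points do not
  overlap.\<close>

definition bump :: "real^'n \<Rightarrow> real" where
  "bump x = (\<Prod>i\<in>UNIV. max 0 (1 - (2 * x $ i)\<^sup>2) ^ 3)"

lemma C2_bump: "C2 bump"
proof -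
  let ?m = "\<lambda>s::real. max 0 (1 - s\<^sup>2)"
  have q: "((\<lambda>s::real. 1 - s\<^sup>2) has_real_derivative - (2 * s)) (at s)" for s
    by (auto intro!: derivative_eq_intros)
  have m3: "((\<lambda>s. ?m s ^ 3) has_real_derivative - 6 * (s * ?m s ^ 2)) (at s)" for s
    using DERIV_chain2[OF DERIV_max_0_power[of 1] q[of s]] by (simp add: numeral_3_eq_3 numeral_2_eq_2 algebra_simps)
  have m2: "((\<lambda>s. ?m s ^ 2) has_real_derivative - 4 * (s * ?m s)) (at s)" for s
    using DERIV_chain2[OF DERIV_max_0_power[of 0] q[of s]] by (simp add: numeral_2_eq_2 algebra_simps)
  have m3': "((\<lambda>s. - 6 * (s * ?m s ^ 2)) has_real_derivative - 6 * (?m s ^ 2 + s * (- 4 * (s * ?m s)))) (at s)" for s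
    by (rule derivative_eq_intros m2 refl)+ simp
  have "C2 (\<lambda>x::real^'a. ?m (axis i 2 \<bullet> x + 0) ^ 3)" for i
    by (rule C2_compose_inner[OF m3 m3']) (intro continuous_intros)
  then have "C2 (\<lambda>x::real^'a. \<Prod>i\<in>UNIV. ?m (axis i 2 \<bullet> x + 0) ^ 3)" by (intro C2_prod)
  moreover have "(\<lambda>x::real^'a. \<Prod>i\<in>UNIV. ?m (axis i 2 \<bullet> x + 0) ^ 3) = bump"
    by (rule ext) (simp add: bump_def inner_axis')
  ultimately show ?thesis by simp
qed

lemma bump_nonneg: "0 \<le> bump x" unfolding bump_def by (intro prod_nonneg) simp

lemma bump_le_1: "bump x \<le> 1"
  unfolding bump_def by (intro prod_le_1) (auto intro!: power_le_one)

lemma bump_pos_iff: "0 < bump x \<longleftrightarrow> (\<forall>i. \<bar>x $ i\<bar> < 1 / 2)"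
proof -
  have "0 < bump x \<longleftrightarrow> bump x \<noteq> 0" using bump_nonneg[of x] by linarith
  also have "\<dots> \<longleftrightarrow> (\<forall>i. max 0 (1 - (2 * x $ i)\<^sup>2) \<noteq> 0)" by (simp add: bump_def)
  also have "\<dots> \<longleftrightarrow> (\<forall>i. (2 * x $ i)\<^sup>2 < 1)"
  proof -
    have "max 0 (1 - s) \<noteq> 0 \<longleftrightarrow> s < 1" for s :: real by (auto simp: max_def)
    then show ?thesis by metis
  qed
  also have "\<dots> \<longleftrightarrow> (\<forall>i. \<bar>x $ i\<bar> < 1 / 2)"
  proof -
    have "(2 * s)\<^sup>2 < 1 \<longleftrightarrow> \<bar>s\<bar> < 1 / 2" for s :: real
      using abs_square_less_1[of "2 * s"] by (auto simp: abs_mult)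
    then show ?thesis by simp
  qed
  finally show ?thesis .
qed

lemma supp_ball_bump_affine:
  assumes "0 < \<delta>"
  shows "supp_ball (norm a + real CARD('n) * \<delta>) (\<lambda>x::real^'n. bump ((1 / \<delta>) *\<^sub>R (x - a)))"
  unfolding supp_ball_def
proof (intro allI impI, rule ccontr)
  fix x :: "real^'n" assume x: "norm a + real CARD('n) * \<delta> < norm x" and "bump ((1 / \<delta>) *\<^sub>R (x - a)) \<noteq> 0"
  then have "0 < bump ((1 / \<delta>) *\<^sub>R (x - a))" using bump_nonneg less_eq_real_def by metis
  then have "\<bar>(x - a) $ i\<bar> \<le> \<delta>" for i using assms unfolding bump_pos_iff by (auto simp: abs_mult field_simps dest!: spec[of _ i])
  then have "(\<Sum>i\<in>UNIV. \<bar>(x - a) $ i\<bar>) \<le> real CARD('n) * \<delta>"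
    using sum_bounded_above[of UNIV "\<lambda>i. \<bar>(x - a) $ i\<bar>" \<delta>] by simp
  then have "norm (x - a) \<le> real CARD('n) * \<delta>" using norm_le_l1_cart order_trans by blast
  then show False using x norm_triangle_sub[of x a] by linarith
qed

definition bump_mass :: "'n::finite itself \<Rightarrow> real" where
  "bump_mass _ = (\<integral>x. bump (x :: real^'n) \<partial>lborel)"

lemma bump_supp: "supp_ball (real CARD('n)) (bump :: real^'n \<Rightarrow> real)"
  using supp_ball_bump_affine[of 1 "0::real^'n"] by simp

lemma bump_mass_pos: "0 < bump_mass TYPE('n::finite)"
proof -
  \<comment> \<open>On the cube of half-width 1/4 each factor is at least 1 - 1/4, to the third
    power.\<close>
  let ?c = "(\<Prod>i\<in>(UNIV::'n set). (3/4::real) ^ 3)"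
  let ?B = "cbox (- (1/4) *\<^sub>R 1) ((1/4) *\<^sub>R 1) :: (real^'n) set"
  have pos: "0 < measure lborel ?B"
    by (simp add: content_cbox_cart interval_ne_empty_cart prod_pos)
  have low: "?c * indicat_real ?B x \<le> bump x" for x
  proof (cases "x \<in> ?B")
    case True
    have "?c \<le> bump x" unfolding bump_def
    proof (intro prod_mono conjI power_mono)
      fix i
      have "\<bar>2 * x $ i\<bar> \<le> 1/2" using True by (auto simp: mem_box_cart abs_le_iff dest!: spec[of _ i])
      then have "(2 * x $ i)\<^sup>2 \<le> (1/2)\<^sup>2" by (metis abs_ge_zero power2_abs power_mono)
      then show "3/4 \<le> max 0 (1 - (2 * x $ i)\<^sup>2)" by (simp add: power2_eq_square)
    qed simp_all
    then show ?thesis using True by simp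
  qed (simp add: bump_nonneg)
  have i: "integrable lborel (indicat_real ?B)"
    using emeasure_bounded_finite[OF bounded_cbox] by (intro integrable_real_indicator) auto
  have "?c * measure lborel ?B = (\<integral>x. ?c * indicat_real ?B x \<partial>lborel)" by simp
  also have "\<dots> \<le> (\<integral>x. bump (x :: real^'n) \<partial>lborel)"
    using i integrable_continuous_supp_ball[OF C2_continuous[OF C2_bump] bump_supp] low
    by (intro Bochner_Integration.integral_mono) auto
  finally show ?thesis 
    unfolding bump_mass_def using less_le_trans[OF mult_pos_pos[OF _ pos, of ?c]] by (simp add: prod_pos)
qed

lemma bump_affine_integral:
  fixes a :: "real^'n"
  assumes "0 < \<delta>"
  shows "(\<integral>x. bump ((1 / \<delta>) *\<^sub>R (x - a)) \<partial>lborel) = \<delta> ^ CARD('n) * bump_mass TYPE('n)"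
proof -
  let ?f = "\<lambda>x::real^'n. bump ((1 / \<delta>) *\<^sub>R (x - a))"
  have [measurable]: "?f \<in> borel_measurable borel" "(bump :: real^'n \<Rightarrow> real) \<in> borel_measurable borel"
    by (intro borel_measurable_continuous_onI continuous_on_compose2[OF C2_continuous[OF C2_bump]] continuous_intros; simp)+
  have "(\<integral>x. ?f x \<partial>lborel) = (\<integral>x. ?f x \<partial>density (distr lborel borel (\<lambda>x. a + \<delta> *\<^sub>R x)) (\<lambda>_. ennreal (\<bar>\<delta>\<bar> ^ DIM(real^'n))))"
    using lborel_affine[of \<delta> a] assms by (metis less_irrefl)
  also have "\<dots> = (\<integral>x. \<bar>\<delta>\<bar> ^ DIM(real^'n) *\<^sub>R ?f x \<partial>distr lborel borel (\<lambda>x. a + \<delta> *\<^sub>R x))"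
    by (rule integral_density) auto
  also have "\<dots> = (\<integral>x. \<bar>\<delta>\<bar> ^ DIM(real^'n) *\<^sub>R ?f (a + \<delta> *\<^sub>R x) \<partial>lborel)"
    by (rule integral_distr) auto
  also have "\<dots> = \<delta> ^ CARD('n) * bump_mass TYPE('n)" using assms by (simp add: bump_mass_def)
  finally show ?thesis .
qed

lemma C2_bump_affine: "C2 (\<lambda>x. bump ((1 / \<delta>) *\<^sub>R (x - a)))"
  using C2_affine[OF C2_bump, of "1 / \<delta>" "- (1 / \<delta>) *\<^sub>R a"] by (simp add: algebra_simps)

section \<open>Divergence and double divergence of a tensor\<close>

definition div_row :: "(real^'n \<Rightarrow> real^'n^'n) \<Rightarrow> 'n \<Rightarrow> real^'n \<Rightarrow> real" where
  "div_row W i x = (\<Sum>j\<in>UNIV. partial j (\<lambda>x. W x $ i $ j) x)"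

definition divdiv :: "(real^'n \<Rightarrow> real^'n^'n) \<Rightarrow> real^'n \<Rightarrow> real" where
  "divdiv W x = (\<Sum>i\<in>UNIV. \<Sum>j\<in>UNIV. partial i (partial j (\<lambda>x. W x $ i $ j)) x)"

definition C2_supp :: "real \<Rightarrow> (real^'n \<Rightarrow> real^'n^'n) \<Rightarrow> bool" where
  "C2_supp R W \<longleftrightarrow> (\<forall>i j. C2 (\<lambda>x. W x $ i $ j) \<and> supp_ball R (\<lambda>x. W x $ i $ j))"

lemma divdiv_continuous:
  assumes "C2_supp R W" shows "continuous_on UNIV (divdiv W)" "supp_ball R (divdiv W)"
  using assms unfolding divdiv_def[abs_def] C2_supp_def
  by (auto intro!: continuous_intros C1_continuous_partial C2_C1 supp_ball_sum supp_ball_partial)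

lemma div_row_C1:
  assumes "C2_supp R W"
  shows "C1 (div_row W i)" "supp_ball R (div_row W i)"
    "partial k (div_row W i) = (\<lambda>x. \<Sum>j\<in>UNIV. partial k (partial j (\<lambda>x. W x $ i $ j)) x)"
proof -
  have "C1 (\<lambda>x. \<Sum>j\<in>UNIV. partial j (\<lambda>x. W x $ i $ j) x) \<and>
      partial k (\<lambda>x. \<Sum>j\<in>UNIV. partial j (\<lambda>x. W x $ i $ j) x) = (\<lambda>x. \<Sum>j\<in>UNIV. partial k (partial j (\<lambda>x. W x $ i $ j)) x)"
    by (rule C1_sum) (use assms C2_C1(2) in \<open>auto simp: C2_supp_def\<close>)
  then show "C1 (div_row W i)"
    "partial k (div_row W i) = (\<lambda>x. \<Sum>j\<in>UNIV. partial k (partial j (\<lambda>x. W x $ i $ j)) x)"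
    unfolding div_row_def[abs_def] by auto
  show "supp_ball R (div_row W i)" using assms unfolding div_row_def[abs_def]
    by (auto simp: C2_supp_def intro!: supp_ball_sum supp_ball_partial)
qed

text \<open>The upper half of the estimate: \<open>divdiv W\<close> is the divergence of the vector
  of row divergences, and each outer derivative is passed to \<open>u\<close> at cost 1.\<close>

lemma convex_potential_divdiv_le:
  assumes u: "convex_potential u" and W: "C2_supp R W" "0 \<le> R"
  shows "(\<integral>x. u x * divdiv W x \<partial>lborel) \<le> (\<Sum>i\<in>UNIV. \<integral>x. \<bar>div_row W i x\<bar> \<partial>lborel)"
proof -
  have "(\<integral>x. u x * divdiv W x \<partial>lborel) = (\<integral>x. (\<Sum>i\<in>UNIV. u x * partial i (div_row W i) x) \<partial>lborel)"
    by (simp add: divdiv_def div_row_C1(3)[OF W(1)] sum_distrib_left)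
  also have "\<dots> = (\<Sum>i\<in>UNIV. \<integral>x. u x * partial i (div_row W i) x \<partial>lborel)"
    by (intro Bochner_Integration.integral_sum integrable_continuous_supp_ball[where R=R] continuous_intros
        convex_potential_continuous[OF u] C1_continuous_partial div_row_C1[OF W(1)] supp_ball_mult supp_ball_partial)
  also have "\<dots> \<le> (\<Sum>i\<in>UNIV. \<integral>x. \<bar>div_row W i x\<bar> \<partial>lborel)"
    by (intro sum_mono convex_potential_partial_le[OF u _ _ W(2)] div_row_C1[OF W(1)])
  finally show ?thesis .
qed

text \<open>Fubini for a continuous integrand of bounded support: \<open>y\<close> within R and
  \<open>x - y\<close> within S force the pair into radius R + (R + S).\<close>

lemma convolution_swap:
  fixes u w q :: "real^'n \<Rightarrow> real"
  assumes u: "continuous_on UNIV u" and w: "continuous_on UNIV w" "supp_ball R w"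
    and q: "continuous_on UNIV q" "supp_ball S q"
  shows "(\<integral>y. w y * (\<integral>x. u x * q (x - y) \<partial>lborel) \<partial>lborel) = (\<integral>x. u x * (\<integral>y. w y * q (x - y) \<partial>lborel) \<partial>lborel)"
    "integrable lborel (\<lambda>y. w y * (\<integral>x. u x * q (x - y) \<partial>lborel))"
    "integrable lborel (\<lambda>x. u x * (\<integral>y. w y * q (x - y) \<partial>lborel))"
proof -
  let ?F = "\<lambda>(y, x). w y * (u x * q (x - y))"
  have "continuous_on UNIV ?F"
    unfolding case_prod_beta
    by (intro continuous_intros continuous_on_compose2[OF u] continuous_on_compose2[OF w(1)] continuous_on_compose2[OF q(1)]) auto
  moreover have "supp_ball (R + (R + S)) ?F" unfolding supp_ball_def
  proof (intro allI impI, clarify)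
    fix y x :: "real^'n" assume n: "R + (R + S) < norm (y, x)"
    show "w y * (u x * q (x - y)) = 0"
    proof (cases "norm y \<le> R \<and> norm (x - y) \<le> S")
      case True
      then have "norm x \<le> R + S" using norm_triangle_sub[of x y] by linarith
      then show ?thesis using n True norm_Pair_le[of y x] by linarith
    next
      case False then show ?thesis using w(2) q(2) by (auto simp: supp_ball_def not_le)
    qed
  qed
  ultimately have "integrable lborel ?F" by (rule integrable_continuous_supp_ball)
  then have int: "integrable (lborel \<Otimes>\<^sub>M lborel) ?F" by (simp add: lborel_prod)
  have 1: "(\<integral>x. w y * (u x * q (x - y)) \<partial>lborel) = w y * (\<integral>x. u x * q (x - y) \<partial>lborel)" for y by simp
  have 2: "(\<integral>y. w y * (u x * q (x - y)) \<partial>lborel) = u x * (\<integral>y. w y * q (x - y) \<partial>lborel)" for x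
    by (subst integral_mult_right_zero[symmetric]) (simp add: algebra_simps)
  show "(\<integral>y. w y * (\<integral>x. u x * q (x - y) \<partial>lborel) \<partial>lborel) = (\<integral>x. u x * (\<integral>y. w y * q (x - y) \<partial>lborel) \<partial>lborel)"
    using lborel_pair.Fubini_integral[of "\<lambda>x y. w x * (u y * q (y - x))"] int unfolding 1 2 by simp
  show "integrable lborel (\<lambda>y. w y * (\<integral>x. u x * q (x - y) \<partial>lborel))"
    using lborel_pair.integrable_fst'[OF int] by (simp add: 1)
  show "integrable lborel (\<lambda>x. u x * (\<integral>y. w y * q (x - y) \<partial>lborel))"
    using lborel_pair.integrable_snd[of "\<lambda>x y. w x * (u y * q (y - x))"] int by (simp add: 2)
qed

text \<open>\<open>u\<close> has no second derivatives, so the nonnegative quantity \<open>W : D\<^sup>2u\<close> is mollified and the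
  derivatives are moved first onto the mollifier and then onto \<open>W\<close>.\<close>

lemma convex_potential_divdiv_nonneg:
  fixes u :: "real^'n \<Rightarrow> real"
  assumes u: "convex_potential u" and W: "C2_supp R W" "0 \<le> R" and psd: "\<And>x. psd_sym (W x)"
  shows "0 \<le> (\<integral>x. u x * divdiv W x \<partial>lborel)"
proof (rule le_if_le_add_eps_mult)
  fix \<epsilon> :: real assume eps: "0 < \<epsilon>"
  let ?d = "real CARD('n)"
  define \<rho> where "\<rho> = (\<lambda>x::real^'n. bump ((1 / \<epsilon>) *\<^sub>R (x - 0)))"
  have \<rho>: "C2 \<rho>" unfolding \<rho>_def by (rule C2_bump_affine)
  define S where "S = ?d * \<epsilon>"
  have S0: "0 \<le> S" using eps by (simp add: S_def)
  have s\<rho>: "supp_ball S \<rho>" unfolding \<rho>_def S_def using supp_ball_bump_affine[OF eps, of "0::real^'n"] by simp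
  have \<rho>0: "0 \<le> \<rho> x" for x by (simp add: \<rho>_def bump_nonneg)
  define m where "m = (\<integral>x. \<rho> x \<partial>lborel)"
  have m: "0 < m" unfolding m_def \<rho>_def using bump_affine_integral[OF eps, of "0::real^'n"] eps bump_mass_pos[where 'n='n] by simp
  note cu = convex_potential_continuous[OF u]
  define w where "w i j = (\<lambda>x. W x $ i $ j)" for i j
  have w: "C2 (w i j)" "supp_ball R (w i j)" for i j using W by (auto simp: w_def C2_supp_def)
  define q where "q i j = partial i (partial j \<rho>)" for i j
  have q: "continuous_on UNIV (q i j)" "supp_ball S (q i j)" for i j
    unfolding q_def using \<rho> s\<rho> by (auto intro: C1_continuous_partial C2_C1 supp_ball_partial)
  \<comment> \<open>The Hessian of the mollified \<open>u\<close>, up to the mass of the mollifier.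
    The indices of \<open>q\<close> are swapped to match the order of derivatives in
    \<open>dir2\<close>.\<close>
  define Hm where "Hm i j y = (\<integral>x. u x * q j i (x - y) \<partial>lborel)" for i j y
  have shift: "partial j (\<lambda>x. f (x - y)) = (\<lambda>x. partial j f (x - y))" "C1 (\<lambda>x. f (x - y))" if "C1 f" for f y and j :: 'n
    using C1_affine[OF that, where c=1 and b="- y"] by simp_all
  have tr: "continuous_on UNIV (\<lambda>x. f (x - y))" if "continuous_on UNIV f" for f :: "real^'n \<Rightarrow> real" and y
    by (rule continuous_on_compose2[OF that]) (auto intro!: continuous_intros)
  have psH: "0 \<le> (\<Sum>i\<in>UNIV. \<Sum>j\<in>UNIV. v $ i * v $ j * Hm i j y)" for v :: "real^'n" and y
  proof -
    have C2s: "C2 (\<lambda>x. \<rho> (x - y))" using C2_affine[OF \<rho>, of 1 "- y"] by simp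
    have ss: "supp_ball (S + norm y) (\<lambda>x. \<rho> (x - y))" using supp_ball_translate[OF s\<rho>, of "- y" "norm y"] by simp
    have sq: "supp_ball (S + norm y) (\<lambda>x. q i j (x - y))" for i j using supp_ball_translate[OF q(2), of "- y" "norm y"] by simp
    have "dir2 v (\<lambda>x. \<rho> (x - y)) x = (\<Sum>i\<in>UNIV. \<Sum>j\<in>UNIV. v $ i * v $ j * q j i (x - y))" for x
      unfolding dir2_def q_def by (simp add: shift C2_C1[OF \<rho>])
    then have "(\<integral>x. u x * dir2 v (\<lambda>x. \<rho> (x - y)) x \<partial>lborel)
        = (\<integral>x. (\<Sum>i\<in>UNIV. \<Sum>j\<in>UNIV. v $ i * v $ j * (u x * q j i (x - y))) \<partial>lborel)"
      by (simp add: sum_distrib_left algebra_simps)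
    also have "\<dots> = (\<Sum>i\<in>UNIV. \<Sum>j\<in>UNIV. v $ i * v $ j * Hm i j y)"
    proof -
      have "integrable lborel (\<lambda>x. v $ i * v $ j * (u x * q j i (x - y)))" for i j
        by (intro integrable_continuous_supp_ball[OF _ supp_ball_mult(2)[OF supp_ball_mult(2)[OF sq]]] continuous_intros cu tr q)
      then show ?thesis by (simp add: Hm_def Bochner_Integration.integral_sum)
    qed
    finally show ?thesis
      using convex_potential_dir2_nonneg[OF u C2s ss, of v] S0 \<rho>0 by simp
  qed
  \<comment> \<open>Each of the two integrations by parts brings a sign, and so does each derivative
    of the reflected mollifier; all four cancel and both derivatives end on
    \<open>w\<close>.\<close>
  have IJ: "(\<integral>y. w i j y * Hm i j y \<partial>lborel) = (\<integral>x. u x * (\<integral>y. partial i (partial j (w i j)) y * \<rho> (x - y) \<partial>lborel) \<partial>lborel)"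
    "integrable lborel (\<lambda>y. w i j y * Hm i j y)" for i j
  proof -
    note sw = convolution_swap[OF cu C2_continuous[OF w(1)] w(2) q, of i j j i]
    show "integrable lborel (\<lambda>y. w i j y * Hm i j y)" using sw(2) by (simp add: Hm_def)
    have "(\<integral>y. w i j y * q j i (x - y) \<partial>lborel) = (\<integral>y. partial i (partial j (w i j)) y * \<rho> (x - y) \<partial>lborel)" for x
    proof -
      have refl: "partial k (\<lambda>y. f (x - y)) = (\<lambda>y. - partial k f (x - y))" "C1 (\<lambda>y. f (x - y))" if "C1 f" for f and k :: 'n
        using C1_affine[OF that, where c="-1" and b=x] by simp_all
      have r1: "partial i (\<lambda>y. \<rho> (x - y)) = (\<lambda>y. - partial i \<rho> (x - y))" "C1 (\<lambda>y. \<rho> (x - y))"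
        using refl[OF C2_C1(1)[OF \<rho>]] by auto
      have r2: "partial j (\<lambda>y. partial i \<rho> (x - y)) = (\<lambda>y. - q j i (x - y))" "C1 (\<lambda>y. partial i \<rho> (x - y))"
        using refl[OF C2_C1(2)[OF \<rho>]] by (auto simp: q_def)
      have "(\<integral>y. w i j y * q j i (x - y) \<partial>lborel) = - (\<integral>y. w i j y * partial j (\<lambda>y. partial i \<rho> (x - y)) y \<partial>lborel)"
        by (simp add: r2)
      also have "\<dots> = (\<integral>y. partial j (w i j) y * partial i \<rho> (x - y) \<partial>lborel)"
        using integral_by_parts_supp_ball[OF C2_C1(1)[OF w(1)] w(2) r2(2), of i j j] by simp
      also have "\<dots> = - (\<integral>y. partial j (w i j) y * partial i (\<lambda>y. \<rho> (x - y)) y \<partial>lborel)"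
        by (simp add: r1)
      also have "\<dots> = (\<integral>y. partial i (partial j (w i j)) y * \<rho> (x - y) \<partial>lborel)"
        using integral_by_parts_supp_ball[OF C2_C1(2)[OF w(1)] supp_ball_partial[OF w(2)] r1(2), of j i j i] by simp
      finally show ?thesis .
    qed
    then show "(\<integral>y. w i j y * Hm i j y \<partial>lborel) = (\<integral>x. u x * (\<integral>y. partial i (partial j (w i j)) y * \<rho> (x - y) \<partial>lborel) \<partial>lborel)"
      using sw(1) by (simp add: Hm_def)
  qed
  define D where "D = divdiv W"
  have D: "continuous_on UNIV D" "supp_ball R D" unfolding D_def using divdiv_continuous[OF W(1)] by auto
  have D_eq: "D y = (\<Sum>i\<in>UNIV. \<Sum>j\<in>UNIV. partial i (partial j (w i j)) y)" for y
    by (simp add: D_def divdiv_def w_def)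
  have ddc: "continuous_on UNIV (partial i (partial j (w i j)))" "supp_ball R (partial i (partial j (w i j)))" for i j
    using C1_continuous_partial[OF C2_C1(2)[OF w(1)]] supp_ball_partial[OF supp_ball_partial[OF w(2)]] by blast+
  note c\<rho> = C2_continuous[OF \<rho>]
  have tr': "continuous_on UNIV (\<lambda>y. \<rho> (x - y))" for x
    by (rule continuous_on_compose2[OF c\<rho>]) (auto intro!: continuous_intros)
  have "0 \<le> (\<integral>y. (\<Sum>i\<in>UNIV. \<Sum>j\<in>UNIV. w i j y * Hm i j y) \<partial>lborel)"
    by (intro Bochner_Integration.integral_nonneg) (simp add: w_def frobenius_psd_nonneg[OF psd psH])
  also have "\<dots> = (\<Sum>i\<in>UNIV. \<Sum>j\<in>UNIV. \<integral>y. w i j y * Hm i j y \<partial>lborel)"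
    using IJ(2) by (simp add: Bochner_Integration.integral_sum)
  also have "\<dots> = (\<integral>x. (\<Sum>i\<in>UNIV. \<Sum>j\<in>UNIV. u x * (\<integral>y. partial i (partial j (w i j)) y * \<rho> (x - y) \<partial>lborel)) \<partial>lborel)"
    using convolution_swap(3)[OF cu ddc c\<rho> s\<rho>] by (simp add: IJ(1) Bochner_Integration.integral_sum)
  also have "\<dots> = (\<integral>x. u x * (\<integral>y. D y * \<rho> (x - y) \<partial>lborel) \<partial>lborel)"
  proof -
    have "integrable lborel (\<lambda>y. partial i (partial j (w i j)) y * \<rho> (x - y))" for i j x
      by (intro integrable_continuous_supp_ball[OF _ supp_ball_mult(1)[OF ddc(2)]] continuous_intros ddc tr')
    then have "(\<integral>y. D y * \<rho> (x - y) \<partial>lborel) = (\<Sum>i\<in>UNIV. \<Sum>j\<in>UNIV. \<integral>y. partial i (partial j (w i j)) y * \<rho> (x - y) \<partial>lborel)" for x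
      by (simp add: D_eq sum_distrib_right Bochner_Integration.integral_sum)
    then show ?thesis by (simp add: sum_distrib_left)
  qed
  also have "\<dots> = (\<integral>y. D y * (\<integral>x. u x * \<rho> (x - y) \<partial>lborel) \<partial>lborel)"
    by (rule convolution_swap(1)[OF cu D c\<rho> s\<rho>, symmetric])
  \<comment> \<open>The mollifier sees only points whose coordinates differ by at most \<epsilon>,
    so by the l1 Lipschitz bound the mollified \<open>u\<close> is within d \<epsilon> m of m times
    \<open>u\<close>.\<close>
  also have "\<dots> \<le> (\<integral>y. m * (u y * D y) + \<epsilon> * (?d * m * \<bar>D y\<bar>) \<partial>lborel)"
  proof (rule Bochner_Integration.integral_mono)
    show "integrable lborel (\<lambda>y. D y * (\<integral>x. u x * \<rho> (x - y) \<partial>lborel))"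
      by (rule convolution_swap(2)[OF cu D c\<rho> s\<rho>])
    show "integrable lborel (\<lambda>y. m * (u y * D y) + \<epsilon> * (?d * m * \<bar>D y\<bar>))"
      by (rule integrable_continuous_supp_ball[where R=R]; (intro continuous_intros cu D | use D(2) in \<open>simp add: supp_ball_def\<close>))
    fix y
    have iu: "integrable lborel (\<lambda>x. u x * \<rho> (x - y))" "integrable lborel (\<lambda>x. \<rho> (x - y))"
      using supp_ball_translate[OF s\<rho>, of "- y" "norm y"]
      by (auto intro!: integrable_continuous_supp_ball[where R="S + norm y"] continuous_intros cu tr c\<rho> supp_ball_mult)
    have m_y: "(\<integral>x. \<rho> (x - y) \<partial>lborel) = m"
      using lborel_integral_translate[OF c\<rho>, of "- y"] by (simp add: m_def)
    have "\<bar>(\<integral>x. u x * \<rho> (x - y) \<partial>lborel) - u y * m\<bar> = \<bar>\<integral>x. (u x - u y) * \<rho> (x - y) \<partial>lborel\<bar>"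
      using iu by (simp add: left_diff_distrib flip: m_y)
    also have "\<dots> \<le> (\<integral>x. \<bar>(u x - u y) * \<rho> (x - y)\<bar> \<partial>lborel)" by (rule integral_abs_bound)
    also have "\<dots> \<le> (\<integral>x. ?d * \<epsilon> * \<rho> (x - y) \<partial>lborel)"
    proof (rule Bochner_Integration.integral_mono)
      fix x
      show "\<bar>(u x - u y) * \<rho> (x - y)\<bar> \<le> ?d * \<epsilon> * \<rho> (x - y)"
      proof (cases "\<rho> (x - y) = 0")
        case False
        then have "0 < bump ((1 / \<epsilon>) *\<^sub>R (x - y))" using \<rho>0[of "x - y"] by (simp add: \<rho>_def)
        then have "\<bar>x $ i - y $ i\<bar> \<le> \<epsilon>" for i using eps unfolding bump_pos_iff
          by (auto simp: abs_mult field_simps dest!: spec[of _ i])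
        then have "(\<Sum>i\<in>UNIV. \<bar>x $ i - y $ i\<bar>) \<le> ?d * \<epsilon>"
          using sum_bounded_above[of UNIV "\<lambda>i. \<bar>x $ i - y $ i\<bar>" \<epsilon>] by simp
        moreover have "\<bar>u x - u y\<bar> \<le> (\<Sum>i\<in>UNIV. \<bar>x $ i - y $ i\<bar>)" using u by (simp add: convex_potential_def)
        ultimately have "\<bar>u x - u y\<bar> \<le> ?d * \<epsilon>" by linarith
        then show ?thesis using \<rho>0[of "x - y"] by (simp add: abs_mult mult_right_mono)
      qed simp
    qed (use iu in \<open>auto simp: left_diff_distrib\<close>)
    also have "\<dots> = ?d * \<epsilon> * m" using m_y by simp
    finally have b: "\<bar>(\<integral>x. u x * \<rho> (x - y) \<partial>lborel) - u y * m\<bar> \<le> ?d * \<epsilon> * m" .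
    have "D y * (\<integral>x. u x * \<rho> (x - y) \<partial>lborel) - m * (u y * D y) = D y * ((\<integral>x. u x * \<rho> (x - y) \<partial>lborel) - u y * m)"
      by (simp add: algebra_simps)
    also have "\<dots> \<le> \<bar>D y\<bar> * (?d * \<epsilon> * m)"
      by (rule order_trans[OF abs_ge_self]) (simp only: abs_mult mult_left_mono[OF b] abs_ge_zero)
    finally show "D y * (\<integral>x. u x * \<rho> (x - y) \<partial>lborel) \<le> m * (u y * D y) + \<epsilon> * (?d * m * \<bar>D y\<bar>)"
      by (simp add: algebra_simps)
  qed
  also have "\<dots> = m * ((\<integral>x. u x * D x \<partial>lborel) + \<epsilon> * (?d * (\<integral>y. \<bar>D y\<bar> \<partial>lborel)))"
  proof -
    have "integrable lborel (\<lambda>y. u y * D y)" "integrable lborel (\<lambda>y. \<bar>D y\<bar>)"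
      using D by (auto intro!: integrable_continuous_supp_ball[where R=R] continuous_intros cu supp_ball_mult simp: supp_ball_def)
    then show ?thesis by (simp add: algebra_simps)
  qed
  finally show "0 \<le> (\<integral>x. u x * divdiv W x \<partial>lborel) + \<epsilon> * (?d * (\<integral>y. \<bar>divdiv W y\<bar> \<partial>lborel))"
    using m by (simp add: zero_le_mult_iff D_def)
qed simp

section \<open>Second differences on fine lattices\<close>

lemma card_lattice_points_cball:
  fixes M :: "real^'n^'n"
  assumes det: "det M \<noteq> 0" and cell: "\<And>t. t \<in> unit_cell \<Longrightarrow> norm (M *v t) \<le> 1"
  shows "\<bar>det M\<bar> * real (card {z. M *v ivec z \<in> cball 0 R}) \<le> measure lebesgue (cball (0::real^'n) (R + 1))"
proof (rule card_lattice_cells_le[OF det finite_lattice_points[OF det bounded_cball]])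
  fix z assume "z \<in> {z. M *v ivec z \<in> cball 0 R}"
  then have z: "norm (M *v ivec z) \<le> R" by simp
  show "lattice_cell M z \<subseteq> cball 0 (R + 1)"
  proof
    fix x assume "x \<in> lattice_cell M z"
    then obtain t where t: "t \<in> unit_cell" "x = M *v ivec z + M *v t"
      by (auto simp: lattice_cell_def matrix_vector_right_distrib)
    show "x \<in> cball 0 (R + 1)"
      using norm_triangle_ineq[of "M *v ivec z" "M *v t"] z cell[OF t(1)] by (simp add: t(2))
  qed
qed simp

lemma lattice_sum_supp_ball:
  assumes "det M \<noteq> 0" "supp_ball R f"
  shows "lattice_sum M f = \<bar>det M\<bar> * (\<Sum>z | M *v ivec z \<in> cball 0 R. f (M *v ivec z))"
  by (rule lattice_sum_eq[OF finite_lattice_points[OF assms(1) bounded_cball]])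
    (use assms(2) in \<open>auto simp: supp_ball_def\<close>)

lemma lattice_sum_mono:
  assumes "det M \<noteq> 0" "supp_ball R f" "supp_ball R g" "\<And>z. f (M *v ivec z) \<le> g (M *v ivec z)"
  shows "lattice_sum M f \<le> lattice_sum M g"
  unfolding lattice_sum_supp_ball[OF assms(1,2)] lattice_sum_supp_ball[OF assms(1,3)]
  by (intro mult_left_mono sum_mono assms(4)) simp

lemma lattice_sum_add:
  assumes "det M \<noteq> 0" "supp_ball R f" "supp_ball R g"
  shows "lattice_sum M (\<lambda>x. f x + g x) = lattice_sum M f + lattice_sum M g"
  unfolding lattice_sum_supp_ball[OF assms(1,2)] lattice_sum_supp_ball[OF assms(1,3)]
    lattice_sum_supp_ball[OF assms(1) supp_ball_add[OF assms(2,3)]]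
  by (simp add: sum.distrib distrib_left)

lemma lattice_sum_cmult:
  assumes "det M \<noteq> 0" "supp_ball R f"
  shows "lattice_sum M (\<lambda>x. c * f x) = c * lattice_sum M f"
  unfolding lattice_sum_supp_ball[OF assms] lattice_sum_supp_ball[OF assms(1) supp_ball_mult(2)[OF assms(2)]]
  by (simp add: sum_distrib_left mult_ac)

lemma lattice_sum_sum:
  assumes "det M \<noteq> 0" "\<And>i. i \<in> I \<Longrightarrow> supp_ball R (f i)"
  shows "lattice_sum M (\<lambda>x. \<Sum>i\<in>I. f i x) = (\<Sum>i\<in>I. lattice_sum M (f i))"
  using assms(2)
proof (induction I rule: infinite_finite_induct)
  case (insert i I)
  then have "lattice_sum M (\<lambda>x. f i x + (\<Sum>i\<in>I. f i x)) = lattice_sum M (f i) + lattice_sum M (\<lambda>x. \<Sum>i\<in>I. f i x)"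
    by (intro lattice_sum_add[OF assms(1), of R] supp_ball_sum) auto
  then show ?case using insert by simp
qed (simp_all add: lattice_sum_def)

lemma lattice_sum_abs_le:
  fixes M :: "real^'n^'n"
  assumes det: "det M \<noteq> 0" and cell: "\<And>t. t \<in> unit_cell \<Longrightarrow> norm (M *v t) \<le> 1"
    and "supp_ball R f" "\<And>x. \<bar>f x\<bar> \<le> c"
  shows "\<bar>lattice_sum M f\<bar> \<le> c * measure lebesgue (cball (0::real^'n) (R + 1))"
proof -
  have "\<bar>\<Sum>z | M *v ivec z \<in> cball 0 R. f (M *v ivec z)\<bar> \<le> (\<Sum>z | M *v ivec z \<in> cball 0 R. c)"
    by (rule order_trans[OF sum_abs sum_mono]) (rule assms(4))
  then have "\<bar>lattice_sum M f\<bar> \<le> c * (\<bar>det M\<bar> * real (card {z. M *v ivec z \<in> cball 0 R}))"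
    unfolding lattice_sum_supp_ball[OF det assms(3)] abs_mult
    using mult_left_mono[of _ _ "\<bar>det M\<bar>"] by (fastforce simp: mult_ac)
  also have "\<dots> \<le> c * measure lebesgue (cball (0::real^'n) (R + 1))"
    using assms(4)[of 0] by (intro mult_left_mono card_lattice_points_cball[OF det cell]) auto
  finally show ?thesis .
qed

text \<open>Discrete summation by parts: since \<open>a\<close> is a lattice vector, shift
  invariance makes the second difference symmetric with respect to the lattice sum.\<close>

lemma lattice_sum_second_difference:
  assumes det: "det M \<noteq> 0" and s: "supp_ball R \<psi>" and a: "M *v ivec e = a"
  shows "lattice_sum M (\<lambda>x. u x * (\<psi> (x + a) + \<psi> (x - a) - 2 * \<psi> x))
       = lattice_sum M (\<lambda>x. \<psi> x * (u (x + a) + u (x - a) - 2 * u x))"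
proof -
  have a': "M *v ivec (- e) = - a"
  proof -
    have "M *v ivec (e + - e) = M *v ivec e + M *v ivec (- e)" unfolding ivec_add matrix_vector_right_distrib ..
    moreover have "M *v ivec (e + - e) = 0" by (simp add: ivec_def zero_vec_def[symmetric])
    ultimately show ?thesis using a by (metis add_eq_0_iff)
  qed
  define S where "S = R + norm a"
  have SS: "supp_ball S \<psi>" "supp_ball S (\<lambda>x. \<psi> (x + a))" "supp_ball S (\<lambda>x. \<psi> (x - a))"
    using supp_ball_mono[OF s] supp_ball_translate[OF s, of a "norm a"] supp_ball_translate[OF s, of "- a" "norm a"]
    by (auto simp: S_def)
  have 1: "lattice_sum M (\<lambda>x. u x * \<psi> (x + a)) = lattice_sum M (\<lambda>x. \<psi> x * u (x - a))"
    using lattice_sum_shift[of M "\<lambda>x. \<psi> x * u (x - a)" e] by (simp add: a mult.commute)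
  have 2: "lattice_sum M (\<lambda>x. u x * \<psi> (x - a)) = lattice_sum M (\<lambda>x. \<psi> x * u (x + a))"
    using lattice_sum_shift[of M "\<lambda>x. \<psi> x * u (x + a)" "- e"] by (simp add: a' mult.commute)
  note add = lattice_sum_add[OF det] and cm = lattice_sum_cmult[OF det]
  note m = supp_ball_mult
  have "lattice_sum M (\<lambda>x. u x * (\<psi> (x + a) + \<psi> (x - a) - 2 * \<psi> x))
      = lattice_sum M (\<lambda>x. (u x * \<psi> (x + a) + u x * \<psi> (x - a)) + (-2) * (\<psi> x * u x))"
    by (simp add: algebra_simps)
  also have "\<dots> = lattice_sum M (\<lambda>x. u x * \<psi> (x + a)) + lattice_sum M (\<lambda>x. u x * \<psi> (x - a)) + (-2) * lattice_sum M (\<lambda>x. \<psi> x * u x)"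
    by (subst add[of S], intro supp_ball_add m SS, intro m SS, subst add[of S], intro m SS, intro m SS, subst cm[of S], intro m SS, rule refl)
  also have "\<dots> = lattice_sum M (\<lambda>x. \<psi> x * u (x + a)) + lattice_sum M (\<lambda>x. \<psi> x * u (x - a)) + (-2) * lattice_sum M (\<lambda>x. \<psi> x * u x)"
    unfolding 1 2 by simp
  also have "\<dots> = lattice_sum M (\<lambda>x. (\<psi> x * u (x + a) + \<psi> x * u (x - a)) + (-2) * (\<psi> x * u x))"
    by (subst add[of S], intro supp_ball_add m SS, intro m SS, subst add[of S], intro m SS, intro m SS, subst cm[of S], intro m SS, rule refl)
  finally show ?thesis by (simp add: algebra_simps)
qed

lemma unit_cell_image_bound:
  fixes T :: "real^'n^'n"
  assumes "t \<in> unit_cell"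
  shows "norm (T *v t) \<le> (\<Sum>i\<in>UNIV. norm (column i T))"
proof -
  have "norm (T *v t) \<le> (\<Sum>i\<in>UNIV. norm (t $ i *s column i T))"
    unfolding matrix_mult_sum by (rule norm_sum)
  also have "\<dots> \<le> (\<Sum>i\<in>UNIV. norm (column i T))"
    using assms by (intro sum_mono) (auto simp: unit_cell_def scalar_mult_eq_scaleR abs_of_nonneg less_imp_le intro!: mult_left_le_one_le)
  finally show ?thesis .
qed

lemma scaled_lattice_mesh:
  fixes T :: "real^'n^'n"
  assumes "0 < \<eta>"
  obtains h0 where "0 < h0" "\<And>h t. 0 < h \<Longrightarrow> h < h0 \<Longrightarrow> t \<in> unit_cell \<Longrightarrow> norm ((h *\<^sub>R T) *v t) \<le> \<eta>"
proof -
  define K where "K = (\<Sum>i\<in>UNIV. norm (column i T)) + 1"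
  have K: "0 < K" by (simp add: K_def add_nonneg_pos sum_nonneg)
  have "norm ((h *\<^sub>R T) *v t) \<le> \<eta>" if "0 < h" "h < \<eta> / K" "t \<in> unit_cell" for h and t :: "real^'n"
  proof -
    have "norm ((h *\<^sub>R T) *v t) = h * norm (T *v t)" using that(1) by (simp add: scaleR_matrix_vector_assoc[symmetric])
    also have "\<dots> \<le> h * K" using unit_cell_image_bound[OF that(3), of T] that(1) by (intro mult_left_mono) (auto simp: K_def)
    also have "\<dots> \<le> \<eta>" using that(2) K by (simp add: field_simps)
    finally show ?thesis .
  qed
  then show ?thesis using that[of "\<eta> / K"] K assms by simp
qed

lemma det_scaleR: "det (c *\<^sub>R T) = c ^ CARD('n) * det (T :: real^'n^'n)"
proof -
  have "c *\<^sub>R T = (\<chi> i. c *s T $ i)" by (simp add: vec_eq_iff)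
  then show ?thesis using det_rows_mul[of "\<lambda>_. c" "\<lambda>i. T $ i"] by simp
qed

text \<open>One scale for all potentials: \<open>u\<close> is chosen only after the mesh, so the
  modulus must not depend on it. The class is equi-Lipschitz and uniformly bounded on balls, which
  makes this possible.\<close>

lemma convex_potential_mult_equicontinuous:
  fixes q :: "real^'n \<Rightarrow> real"
  assumes q: "continuous_on UNIV q" "supp_ball R q" "0 \<le> R" and "0 < \<epsilon>"
  obtains \<eta> where "0 < \<eta>" "\<eta> \<le> 1"
    "\<And>u x y. convex_potential u \<Longrightarrow> dist x y \<le> \<eta> \<Longrightarrow> \<bar>u x * q x - u y * q y\<bar> \<le> \<epsilon>"
proof -
  let ?d = "real CARD('n)"
  define U where "U = ?d * (R + 1)"
  have U: "0 < U" using q(3) by (simp add: U_def)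
  obtain b where b: "0 < b" "\<And>x. \<bar>q x\<bar> \<le> b" using supp_ball_bounded[OF q(1,2)] by blast
  have "0 < \<epsilon> / (2 * U)" using U \<open>0 < \<epsilon>\<close> by simp
  then obtain \<delta> where \<delta>: "0 < \<delta>" "\<And>x y. dist x y < \<delta> \<Longrightarrow> \<bar>q x - q y\<bar> < \<epsilon> / (2 * U)"
    using supp_ball_uniformly_continuous[OF q(1,2)] by metis
  \<comment> \<open>Half of the tolerance goes to the oscillation of \<open>q\<close>, weighted by
    the bound \<open>U\<close> on the potentials, half to that of \<open>u\<close>, weighted by the
    bound \<open>b\<close> on \<open>q\<close>.\<close>
  define \<eta> where "\<eta> = min (min (\<delta> / 2) 1) (\<epsilon> / (2 * ?d * b))"
  have \<eta>: "0 < \<eta>" "\<eta> \<le> 1" "\<eta> < \<delta>" "\<eta> \<le> \<epsilon> / (2 * ?d * b)" using \<delta>(1) b(1) \<open>0 < \<epsilon>\<close> by (auto simp: \<eta>_def)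
  have "\<bar>u x * q x - u y * q y\<bar> \<le> \<epsilon>" if u: "convex_potential u" and xy: "dist x y \<le> \<eta>" for u and x y :: "real^'n"
  proof -
    have 1: "\<bar>u x * (q x - q y)\<bar> \<le> \<epsilon> / 2"
    proof (cases "norm x \<le> R + 1")
      case True
      have "\<bar>u x\<bar> \<le> U" unfolding U_def by (rule order_trans[OF convex_potential_bound[OF u] mult_left_mono[OF True]]) simp
      moreover have "\<bar>q x - q y\<bar> \<le> \<epsilon> / (2 * U)" using \<delta>(2)[of x y] xy \<eta>(3) by simp
      ultimately have "\<bar>u x * (q x - q y)\<bar> \<le> U * (\<epsilon> / (2 * U))" unfolding abs_mult using U by (intro mult_mono) auto
      then show ?thesis using U by simp
    next
      case False
      have "norm x \<le> norm y + dist x y" using norm_triangle_sub[of x y] by (simp add: dist_norm)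
      then have "R < norm y" "R < norm x" using False xy \<eta>(2) by auto
      then show ?thesis using q(2) \<open>0 < \<epsilon>\<close> by (simp add: supp_ball_def)
    qed
    have "\<bar>u x - u y\<bar> \<le> ?d * \<eta>" by (rule order_trans[OF convex_potential_lipschitz[OF u] mult_left_mono[OF xy]]) simp
    then have "\<bar>(u x - u y) * q y\<bar> \<le> (?d * \<eta>) * b" unfolding abs_mult using b \<eta>(1) by (intro mult_mono) auto
    also have "\<dots> \<le> \<epsilon> / 2" using mult_left_mono[OF \<eta>(4), of "?d * b"] b(1) by (simp add: field_simps)
    finally have 2: "\<bar>(u x - u y) * q y\<bar> \<le> \<epsilon> / 2" .
    have "u x * q x - u y * q y = u x * (q x - q y) + (u x - u y) * q y" by (simp add: algebra_simps)
    then show ?thesis using 1 2 by linarith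
  qed
  then show ?thesis using that \<eta> by blast
qed

text \<open>Summation by parts moves the second difference to the fixed \<psi>, Taylor's formula
  replaces it by \<open>dir2\<close>, and the Riemann sum becomes an integral. The errors involve
  \<open>u\<close> only through bounds common to all potentials, so \<open>h0\<close> can be fixed
  before \<open>u\<close>.\<close>

lemma lattice_second_difference_consistent:
  fixes T :: "real^'n^'n"
  assumes \<psi>: "C2 \<psi>" "supp_ball R \<psi>" "0 \<le> R" and T: "det T \<noteq> 0" and t: "t = T *v ivec e" and "0 < \<epsilon>"
  obtains h0 where "0 < h0" "\<And>h u. 0 < h \<Longrightarrow> h < h0 \<Longrightarrow> convex_potential u \<Longrightarrow>
    \<bar>lattice_sum (h *\<^sub>R T) (\<lambda>x. \<psi> x * ((u (x + h *\<^sub>R t) + u (x - h *\<^sub>R t) - 2 * u x) / h\<^sup>2))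
      - (\<integral>x. u x * dir2 t \<psi> x \<partial>lborel)\<bar> \<le> \<epsilon>"
proof -
  let ?d = "real CARD('n)"
  let ?V1 = "measure lebesgue (cball (0::real^'n) (R + 1 + 1))"
  let ?V3 = "measure lebesgue (ball (0::real^'n) (R + 3))"
  define U where "U = ?d * (R + 1)"
  have U: "0 \<le> U" using \<psi>(3) by (simp add: U_def)
  \<comment> \<open>\<open>U\<close> times a ball volume for the Taylor error, and the volume for
    radius R + 3 for the Riemann sum.\<close>
  define C where "C = U * ?V1 + ?V3 + 1"
  have C: "0 < C" using U by (simp add: C_def add_nonneg_pos)
  define \<epsilon>1 where "\<epsilon>1 = \<epsilon> / C"
  have e1: "0 < \<epsilon>1" using C \<open>0 < \<epsilon>\<close> by (simp add: \<epsilon>1_def)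
  define q where "q = dir2 t \<psi>"
  have q: "continuous_on UNIV q" "supp_ball R q"
    unfolding q_def using continuous_on_dir2[OF \<psi>(1)] supp_ball_dir2[OF \<psi>(2)] by auto
  obtain \<eta> where \<eta>: "0 < \<eta>" "\<eta> \<le> 1" "\<And>u x y. convex_potential u \<Longrightarrow> dist x y \<le> \<eta> \<Longrightarrow> \<bar>u x * q x - u y * q y\<bar> \<le> \<epsilon>1"
    using convex_potential_mult_equicontinuous[OF q \<psi>(3) e1] by blast
  obtain h1 where h1: "0 < h1" "\<And>h s. 0 < h \<Longrightarrow> h < h1 \<Longrightarrow> s \<in> unit_cell \<Longrightarrow> norm ((h *\<^sub>R T) *v s) \<le> \<eta>"
    using scaled_lattice_mesh[OF \<eta>(1)] by blast
  obtain h2 where h2: "0 < h2" "\<And>h x. 0 < h \<Longrightarrow> h < h2 \<Longrightarrow> \<bar>(\<psi> (x + h *\<^sub>R t) + \<psi> (x - h *\<^sub>R t) - 2 * \<psi> x) / h\<^sup>2 - q x\<bar> < \<epsilon>1"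
    using second_difference_uniform[OF \<psi>(1,2) e1, of t] unfolding q_def by metis
  define h0 where "h0 = min (min h1 h2) (1 / (norm t + 1))"
  have nt: "0 < norm t + 1" by (simp add: add_nonneg_pos)
  have "\<bar>lattice_sum (h *\<^sub>R T) (\<lambda>x. \<psi> x * ((u (x + h *\<^sub>R t) + u (x - h *\<^sub>R t) - 2 * u x) / h\<^sup>2))
      - (\<integral>x. u x * q x \<partial>lborel)\<bar> \<le> \<epsilon>" if h: "0 < h" "h < h0" and u: "convex_potential u" for h u
  proof -
    let ?M = "h *\<^sub>R T"
    have det: "det ?M \<noteq> 0" using T h by (simp add: det_scaleR)
    have "h * norm t \<le> 1 / (norm t + 1) * (norm t + 1)" using h by (intro mult_mono) (auto simp: h0_def)
    then have ht: "norm (h *\<^sub>R t) \<le> 1" "norm (- (h *\<^sub>R t)) \<le> 1" using h nt by auto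
    have cell: "norm (?M *v s) \<le> \<eta>" if "s \<in> unit_cell" for s using h1(2)[OF h(1)] h(2) that by (simp add: h0_def)
    define q' where "q' x = (\<psi> (x + h *\<^sub>R t) + \<psi> (x - h *\<^sub>R t) - 2 * \<psi> x) / h\<^sup>2" for x
    have sq': "supp_ball (R + 1) q'"
      using supp_ball_translate[OF \<psi>(2) ht(1)] supp_ball_translate[OF \<psi>(2) ht(2)] supp_ball_mono[OF \<psi>(2), of "R + 1"]
      by (simp add: q'_def supp_ball_def)
    have sq: "supp_ball (R + 1) q" using supp_ball_mono[OF q(2)] by simp
    have Mt: "?M *v ivec e = h *\<^sub>R t" using t by (simp add: scaleR_matrix_vector_assoc[symmetric])
    have s2: "lattice_sum ?M (\<lambda>x. (1 / h\<^sup>2) * (u x * (\<psi> (x + h *\<^sub>R t) + \<psi> (x - h *\<^sub>R t) - 2 * \<psi> x)))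
        = lattice_sum ?M (\<lambda>x. (1 / h\<^sup>2) * (\<psi> x * (u (x + h *\<^sub>R t) + u (x - h *\<^sub>R t) - 2 * u x)))"
    proof -
      have "supp_ball (R + 1) (\<lambda>x. u x * (\<psi> (x + h *\<^sub>R t) + \<psi> (x - h *\<^sub>R t) - 2 * \<psi> x))"
        using sq' h by (simp add: q'_def supp_ball_def)
      from lattice_sum_cmult[OF det this, of "1 / h\<^sup>2"] show ?thesis
        unfolding lattice_sum_second_difference[OF det \<psi>(2) Mt, of u]
          lattice_sum_cmult[OF det supp_ball_mult(1)[OF \<psi>(2)], of "1 / h\<^sup>2"] .
    qed
    have "lattice_sum ?M (\<lambda>x. \<psi> x * ((u (x + h *\<^sub>R t) + u (x - h *\<^sub>R t) - 2 * u x) / h\<^sup>2))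
        = lattice_sum ?M (\<lambda>x. (1 / h\<^sup>2) * (\<psi> x * (u (x + h *\<^sub>R t) + u (x - h *\<^sub>R t) - 2 * u x)))"
      by (intro arg_cong[of _ _ "lattice_sum ?M"] ext) simp
    also have "\<dots> = lattice_sum ?M (\<lambda>x. u x * q' x)"
      unfolding s2[symmetric] by (intro arg_cong[of _ _ "lattice_sum ?M"] ext) (simp add: q'_def)
    also have "\<dots> = lattice_sum ?M (\<lambda>x. u x * (q' x - q x) + u x * q x)"
      by (simp add: right_diff_distrib)
    also have "\<dots> = lattice_sum ?M (\<lambda>x. u x * (q' x - q x)) + lattice_sum ?M (\<lambda>x. u x * q x)"
      by (rule lattice_sum_add[OF det, of "R + 1"]) (intro supp_ball_mult supp_ball_diff sq sq')+
    finally have eq: "lattice_sum ?M (\<lambda>x. \<psi> x * ((u (x + h *\<^sub>R t) + u (x - h *\<^sub>R t) - 2 * u x) / h\<^sup>2))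
      = lattice_sum ?M (\<lambda>x. u x * (q' x - q x)) + lattice_sum ?M (\<lambda>x. u x * q x)" .
    have b1: "\<bar>lattice_sum ?M (\<lambda>x. u x * (q' x - q x))\<bar> \<le> (U * \<epsilon>1) * ?V1"
    proof (rule lattice_sum_abs_le[OF det])
      show "norm (?M *v s) \<le> 1" if "s \<in> unit_cell" for s using cell[OF that] \<eta>(2) by simp
      show "supp_ball (R + 1) (\<lambda>x. u x * (q' x - q x))" by (intro supp_ball_mult supp_ball_diff sq sq')
      fix x
      show "\<bar>u x * (q' x - q x)\<bar> \<le> U * \<epsilon>1"
      proof (cases "norm x \<le> R + 1")
        case True
        have "\<bar>u x\<bar> \<le> U" unfolding U_def by (rule order_trans[OF convex_potential_bound[OF u] mult_left_mono[OF True]]) simp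
        moreover have "\<bar>q' x - q x\<bar> \<le> \<epsilon>1" using h2(2)[OF h(1), of x] h(2) by (simp add: h0_def q'_def)
        ultimately show ?thesis unfolding abs_mult using U by (intro mult_mono) auto
      next
        case False
        then show ?thesis using sq sq' U e1 by (simp add: supp_ball_def)
      qed
    qed
    have b2: "\<bar>lattice_sum ?M (\<lambda>x. u x * q x) - (\<integral>x. u x * q x \<partial>lborel)\<bar> \<le> \<epsilon>1 * ?V3"
      by (rule lattice_sum_approx_integral[OF det _ _ \<eta>(3)[OF u] cell \<eta>(2)])
        (intro continuous_intros convex_potential_continuous[OF u] q supp_ball_mult)+
    have "(U * \<epsilon>1) * ?V1 + \<epsilon>1 * ?V3 = \<epsilon>1 * (C - 1)" by (simp add: C_def algebra_simps)
    also have "\<dots> \<le> \<epsilon>1 * C" using e1 by simp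
    also have "\<dots> = \<epsilon>" using C by (simp add: \<epsilon>1_def)
    finally show ?thesis unfolding eq using b1 b2 by linarith
  qed
  moreover have "0 < h0" using h1(1) h2(1) nt by (simp add: h0_def)
  ultimately show ?thesis using that unfolding q_def by blast
qed

lemma lattice_sum_tendsto_integral:
  fixes T :: "real^'n^'n"
  assumes \<psi>: "continuous_on UNIV \<psi>" "supp_ball R \<psi>" and T: "det T \<noteq> 0" and "0 < \<epsilon>"
  obtains h0 where "0 < h0" "\<And>h. 0 < h \<Longrightarrow> h < h0 \<Longrightarrow> \<bar>lattice_sum (h *\<^sub>R T) \<psi> - (\<integral>x. \<psi> x \<partial>lborel)\<bar> \<le> \<epsilon>"
proof -
  let ?V = "measure lebesgue (ball (0::real^'n) (R + 3))"
  have "0 < \<epsilon> / (?V + 1)" using \<open>0 < \<epsilon>\<close> by (simp add: add_nonneg_pos)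
  then obtain \<delta> where \<delta>: "0 < \<delta>" "\<And>x y. dist x y < \<delta> \<Longrightarrow> \<bar>\<psi> x - \<psi> y\<bar> < \<epsilon> / (?V + 1)"
    using supp_ball_uniformly_continuous[OF \<psi>] by metis
  define \<eta> where "\<eta> = min (\<delta> / 2) 1"
  have \<eta>: "0 < \<eta>" "\<eta> < \<delta>" "\<eta> \<le> 1" using \<delta>(1) by (auto simp: \<eta>_def)
  obtain h0 where h0: "0 < h0" "\<And>h s. 0 < h \<Longrightarrow> h < h0 \<Longrightarrow> s \<in> unit_cell \<Longrightarrow> norm ((h *\<^sub>R T) *v s) \<le> \<eta>"
    using scaled_lattice_mesh[OF \<eta>(1)] by blast
  have "\<bar>lattice_sum (h *\<^sub>R T) \<psi> - (\<integral>x. \<psi> x \<partial>lborel)\<bar> \<le> \<epsilon>" if h: "0 < h" "h < h0" for h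
  proof -
    have "\<bar>\<psi> x - \<psi> y\<bar> \<le> \<epsilon> / (?V + 1)" if "dist x y \<le> \<eta>" for x y
      using \<delta>(2)[of x y] that \<eta>(2) by simp
    then have "\<bar>lattice_sum (h *\<^sub>R T) \<psi> - (\<integral>x. \<psi> x \<partial>lborel)\<bar> \<le> \<epsilon> / (?V + 1) * ?V"
      using T h by (intro lattice_sum_approx_integral[OF _ \<psi> _ h0(2) \<eta>(3)]) (auto simp: det_scaleR)
    also have "\<dots> \<le> \<epsilon> / (?V + 1) * (?V + 1)" using \<open>0 < \<epsilon>\<close> by (intro mult_left_mono) auto
    also have "\<dots> = \<epsilon>" by (simp add: add_nonneg_eq_0_iff)
    finally show ?thesis .
  qed
  then show ?thesis using that h0(1) by blast
qed

text \<open>Testing the subgradient inequality at \<open>x\<close> plus and minus column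
  \<open>i\<close> traps the product of the slope with that column between a backward and a forward
  difference. So the transpose of \<open>M\<close> sends the slopes into a box whose sides are
  second differences.\<close>

lemma subgradient_measure_le:
  fixes M :: "real^'n^'n"
  assumes u: "convex_potential u"
  shows "\<bar>det M\<bar> * measure lebesgue {p \<in> unit_cube. \<forall>y. u x + p \<bullet> (y - x) \<le> u y}
     \<le> (\<Prod>i\<in>UNIV. u (x + column i M) + u (x - column i M) - 2 * u x)"
proof -
  let ?S = "{p \<in> unit_cube. \<forall>y. u x + p \<bullet> (y - x) \<le> u y}"
  let ?a = "(\<chi> i. u x - u (x - column i M)) :: real^'n" and ?b = "(\<chi> i. u (x + column i M) - u x) :: real^'n"
  have ab: "?a $ i \<le> ?b $ i" for i
    using u unfolding convex_potential_def by (simp add: algebra_simps)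
  have S: "compact (unit_cube \<inter> (\<Inter>y. {p. u x + p \<bullet> (y - x) \<le> u y}))"
    by (intro compact_Int_closed closed_INT ballI closed_Collect_le continuous_intros) (simp add: unit_cube_def)
  have "unit_cube \<inter> (\<Inter>y. {p. u x + p \<bullet> (y - x) \<le> u y}) = ?S" by auto
  then have S: "?S \<in> lmeasurable" using lmeasurable_compact[OF S] by simp
  have "(*v) (transpose M) ` ?S \<subseteq> cbox ?a ?b"
  proof
    fix w assume "w \<in> (*v) (transpose M) ` ?S"
    then obtain p where p: "\<And>y. u x + p \<bullet> (y - x) \<le> u y" "w = transpose M *v p" by auto
    have "w $ i = p \<bullet> column i M" for i
      by (simp add: p(2) matrix_vector_mult_def transpose_def inner_vec_def column_def mult.commute)
    then show "w \<in> cbox ?a ?b"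
      using p(1)[of "x + column i M" for i] p(1)[of "x - column i M" for i] by (force simp: mem_box_cart algebra_simps)
  qed
  then have "measure lebesgue ((*v) (transpose M) ` ?S) \<le> measure lebesgue (cbox ?a ?b)"
    using measure_matrix_image[OF S, of "transpose M"] by (intro measure_mono_fmeasurable) (auto simp: fmeasurableD)
  also have "\<dots> = (\<Prod>i\<in>UNIV. ?b $ i - ?a $ i)"
    using ab by (simp add: content_cbox_cart interval_ne_empty_cart)
  also have "\<dots> = (\<Prod>i\<in>UNIV. u (x + column i M) + u (x - column i M) - 2 * u x)"
    by (intro prod.cong) auto
  finally show ?thesis using measure_matrix_image[OF S, of "transpose M"] by simp
qed

text \<open>The slopes of \<open>u\<close> at a lattice point \<open>x\<close> fill a parallelepiped whose widths are the second
  differences of \<open>u\<close> at \<open>x\<close>; hence a lower bound on the volume of the subgradient is, by the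
  inequality of the means, a lower bound on the sum of the second differences.\<close>

lemma local_lower_bound:
  fixes T :: "real^'n^'n"
  assumes \<psi>: "C2 \<psi>" "supp_ball R \<psi>" "0 \<le> R" "\<And>x. 0 \<le> \<psi> x" and T: "det T \<noteq> 0" and f: "0 \<le> f" and "0 < \<epsilon>"
  obtains h0 where "0 < h0" "\<And>h u. \<lbrakk>0 < h; h < h0; convex_potential u;
     \<And>z. 0 < \<psi> ((h *\<^sub>R T) *v ivec z) \<Longrightarrow> f * \<bar>det (h *\<^sub>R T)\<bar>
         \<le> measure lebesgue {p \<in> unit_cube. \<forall>y. u ((h *\<^sub>R T) *v ivec z) + p \<bullet> (y - (h *\<^sub>R T) *v ivec z) \<le> u y}\<rbrakk> \<Longrightarrow>
    real CARD('n) * ((det T)\<^sup>2 * f) powr (1 / real CARD('n)) * (\<integral>x. \<psi> x \<partial>lborel) - \<epsilon>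
      \<le> (\<Sum>i\<in>UNIV. \<integral>x. u x * dir2 (column i T) \<psi> x \<partial>lborel)"
proof -
  let ?d = "real CARD('n)"
  define c where "c = ?d * ((det T)\<^sup>2 * f) powr (1 / ?d)"
  have c: "0 \<le> c" by (simp add: c_def)
  \<comment> \<open>The error enters \<open>c\<close> times through the sum of \<psi> and once for
    each of the d directions.\<close>
  define \<epsilon>1 where "\<epsilon>1 = \<epsilon> / (c + ?d)"
  have e1: "0 < \<epsilon>1" using c \<open>0 < \<epsilon>\<close> by (simp add: \<epsilon>1_def add_nonneg_pos)
  have col: "column i T = T *v ivec (axis i 1)" for i
  proof -
    have "ivec (axis i 1) = axis i 1" by (simp add: ivec_def axis_def vec_eq_iff)
    then show ?thesis by (simp add: matrix_vector_mult_basis)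
  qed
  define P where "P i h0 \<longleftrightarrow> (\<forall>h u. 0 < h \<longrightarrow> h < h0 \<longrightarrow> convex_potential u \<longrightarrow>
    \<bar>lattice_sum (h *\<^sub>R T) (\<lambda>x. \<psi> x * ((u (x + h *\<^sub>R column i T) + u (x - h *\<^sub>R column i T) - 2 * u x) / h\<^sup>2))
      - (\<integral>x. u x * dir2 (column i T) \<psi> x \<partial>lborel)\<bar> \<le> \<epsilon>1)" for i h0
  have "\<exists>h0>0. P i h0" for i
    by (rule lattice_second_difference_consistent[OF \<psi>(1-3) T col[of i] e1]) (auto simp: P_def)
  then obtain H where H: "\<And>i. 0 < H i" "\<And>i. P i (H i)" by metis
  obtain h1 where h1: "0 < h1" "\<And>h. 0 < h \<Longrightarrow> h < h1 \<Longrightarrow> \<bar>lattice_sum (h *\<^sub>R T) \<psi> - (\<integral>x. \<psi> x \<partial>lborel)\<bar> \<le> \<epsilon>1"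
    using lattice_sum_tendsto_integral[OF C2_continuous[OF \<psi>(1)] \<psi>(2) T e1] by blast
  define h0 where "h0 = min h1 (Min (range H))"
  have h0: "0 < h0" "h0 \<le> h1" "h0 \<le> H i" for i using H(1) h1(1) by (auto simp: h0_def min.coboundedI2)
  show ?thesis
  proof (rule that[OF h0(1)])
    fix h u assume h: "0 < h" "h < h0" and u: "convex_potential u"
      and sub: "\<And>z. 0 < \<psi> ((h *\<^sub>R T) *v ivec z) \<Longrightarrow> f * \<bar>det (h *\<^sub>R T)\<bar>
         \<le> measure lebesgue {p \<in> unit_cube. \<forall>y. u ((h *\<^sub>R T) *v ivec z) + p \<bullet> (y - (h *\<^sub>R T) *v ivec z) \<le> u y}"
    let ?M = "h *\<^sub>R T"
    have det: "det ?M \<noteq> 0" using T h by (simp add: det_scaleR)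
    define \<Delta> where "\<Delta> i x = u (x + h *\<^sub>R column i T) + u (x - h *\<^sub>R column i T) - 2 * u x" for i x
    have \<Delta>0: "0 \<le> \<Delta> i x" for i x using u by (simp add: \<Delta>_def convex_potential_def)
    have pt: "c * \<psi> (?M *v ivec z) \<le> (\<Sum>i\<in>UNIV. \<psi> (?M *v ivec z) * (\<Delta> i (?M *v ivec z) / h\<^sup>2))" for z
    proof (cases "0 < \<psi> (?M *v ivec z)")
      case True
      let ?x = "?M *v ivec z"
      have colM: "column i ?M = h *\<^sub>R column i T" for i by (simp add: column_def vec_eq_iff)
      \<comment> \<open>One factor |det M| is the cell volume contained in the prescribed mass, the
        other the distortion of slopes by the transpose of \<open>M\<close>. Dividing each of the d
        second differences by h squared removes all powers of \<open>h\<close>.\<close>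
      have "f * (det ?M)\<^sup>2 = \<bar>det ?M\<bar> * (f * \<bar>det ?M\<bar>)" by (simp add: power2_eq_square)
      also have "\<dots> \<le> \<bar>det ?M\<bar> * measure lebesgue {p \<in> unit_cube. \<forall>y. u ?x + p \<bullet> (y - ?x) \<le> u y}"
        by (intro mult_left_mono sub True) simp
      also have "\<dots> \<le> (\<Prod>i\<in>UNIV. \<Delta> i ?x)"
        using subgradient_measure_le[OF u, of ?M ?x] by (simp add: colM \<Delta>_def)
      finally have "f * (det ?M)\<^sup>2 / h ^ (2 * CARD('n)) \<le> (\<Prod>i\<in>UNIV. \<Delta> i ?x) / h ^ (2 * CARD('n))"
        using h by (intro divide_right_mono) auto
      also have "f * (det ?M)\<^sup>2 / h ^ (2 * CARD('n)) = (det T)\<^sup>2 * f"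
        using h by (simp add: det_scaleR power_mult_distrib power_mult[symmetric] mult.commute)
      also have "(\<Prod>i\<in>UNIV. \<Delta> i ?x) / h ^ (2 * CARD('n)) = (\<Prod>i\<in>UNIV. \<Delta> i ?x / h\<^sup>2)"
        by (simp add: prod_dividef power_mult)
      finally have "c \<le> ?d * (\<Prod>i\<in>UNIV. \<Delta> i ?x / h\<^sup>2) powr (1 / ?d)"
        unfolding c_def using f by (intro mult_left_mono powr_mono2) auto
      also have "\<dots> \<le> (\<Sum>i\<in>UNIV. \<Delta> i ?x / h\<^sup>2)"
        by (rule card_times_geometric_mean_le_sum) (use \<Delta>0 in auto)
      finally have "\<psi> ?x * c \<le> \<psi> ?x * (\<Sum>i\<in>UNIV. \<Delta> i ?x / h\<^sup>2)" using \<psi>(4) by (rule mult_left_mono)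
      then show ?thesis unfolding sum_distrib_left by (simp only: mult.commute[of c])
    next
      case False
      then have "\<psi> (?M *v ivec z) = 0" using \<psi>(4)[of "?M *v ivec z"] by linarith
      then show ?thesis by simp
    qed
    have "c * (\<integral>x. \<psi> x \<partial>lborel) - c * \<epsilon>1 = c * ((\<integral>x. \<psi> x \<partial>lborel) - \<epsilon>1)" by (simp add: right_diff_distrib)
    also have "\<dots> \<le> c * lattice_sum ?M \<psi>" using h1(2)[OF h(1)] h(2) h0(2) c by (intro mult_left_mono) auto
    also have "\<dots> = lattice_sum ?M (\<lambda>x. c * \<psi> x)" by (rule lattice_sum_cmult[OF det \<psi>(2), symmetric])
    also have "\<dots> \<le> lattice_sum ?M (\<lambda>x. \<Sum>i\<in>UNIV. \<psi> x * (\<Delta> i x / h\<^sup>2))"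
    proof (rule lattice_sum_mono[OF det])
      show "supp_ball R (\<lambda>x. c * \<psi> x)" by (rule supp_ball_mult(2)[OF \<psi>(2)])
      show "supp_ball R (\<lambda>x. \<Sum>i\<in>UNIV. \<psi> x * (\<Delta> i x / h\<^sup>2))"
        by (rule supp_ball_sum[OF supp_ball_mult(1)[OF \<psi>(2)]])
    qed (rule pt)
    also have "\<dots> = (\<Sum>i\<in>UNIV. lattice_sum ?M (\<lambda>x. \<psi> x * (\<Delta> i x / h\<^sup>2)))"
      by (rule lattice_sum_sum[OF det supp_ball_mult(1)[OF \<psi>(2)]])
    also have "\<dots> \<le> (\<Sum>i\<in>UNIV. (\<integral>x. u x * dir2 (column i T) \<psi> x \<partial>lborel) + \<epsilon>1)"
    proof (rule sum_mono)
      fix i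
      have "h < H i" using h(2) h0(3)[of i] by simp
      with h(1) u H(2)[of i] have "\<bar>lattice_sum ?M (\<lambda>x. \<psi> x * (\<Delta> i x / h\<^sup>2)) - (\<integral>x. u x * dir2 (column i T) \<psi> x \<partial>lborel)\<bar> \<le> \<epsilon>1"
        unfolding P_def \<Delta>_def by blast
      then show "lattice_sum ?M (\<lambda>x. \<psi> x * (\<Delta> i x / h\<^sup>2)) \<le> (\<integral>x. u x * dir2 (column i T) \<psi> x \<partial>lborel) + \<epsilon>1"
        by linarith
    qed
    also have "\<dots> = (\<Sum>i\<in>UNIV. \<integral>x. u x * dir2 (column i T) \<psi> x \<partial>lborel) + ?d * \<epsilon>1" by (simp add: sum.distrib)
    finally have "c * (\<integral>x. \<psi> x \<partial>lborel) - (c + ?d) * \<epsilon>1 \<le> (\<Sum>i\<in>UNIV. \<integral>x. u x * dir2 (column i T) \<psi> x \<partial>lborel)"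
      by (simp add: algebra_simps)
    moreover have "(c + ?d) * \<epsilon>1 = \<epsilon>"
    proof -
      have "0 < c + ?d" using c by (simp add: add_nonneg_pos)
      then show ?thesis by (simp add: \<epsilon>1_def)
    qed
    ultimately show "?d * ((det T)\<^sup>2 * f) powr (1 / ?d) * (\<integral>x. \<psi> x \<partial>lborel) - \<epsilon>
      \<le> (\<Sum>i\<in>UNIV. \<integral>x. u x * dir2 (column i T) \<psi> x \<partial>lborel)" unfolding c_def by simp
  qed
qed

section \<open>The inequality for finitely many cubes\<close>

lemma semidiscrete_convex_potential:
  fixes X :: "(real^'n) set"
  assumes "finite X" "\<And>x. x \<in> X \<Longrightarrow> 0 < f x" "(\<Sum>x\<in>X. f x) \<le> 2 ^ CARD('n)"
  obtains u where "convex_potential u"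
    "\<And>x. x \<in> X \<Longrightarrow> f x \<le> measure lebesgue {p \<in> unit_cube. \<forall>y. u x + p \<bullet> (y - x) \<le> u y}"
proof (cases "X = {}")
  case True
  have "convex_potential (\<lambda>x::real^'n. 0)" by (simp add: convex_potential_def sum_nonneg)
  then show ?thesis using that True by auto
next
  case False
  from semidiscrete_monge_ampere[OF assms(1) False assms(2,3)] obtain u where
    "u 0 = 0" "\<And>x y. \<bar>u x - u y\<bar> \<le> (\<Sum>i\<in>UNIV. \<bar>x $ i - y $ i\<bar>)"
    "\<And>x e. 2 * u x \<le> u (x + e) + u (x - e)"
    "\<And>x. x \<in> X \<Longrightarrow> f x \<le> measure lebesgue {p \<in> unit_cube. \<forall>y. u x + p \<bullet> (y - x) \<le> u y}" by blast
  then show ?thesis using that[of u] by (simp add: convex_potential_def)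
qed

text \<open>Contracting the Hessian with a factorised tensor amounts to adding second derivatives
  along the columns; this turns estimates along lattice directions into one for the tensor.\<close>

lemma dir2_sum_columns:
  fixes T :: "real^'n^'n"
  shows "(\<Sum>l\<in>UNIV. dir2 (column l T) f x)
    = (\<Sum>i\<in>UNIV. \<Sum>j\<in>UNIV. (T ** transpose T) $ i $ j * partial i (partial j f) x)"
proof -
  have "(\<Sum>l\<in>UNIV. dir2 (column l T) f x)
      = (\<Sum>i\<in>UNIV. \<Sum>j\<in>UNIV. \<Sum>l\<in>UNIV. T $ i $ l * T $ j $ l * partial j (partial i f) x)"
    unfolding dir2_def column_def by (simp, subst sum.swap, subst (2) sum.swap, rule refl)
  also have "\<dots> = (\<Sum>i\<in>UNIV. \<Sum>j\<in>UNIV. (T ** transpose T) $ j $ i * partial j (partial i f) x)"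
    by (simp add: matrix_matrix_mult_def transpose_def sum_distrib_left mult.commute)
  also have "\<dots> = (\<Sum>j\<in>UNIV. \<Sum>i\<in>UNIV. (T ** transpose T) $ j $ i * partial j (partial i f) x)"
    by (rule sum.swap)
  finally show ?thesis .
qed

lemma divdiv_diff_sum:
  fixes W :: "real^'n \<Rightarrow> real^'n^'n"
  assumes W: "C2_supp R W" and \<psi>: "\<And>k. k \<in> I \<Longrightarrow> C2 (\<psi> k)"
  shows "divdiv (\<lambda>x. W x - (\<Sum>k\<in>I. \<psi> k x *\<^sub>R A k)) x
    = divdiv W x - (\<Sum>k\<in>I. \<Sum>i\<in>UNIV. \<Sum>j\<in>UNIV. A k $ i $ j * partial i (partial j (\<psi> k)) x)"
proof -
  have eq: "partial i (partial j (\<lambda>x. (W x - (\<Sum>k\<in>I. \<psi> k x *\<^sub>R A k)) $ i $ j)) x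
     = partial i (partial j (\<lambda>x. W x $ i $ j)) x - (\<Sum>k\<in>I. A k $ i $ j * partial i (partial j (\<psi> k)) x)" for i j
  proof -
    define c where "c k = - A k $ i $ j" for k
    have w: "C2 (\<lambda>x. W x $ i $ j)" using W by (simp add: C2_supp_def)
    have fe: "(\<lambda>x. (W x - (\<Sum>k\<in>I. \<psi> k x *\<^sub>R A k)) $ i $ j) = (\<lambda>x. W x $ i $ j + (\<Sum>k\<in>I. c k * \<psi> k x))"
      by (simp add: c_def sum_negf mult.commute)
    have s1: "C1 (\<lambda>x. \<Sum>k\<in>I. c k * \<psi> k x) \<and>
        partial j (\<lambda>x. \<Sum>k\<in>I. c k * \<psi> k x) = (\<lambda>x. \<Sum>k\<in>I. partial j (\<lambda>x. c k * \<psi> k x) x)"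
      by (rule C1_sum) (intro C1_cmult(1) C2_C1(1) \<psi>)
    have e1: "partial j (\<lambda>x. W x $ i $ j + (\<Sum>k\<in>I. c k * \<psi> k x))
       = (\<lambda>x. partial j (\<lambda>x. W x $ i $ j) x + (\<Sum>k\<in>I. c k * partial j (\<psi> k) x))"
      using C1_add(2)[OF C2_C1(1)[OF w], of "\<lambda>x. \<Sum>k\<in>I. c k * \<psi> k x" j] s1 \<psi>
      by (simp add: C1_cmult C2_C1)
    have s2: "C1 (\<lambda>x. \<Sum>k\<in>I. c k * partial j (\<psi> k) x) \<and>
        partial i (\<lambda>x. \<Sum>k\<in>I. c k * partial j (\<psi> k) x) = (\<lambda>x. \<Sum>k\<in>I. partial i (\<lambda>x. c k * partial j (\<psi> k) x) x)"
      by (rule C1_sum) (intro C1_cmult(1) C2_C1(2) \<psi>)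
    have e2: "partial i (\<lambda>x. partial j (\<lambda>x. W x $ i $ j) x + (\<Sum>k\<in>I. c k * partial j (\<psi> k) x))
       = (\<lambda>x. partial i (partial j (\<lambda>x. W x $ i $ j)) x + (\<Sum>k\<in>I. c k * partial i (partial j (\<psi> k)) x))"
      using C1_add(2)[OF C2_C1(2)[OF w], of "\<lambda>x. \<Sum>k\<in>I. c k * partial j (\<psi> k) x" i j] s2 \<psi>
      by (simp add: C1_cmult C2_C1)
    show ?thesis unfolding fe e1 e2 by (simp add: c_def sum_negf)
  qed
  show ?thesis unfolding divdiv_def eq
    by (simp add: sum_subtractf, subst sum.swap, subst (2) sum.swap, rule refl)
qed

text \<open>With cells of size at most half of \<delta>, the cells of the lattice points under a
  bump of width \<delta> fit into a cube of side 2 \<delta>. The resulting factor 2^d equals the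
  volume of \<open>unit_cube\<close>, so a density of total mass at most 1 asks for no more slopes
  than there are.\<close>

lemma card_bump_lattice_points:
  fixes M :: "real^'n^'n" and a :: "real^'n"
  assumes det: "det M \<noteq> 0" and \<delta>: "0 < \<delta>" and cell: "\<And>t. t \<in> unit_cell \<Longrightarrow> norm (M *v t) \<le> \<delta> / 2"
  defines "Z \<equiv> {z. 0 < bump ((1 / \<delta>) *\<^sub>R (M *v ivec z - a))}"
  shows "finite Z" "\<bar>det M\<bar> * real (card Z) \<le> 2 ^ CARD('n) * \<delta> ^ CARD('n)"
proof -
  have comp: "\<bar>(M *v ivec z) $ i - a $ i\<bar> < \<delta> / 2" if "z \<in> Z" for z i
    using that \<delta> unfolding Z_def bump_pos_iff by (auto simp: abs_mult field_simps dest!: spec[of _ i])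
  let ?B = "cbox (\<chi> i. a $ i - \<delta>) (\<chi> i. a $ i + \<delta>)"
  have "Z \<subseteq> {z. M *v ivec z \<in> ?B}"
  proof
    fix z assume z: "z \<in> Z"
    show "z \<in> {z. M *v ivec z \<in> ?B}"
      using comp[OF z] \<delta> by (simp add: mem_box_cart) (smt (verit) field_sum_of_halves)
  qed
  then show fin: "finite Z" using finite_lattice_points[OF det bounded_cbox] finite_subset by blast
  have "\<bar>det M\<bar> * real (card Z) \<le> measure lebesgue ?B"
  proof (rule card_lattice_cells_le[OF det fin])
    fix z assume z: "z \<in> Z"
    show "lattice_cell M z \<subseteq> ?B"
    proof
      fix x assume "x \<in> lattice_cell M z"
      then obtain t where t: "t \<in> unit_cell" "x = M *v ivec z + M *v t"
        by (auto simp: lattice_cell_def matrix_vector_right_distrib)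
      have "\<bar>(M *v t) $ i\<bar> \<le> \<delta> / 2" for i
        using cell[OF t(1)] component_le_norm_cart[of "M *v t" i] by linarith
      then have "a $ i - \<delta> \<le> x $ i \<and> x $ i \<le> a $ i + \<delta>" for i
        using comp[OF z, of i] by (simp add: t(2)) (smt (verit) field_sum_of_halves)
      then show "x \<in> ?B" by (simp add: mem_box_cart)
    qed
  qed simp
  also have "\<dots> = (\<Prod>i\<in>(UNIV::'n set). 2 * \<delta>)"
    using \<delta> by (simp add: content_cbox_cart interval_ne_empty_cart)
  finally show "\<bar>det M\<bar> * real (card Z) \<le> 2 ^ CARD('n) * \<delta> ^ CARD('n)" by (simp add: power_mult_distrib)
qed

text \<open>The cube around \<open>a k\<close> carries its own lattice \<open>h T\<^sub>k \<int>\<^sup>d\<close>, where \<open>T\<^sub>k T\<^sub>k\<^sup>t = A k\<close>: in lattice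
  coordinates \<open>A k\<close> is the identity, and the constant does not depend on its ellipticity.\<close>

lemma compensated_inequality_cubes:
  fixes W :: "real^'n \<Rightarrow> real^'n^'n" and a :: "'k \<Rightarrow> real^'n"
  assumes I: "finite I" and \<delta>: "0 < \<delta>" and W: "C2_supp R W" "0 \<le> R"
    and A: "\<And>k. k \<in> I \<Longrightarrow> psd_sym (A k)" "\<And>k. k \<in> I \<Longrightarrow> det (A k) \<noteq> 0"
    and f: "\<And>k. k \<in> I \<Longrightarrow> 0 < f k" "(\<Sum>k\<in>I. f k * \<delta> ^ CARD('n)) \<le> 1"
  defines "\<psi> \<equiv> \<lambda>k x. bump ((1 / \<delta>) *\<^sub>R (x - a k))"
  assumes disj: "\<And>k l x. k \<in> I \<Longrightarrow> l \<in> I \<Longrightarrow> 0 < \<psi> k x \<Longrightarrow> 0 < \<psi> l x \<Longrightarrow> k = l"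
    and psd: "\<And>x. psd_sym (W x - (\<Sum>k\<in>I. \<psi> k x *\<^sub>R A k))"
  shows "real CARD('n) * bump_mass TYPE('n) * (\<Sum>k\<in>I. \<delta> ^ CARD('n) * (det (A k) * f k) powr (1 / real CARD('n)))
     \<le> (\<Sum>i\<in>UNIV. \<integral>x. \<bar>div_row W i x\<bar> \<partial>lborel)"
proof (rule le_if_le_add_eps_mult)
  fix \<epsilon> :: real assume eps: "0 < \<epsilon>"
  let ?d = "real CARD('n)"
  define S where "S = R + (\<Sum>k\<in>I. norm (a k) + ?d * \<delta>)"
  have S: "0 \<le> S" "R \<le> S" unfolding S_def using W(2) \<delta> by (auto intro!: add_nonneg_nonneg sum_nonneg)
  have \<psi>: "C2 (\<psi> k)" "0 \<le> \<psi> k x" "(\<integral>x. \<psi> k x \<partial>lborel) = \<delta> ^ CARD('n) * bump_mass TYPE('n)" for k x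
    unfolding \<psi>_def using C2_bump_affine bump_nonneg bump_affine_integral[OF \<delta>] by auto
  have s\<psi>: "supp_ball S (\<psi> k)" if "k \<in> I" for k
  proof -
    have "norm (a k) + ?d * \<delta> \<le> (\<Sum>k\<in>I. norm (a k) + ?d * \<delta>)"
      using I that \<delta> by (intro member_le_sum[where f="\<lambda>k. norm (a k) + ?d * \<delta>"]) auto
    then have "norm (a k) + ?d * \<delta> \<le> S" using W(2) by (simp add: S_def)
    then show ?thesis using supp_ball_mono[OF supp_ball_bump_affine[OF \<delta>, of "a k"]] by (simp add: \<psi>_def)
  qed
  have "\<exists>T::real^'n^'n. A k = T ** transpose T" if "k \<in> I" for k using psd_sym_factor[OF A(1)[OF that]] by metis
  then obtain T :: "'k \<Rightarrow> real^'n^'n" where T: "\<And>k. k \<in> I \<Longrightarrow> A k = T k ** transpose (T k)" by metis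
  have detA: "det (A k) = (det (T k))\<^sup>2" if "k \<in> I" for k
    using T[OF that] by (simp add: det_mul det_transpose power2_eq_square)
  have detT: "det (T k) \<noteq> 0" if "k \<in> I" for k using A(2)[OF that] detA[OF that] by auto
  define P where "P k h0 \<longleftrightarrow> (\<forall>h u. 0 < h \<longrightarrow> h < h0 \<longrightarrow> convex_potential u \<longrightarrow>
     (\<forall>z. 0 < \<psi> k ((h *\<^sub>R T k) *v ivec z) \<longrightarrow> f k * \<bar>det (h *\<^sub>R T k)\<bar>
         \<le> measure lebesgue {p \<in> unit_cube. \<forall>y. u ((h *\<^sub>R T k) *v ivec z) + p \<bullet> (y - (h *\<^sub>R T k) *v ivec z) \<le> u y}) \<longrightarrow>
    ?d * ((det (T k))\<^sup>2 * f k) powr (1 / ?d) * (\<integral>x. \<psi> k x \<partial>lborel) - \<epsilon>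
      \<le> (\<Sum>i\<in>UNIV. \<integral>x. u x * dir2 (column i (T k)) (\<psi> k) x \<partial>lborel))" for k h0
  define Q where "Q k h0 \<longleftrightarrow> (\<forall>h t. 0 < h \<longrightarrow> h < h0 \<longrightarrow> t \<in> unit_cell \<longrightarrow> norm ((h *\<^sub>R T k) *v t) \<le> \<delta> / 2)" for k h0
  have "\<exists>h0>0. P k h0" if "k \<in> I" for k
    by (rule local_lower_bound[OF \<psi>(1) s\<psi>[OF that] S(1) \<psi>(2) detT[OF that] less_imp_le[OF f(1)[OF that]] eps])
      (auto simp: P_def)
  then obtain H1 where H1: "\<And>k. k \<in> I \<Longrightarrow> 0 < H1 k" "\<And>k. k \<in> I \<Longrightarrow> P k (H1 k)" by metis
  have "\<exists>h0>0. Q k h0" for k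
    by (rule scaled_lattice_mesh[of "\<delta> / 2" "T k"]) (use \<delta> in \<open>auto simp: Q_def\<close>)
  then obtain H2 where H2: "\<And>k. 0 < H2 k" "\<And>k. Q k (H2 k)" by metis
  \<comment> \<open>A single \<open>h\<close> for all cubes, although their lattices differ;
    possible because \<open>I\<close> is finite.\<close>
  obtain h where h: "0 < h" "\<And>k. k \<in> I \<Longrightarrow> h < H1 k \<and> h < H2 k"
  proof -
    define m where "m = Min (insert 1 ((\<lambda>k. min (H1 k) (H2 k)) ` I))"
    have "0 < m" unfolding m_def using I H1(1) H2(1) by auto
    moreover have "m \<le> min (H1 k) (H2 k)" if "k \<in> I" for k unfolding m_def using I that by (intro Min_le) auto
    ultimately show ?thesis using that[of "m / 2"] by (force simp: min_def split: if_splits)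
  qed
  define M where "M k = h *\<^sub>R T k" for k
  have detM: "det (M k) \<noteq> 0" if "k \<in> I" for k using detT[OF that] h(1) by (simp add: M_def det_scaleR)
  define Z where "Z k = {z. 0 < \<psi> k (M k *v ivec z)}" for k
  have cellM: "norm (M k *v t) \<le> \<delta> / 2" if "k \<in> I" "t \<in> unit_cell" for k t
    using H2(2)[of k] h that unfolding Q_def M_def by blast
  have Z: "finite (Z k)" "\<bar>det (M k)\<bar> * real (card (Z k)) \<le> 2 ^ CARD('n) * \<delta> ^ CARD('n)" if "k \<in> I" for k
    using card_bump_lattice_points[OF detM[OF that] \<delta> cellM[OF that], of "a k"] unfolding Z_def \<psi>_def by auto
  define X where "X k = (\<lambda>z. M k *v ivec z) ` Z k" for k
  \<comment> \<open>The cube that owns an atom; it is unique because no point lies under two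
    bumps.\<close>
  define \<kappa> where "\<kappa> x = (SOME k. k \<in> I \<and> 0 < \<psi> k x)" for x
  have \<kappa>: "\<kappa> x = k" if "k \<in> I" "x \<in> X k" for k x
  proof -
    have k: "k \<in> I \<and> 0 < \<psi> k x" using that by (auto simp: X_def Z_def)
    then have "\<kappa> x \<in> I \<and> 0 < \<psi> (\<kappa> x) x" unfolding \<kappa>_def by (rule someI)
    then show ?thesis using disj k by blast
  qed
  \<comment> \<open>Density times cell volume of the owner's lattice, so that counting the atoms of
    a cube makes the dependence on the lattice disappear.\<close>
  define F where "F x = f (\<kappa> x) * \<bar>det (M (\<kappa> x))\<bar>" for x
  obtain u where u: "convex_potential u"
    "\<And>x. x \<in> (\<Union>k\<in>I. X k) \<Longrightarrow> F x \<le> measure lebesgue {p \<in> unit_cube. \<forall>y. u x + p \<bullet> (y - x) \<le> u y}"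
  proof (rule semidiscrete_convex_potential[of "\<Union>k\<in>I. X k" F])
    show "finite (\<Union>k\<in>I. X k)" using I Z(1) by (auto simp: X_def)
    show "0 < F x" if "x \<in> (\<Union>k\<in>I. X k)" for x
      using that \<kappa> f(1) detM by (auto simp: F_def)
    have "(\<Sum>x\<in>(\<Union>k\<in>I. X k). F x) = (\<Sum>k\<in>I. \<Sum>x\<in>X k. F x)"
    proof (rule sum.UNION_disjoint[OF I])
      show "\<forall>k\<in>I. finite (X k)" using Z(1) by (auto simp: X_def)
      show "\<forall>i\<in>I. \<forall>j\<in>I. i \<noteq> j \<longrightarrow> X i \<inter> X j = {}" using \<kappa> by blast
    qed
    also have "\<dots> \<le> (\<Sum>k\<in>I. 2 ^ CARD('n) * (f k * \<delta> ^ CARD('n)))"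
    proof (rule sum_mono)
      fix k assume k: "k \<in> I"
      have "(\<Sum>x\<in>X k. F x) = (\<Sum>x\<in>X k. f k * \<bar>det (M k)\<bar>)" using \<kappa>[OF k] by (intro sum.cong) (auto simp: F_def)
      also have "\<dots> = f k * (\<bar>det (M k)\<bar> * real (card (X k)))" by simp
      also have "\<dots> \<le> f k * (\<bar>det (M k)\<bar> * real (card (Z k)))"
        using card_image_le[OF Z(1)[OF k]] f(1)[OF k] by (intro mult_left_mono) (auto simp: X_def)
      also have "\<dots> \<le> f k * (2 ^ CARD('n) * \<delta> ^ CARD('n))"
        using Z(2)[OF k] f(1)[OF k] by (intro mult_left_mono) auto
      finally show "(\<Sum>x\<in>X k. F x) \<le> 2 ^ CARD('n) * (f k * \<delta> ^ CARD('n))" by (simp add: mult_ac)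
    qed
    also have "\<dots> \<le> 2 ^ CARD('n)" using f(2) unfolding sum_distrib_left[symmetric] by simp
    finally show "(\<Sum>x\<in>(\<Union>k\<in>I. X k). F x) \<le> 2 ^ CARD('n)" .
  qed blast
  have low: "?d * (det (A k) * f k) powr (1 / ?d) * (\<delta> ^ CARD('n) * bump_mass TYPE('n)) - \<epsilon>
      \<le> (\<Sum>i\<in>UNIV. \<integral>x. u x * dir2 (column i (T k)) (\<psi> k) x \<partial>lborel)" if k: "k \<in> I" for k
  proof -
    have "f k * \<bar>det (h *\<^sub>R T k)\<bar>
         \<le> measure lebesgue {p \<in> unit_cube. \<forall>y. u ((h *\<^sub>R T k) *v ivec z) + p \<bullet> (y - (h *\<^sub>R T k) *v ivec z) \<le> u y}"
      if "0 < \<psi> k ((h *\<^sub>R T k) *v ivec z)" for z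
    proof -
      have x: "M k *v ivec z \<in> X k" using that by (auto simp: X_def Z_def M_def)
      then show ?thesis using u(2)[of "M k *v ivec z"] k \<kappa>[OF k x] by (auto simp: F_def M_def)
    qed
    then show ?thesis using H1(2)[OF k] h u(1) k unfolding P_def \<psi>(3) detA[OF k] by blast
  qed
  \<comment> \<open>\<open>W\<close> dominates the sum of the localised frozen tensors, so the
    difference pairs nonnegatively with the convex \<open>u\<close>; the lower bounds on the
    separate cubes therefore add up below the pairing with \<open>W\<close>.\<close>
  let ?W' = "\<lambda>x. W x - (\<Sum>k\<in>I. \<psi> k x *\<^sub>R A k)"
  have W': "C2_supp S ?W'"
    unfolding C2_supp_def
  proof (intro allI conjI)
    fix i j
    have e: "(\<lambda>x. ?W' x $ i $ j) = (\<lambda>x. W x $ i $ j - (\<Sum>k\<in>I. \<psi> k x * A k $ i $ j))" by simp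
    show "C2 (\<lambda>x. ?W' x $ i $ j)" unfolding e
      using W(1) by (intro C2_diff C2_sum C2_mult C2_const \<psi>) (simp add: C2_supp_def)
    show "supp_ball S (\<lambda>x. ?W' x $ i $ j)" unfolding e
      using W(1) S(2) by (intro supp_ball_diff supp_ball_sum supp_ball_mult(1) s\<psi>) (auto simp: C2_supp_def intro: supp_ball_mono)
  qed
  note cu = convex_potential_continuous[OF u(1)]
  have iW: "integrable lborel (\<lambda>x. u x * divdiv W x)"
    using divdiv_continuous[OF W(1)] by (intro integrable_continuous_supp_ball[where R=R] continuous_intros cu supp_ball_mult(2))
  have i2: "integrable lborel (\<lambda>x. u x * dir2 (column l (T k)) (\<psi> k) x)" if "k \<in> I" for l k
    by (intro integrable_continuous_supp_ball[where R=S] continuous_intros cu continuous_on_dir2 \<psi> supp_ball_mult(2) supp_ball_dir2 s\<psi> that)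
  have dd: "u x * divdiv ?W' x = u x * divdiv W x - (\<Sum>k\<in>I. \<Sum>l\<in>UNIV. u x * dir2 (column l (T k)) (\<psi> k) x)" for x
    unfolding divdiv_diff_sum[OF W(1) \<psi>(1)] right_diff_distrib sum_distrib_left[symmetric]
    using T by (simp add: dir2_sum_columns cong: sum.cong)
  have "0 \<le> (\<integral>x. u x * divdiv ?W' x \<partial>lborel)"
    by (rule convex_potential_divdiv_nonneg[OF u(1) W' S(1) psd])
  also have "\<dots> = (\<integral>x. u x * divdiv W x \<partial>lborel) - (\<Sum>k\<in>I. \<Sum>l\<in>UNIV. \<integral>x. u x * dir2 (column l (T k)) (\<psi> k) x \<partial>lborel)"
    unfolding dd using iW i2 by (simp add: Bochner_Integration.integral_sum)
  finally have "(\<Sum>k\<in>I. \<Sum>l\<in>UNIV. \<integral>x. u x * dir2 (column l (T k)) (\<psi> k) x \<partial>lborel) \<le> (\<integral>x. u x * divdiv W x \<partial>lborel)" by simp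
  also have "\<dots> \<le> (\<Sum>i\<in>UNIV. \<integral>x. \<bar>div_row W i x\<bar> \<partial>lborel)" by (rule convex_potential_divdiv_le[OF u(1) W])
  finally have up: "(\<Sum>k\<in>I. \<Sum>l\<in>UNIV. \<integral>x. u x * dir2 (column l (T k)) (\<psi> k) x \<partial>lborel) \<le> (\<Sum>i\<in>UNIV. \<integral>x. \<bar>div_row W i x\<bar> \<partial>lborel)" .
  have "?d * bump_mass TYPE('n) * (\<Sum>k\<in>I. \<delta> ^ CARD('n) * (det (A k) * f k) powr (1 / ?d)) - \<epsilon> * card I
      = (\<Sum>k\<in>I. ?d * (det (A k) * f k) powr (1 / ?d) * (\<delta> ^ CARD('n) * bump_mass TYPE('n)) - \<epsilon>)"
    by (simp add: sum_subtractf sum_distrib_left mult_ac)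
  also have "\<dots> \<le> (\<Sum>k\<in>I. \<Sum>l\<in>UNIV. \<integral>x. u x * dir2 (column l (T k)) (\<psi> k) x \<partial>lborel)"
    by (rule sum_mono[OF low])
  finally show "?d * bump_mass TYPE('n) * (\<Sum>k\<in>I. \<delta> ^ CARD('n) * (det (A k) * f k) powr (1 / ?d))
      \<le> (\<Sum>i\<in>UNIV. \<integral>x. \<bar>div_row W i x\<bar> \<partial>lborel) + \<epsilon> * card I" using up by linarith
qed simp

section \<open>The inequality for smooth tensors\<close>

lemma psd_symI:
  assumes "\<And>i j. M $ i $ j = M $ j $ i" "\<And>v. 0 \<le> v \<bullet> (M *v v)"
  shows "psd_sym M"
  using assms by (simp add: psd_sym_def transpose_def vec_eq_iff)

lemma lattice_sum_identity_tendsto: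
  fixes \<psi> :: "real^'n \<Rightarrow> real"
  assumes "continuous_on UNIV \<psi>" "supp_ball R \<psi>"
  shows "((\<lambda>h. lattice_sum (h *\<^sub>R mat 1) \<psi>) \<longlongrightarrow> (\<integral>x. \<psi> x \<partial>lborel)) (at_right 0)"
proof (rule tendstoI)
  fix e :: real assume "0 < e"
  then have e2: "0 < e / 2" by simp
  have "det (mat 1 :: real^'n^'n) \<noteq> 0" by simp
  from lattice_sum_tendsto_integral[OF assms this e2] obtain h0 where
    h0: "0 < h0" "\<And>h. 0 < h \<Longrightarrow> h < h0 \<Longrightarrow> \<bar>lattice_sum (h *\<^sub>R mat 1) \<psi> - (\<integral>x. \<psi> x \<partial>lborel)\<bar> \<le> e / 2" by metis
  show "\<forall>\<^sub>F h in at_right 0. dist (lattice_sum (h *\<^sub>R mat 1) \<psi>) (\<integral>x. \<psi> x \<partial>lborel) < e"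
    unfolding eventually_at_right_field dist_real_def
  proof (intro exI[of _ h0] conjI allI impI h0(1))
    fix h assume "0 < h" "h < h0"
    then show "\<bar>lattice_sum (h *\<^sub>R mat 1) \<psi> - (\<integral>x. \<psi> x \<partial>lborel)\<bar> < e" using h0(2)[of h] \<open>0 < e\<close> by linarith
  qed
qed

lemma quadratic_form_entry_bound:
  fixes E :: "real^'n^'n"
  assumes "\<And>i j. \<bar>E $ i $ j\<bar> \<le> c"
  shows "\<bar>v \<bullet> (E *v v)\<bar> \<le> c * (real CARD('n))\<^sup>2 * (v \<bullet> v)"
proof -
  have c: "0 \<le> c" using assms[of undefined undefined] by linarith
  have "\<bar>v \<bullet> (E *v v)\<bar> \<le> (\<Sum>i\<in>UNIV. \<Sum>j\<in>UNIV. c * (\<bar>v $ i\<bar> * \<bar>v $ j\<bar>))"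
    unfolding quadratic_form_sum
  proof (rule order_trans[OF sum_abs sum_mono], rule order_trans[OF sum_abs sum_mono])
    fix i j show "\<bar>E $ i $ j * v $ i * v $ j\<bar> \<le> c * (\<bar>v $ i\<bar> * \<bar>v $ j\<bar>)"
      using mult_right_mono[OF assms[of i j], of "\<bar>v $ i\<bar> * \<bar>v $ j\<bar>"] by (simp add: abs_mult mult.assoc)
  qed
  also have "\<dots> = c * (\<Sum>i\<in>UNIV. \<bar>v $ i\<bar>)\<^sup>2"
  proof -
    have sq: "(\<Sum>i\<in>UNIV. \<bar>v $ i\<bar>)\<^sup>2 = (\<Sum>i\<in>UNIV. \<Sum>j\<in>UNIV. \<bar>v $ i\<bar> * \<bar>v $ j\<bar>)"
      by (simp only: power2_eq_square sum_product)
    show ?thesis unfolding sq by (simp only: sum_distrib_left)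
  qed
  also have "\<dots> \<le> c * (real CARD('n) * norm v)\<^sup>2"
    by (intro mult_left_mono power_mono sum_abs_le_norm c) (simp add: sum_nonneg)
  finally show ?thesis by (simp add: power_mult_distrib power2_norm_eq_inner mult.assoc)
qed

lemma det_pos_if_ge_identity:
  fixes M :: "real^'n^'n"
  assumes "psd_sym M" "\<And>v. v \<bullet> v \<le> v \<bullet> (M *v v)"
  shows "0 < det M"
proof -
  have "inj ((*v) M)"
  proof (rule injI)
    fix x y assume "M *v x = M *v y"
    then have "M *v (x - y) = 0" by (simp add: matrix_vector_mult_diff_distrib)
    then have "(x - y) \<bullet> (x - y) \<le> 0" using assms(2)[of "x - y"] by simp
    then have "(x - y) \<bullet> (x - y) = 0" using inner_ge_zero[of "x - y"] by linarith
    then show "x = y" by simp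
  qed
  then have "det M \<noteq> 0" using inj_matrix_vector_mult invertible_det_nz
    by (metis matrix_left_invertible_injective invertible_left_inverse)
  then show ?thesis using psd_sym_det_nonneg[OF assms(1)] by simp
qed

lemma power_powr_inverse: "0 \<le> x \<Longrightarrow> 0 < n \<Longrightarrow> (x ^ n) powr (1 / real n) = x"
  by (cases "x = 0") (simp_all add: powr_powr flip: powr_realpow)

text \<open>On cubes of side \<open>h\<close> around the points of h Z^d the tensor is frozen to
  half its value at the centre, which \<open>A\<close> dominates nearby because it is at least the
  identity and varies little. With a density proportional to g^d both sides are Riemann sums, and
  \<open>h\<close> tends to 0.\<close>

lemma compensated_inequality_smooth:
  fixes A :: "real^'n \<Rightarrow> real^'n^'n"
  assumes A: "\<And>i j. C2 (\<lambda>x. A x $ i $ j)" "\<And>x. psd_sym (A x)" "\<And>x v. v \<bullet> v \<le> v \<bullet> (A x *v v)"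
    and \<zeta>: "C2 \<zeta>" "supp_ball R \<zeta>" "0 \<le> R" "\<And>x. 0 \<le> \<zeta> x" "\<And>x. norm x \<le> r \<Longrightarrow> 1 \<le> \<zeta> x"
    and g: "continuous_on UNIV g" "supp_ball r0 g" "\<And>x. 0 \<le> g x" "r0 < r"
  shows "real CARD('n) * bump_mass TYPE('n) / 2 * (\<integral>x. g x * det (A x) powr (1 / real CARD('n)) \<partial>lborel)
     \<le> (\<Sum>i\<in>UNIV. \<integral>x. \<bar>div_row (\<lambda>x. \<zeta> x *\<^sub>R A x) i x\<bar> \<partial>lborel)
        * (\<integral>x. g x ^ CARD('n) \<partial>lborel) powr (1 / real CARD('n))"
proof -
  let ?d = "real CARD('n)"
  let ?q = "1 / ?d"
  let ?W = "\<lambda>x. \<zeta> x *\<^sub>R A x"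
  define \<beta> where "\<beta> = (\<Sum>i\<in>UNIV. \<integral>x. \<bar>div_row ?W i x\<bar> \<partial>lborel)"
  have W: "C2_supp R ?W"
    unfolding C2_supp_def using C2_mult[OF \<zeta>(1) A(1)] supp_ball_mult(1)[OF \<zeta>(2)] by simp
  define G where "G x = det (A x) powr ?q" for x
  have detA: "0 < det (A x)" for x by (rule det_pos_if_ge_identity[OF A(2,3)])
  have cdet: "continuous_on UNIV (\<lambda>x. det (A x))"
    unfolding det_def by (intro continuous_intros C2_continuous A(1))
  have cG: "continuous_on UNIV G" unfolding G_def
    by (intro continuous_on_powr cdet continuous_on_const) (use detA in \<open>auto simp: less_imp_neq[symmetric]\<close>)
  define L1 where "L1 h = lattice_sum (h *\<^sub>R mat 1) (\<lambda>x. g x * G x)" for h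
  define L2 where "L2 h = lattice_sum (h *\<^sub>R mat 1) (\<lambda>x. g x ^ CARD('n))" for h
  have gd: "continuous_on UNIV (\<lambda>x. g x ^ CARD('n))" "supp_ball r0 (\<lambda>x. g x ^ CARD('n))"
    using g by (auto intro: continuous_intros simp: supp_ball_def)
  have lim1: "(L1 \<longlongrightarrow> (\<integral>x. g x * G x \<partial>lborel)) (at_right 0)"
    unfolding L1_def by (rule lattice_sum_identity_tendsto[OF continuous_on_mult[OF g(1) cG] supp_ball_mult(1)[OF g(2)]])
  have lim2: "(L2 \<longlongrightarrow> (\<integral>x. g x ^ CARD('n) \<partial>lborel)) (at_right 0)"
    unfolding L2_def by (rule lattice_sum_identity_tendsto[OF gd])
  \<comment> \<open>Entries that differ by at most 1 / d^2 change the quadratic form by at most that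
    of the identity, which \<open>A\<close> dominates; the factor 1/2 pays for this.\<close>
  obtain \<eta> where \<eta>: "0 < \<eta>" "\<And>x y i j. x \<in> cball 0 r \<Longrightarrow> y \<in> cball 0 r \<Longrightarrow> dist x y < \<eta> \<Longrightarrow> \<bar>A x $ i $ j - A y $ i $ j\<bar> \<le> 1 / ?d\<^sup>2"
  proof -
    define P where "P p e \<longleftrightarrow> (\<forall>x\<in>cball 0 r. \<forall>y\<in>cball 0 r. dist x y < e \<longrightarrow> \<bar>A x $ fst p $ snd p - A y $ fst p $ snd p\<bar> \<le> 1 / ?d\<^sup>2)" for p e
    have "\<exists>e>0. P p e" for p
    proof -
      have "uniformly_continuous_on (cball 0 r) (\<lambda>x. A x $ fst p $ snd p)"
        by (intro compact_uniformly_continuous continuous_on_subset[OF C2_continuous[OF A(1)]]) auto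
      moreover have "0 < 1 / ?d\<^sup>2" by simp
      ultimately obtain e where e: "0 < e" "\<And>x y. x \<in> cball 0 r \<Longrightarrow> y \<in> cball 0 r \<Longrightarrow> dist y x < e \<Longrightarrow> dist (A y $ fst p $ snd p) (A x $ fst p $ snd p) < 1 / ?d\<^sup>2"
        unfolding uniformly_continuous_on_def by metis
      then have "P p e" unfolding P_def dist_real_def by (metis less_imp_le)
      then show ?thesis using e(1) by blast
    qed
    then obtain e where e: "\<And>p. 0 < e p" "\<And>p. P p (e p)" by metis
    show ?thesis
    proof (rule that[of "Min (range e)"])
      show "0 < Min (range e)" using e(1) by simp
      fix x y :: "real^'n" and i j
      assume xy: "x \<in> cball 0 r" "y \<in> cball 0 r" "dist x y < Min (range e)"
      have "Min (range e) \<le> e (i, j)" by simp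
      then show "\<bar>A x $ i $ j - A y $ i $ j\<bar> \<le> 1 / ?d\<^sup>2" using xy e(2)[of "(i, j)"] by (simp add: P_def)
    qed
  qed
  have half: "0 \<le> v \<bullet> (A x *v v) - 1/2 * (v \<bullet> (A y *v v))" if "x \<in> cball 0 r" "y \<in> cball 0 r" "dist x y < \<eta>" for x y v
  proof -
    have "\<bar>v \<bullet> ((A x - A y) *v v)\<bar> \<le> 1 / ?d\<^sup>2 * ?d\<^sup>2 * (v \<bullet> v)"
      by (rule quadratic_form_entry_bound) (use \<eta>(2)[OF that] in simp)
    then have "v \<bullet> (A y *v v) - v \<bullet> (A x *v v) \<le> v \<bullet> v"
      by (simp add: matrix_vector_mult_diff_rdistrib inner_diff_right abs_le_iff)
    then show ?thesis using A(3)[of v x] by linarith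
  qed
  \<comment> \<open>\<open>h\<close> is so small that a cube around a point of the support of
    \<open>g\<close> lies where \<zeta> is at least 1 and where \<open>A\<close> varies by the
    allowed amount.\<close>
  have main: "?d * bump_mass TYPE('n) / 2 * L1 h \<le> \<beta> * L2 h powr ?q"
    if h: "0 < h" "h < min (\<eta> / ?d) ((r - r0) / ?d)" for h
  proof -
    let ?M = "h *\<^sub>R mat 1 :: real^'n^'n"
    have det: "det ?M = h ^ CARD('n)" by (simp add: det_scaleR)
    have Mz: "?M *v ivec z = h *\<^sub>R ivec z" for z by (simp add: scaleR_matrix_vector_assoc[symmetric])
    define I where "I = {z::int^'n. g (h *\<^sub>R ivec z) \<noteq> 0}"
    have gn: "norm x \<le> r0" if "g x \<noteq> 0" for x using g(2) that unfolding supp_ball_def by (meson not_le)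
    then have sub: "I \<subseteq> {z. ?M *v ivec z \<in> cball 0 r0}" 
      unfolding Mz I_def mem_cball_0 by blast
    have I: "finite I"
      by (rule finite_subset[OF sub finite_lattice_points[OF _ bounded_cball]]) (use det h(1) in simp)
    define a where "a z = h *\<^sub>R (ivec z :: real^'n)" for z
    have L1: "L1 h = h ^ CARD('n) * (\<Sum>z\<in>I. g (a z) * G (a z))"
      unfolding L1_def using h(1) by (subst lattice_sum_eq[OF I]) (auto simp: Mz det I_def a_def)
    have L2: "L2 h = h ^ CARD('n) * (\<Sum>z\<in>I. g (a z) ^ CARD('n))"
      unfolding L2_def using h(1) by (subst lattice_sum_eq[OF I]) (auto simp: Mz det I_def a_def)
    show ?thesis
    proof (cases "I = {}")
      case True
      then show ?thesis by (simp add: L1 L2)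
    next
      case False
      have gp: "0 < g (a z)" if "z \<in> I" for z using that g(3)[of "a z"] by (auto simp: I_def a_def less_eq_real_def)
      have L2p: "0 < L2 h" unfolding L2 using h(1) I False gp by (intro mult_pos_pos sum_pos) auto
      \<comment> \<open>Normalised to total mass 1 after multiplication by the cube volume; its d-th
        root is \<open>g\<close> divided by the discrete L^d norm.\<close>
      define f where "f z = g (a z) ^ CARD('n) / L2 h" for z
      have an: "norm (a z) \<le> r0" if "z \<in> I" for z
        using that gn unfolding I_def a_def by blast
      let ?\<psi> = "\<lambda>z x. bump ((1 / h) *\<^sub>R (x - a z))"
      have near: "\<bar>x $ i - a z $ i\<bar> < h / 2" if "0 < ?\<psi> z x" for z x i
        using that h(1) unfolding bump_pos_iff by (auto simp: abs_mult field_simps dest!: spec[of _ i])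
      have core: "?d * bump_mass TYPE('n) * (\<Sum>z\<in>I. h ^ CARD('n) * (det ((1/2) *\<^sub>R A (a z)) * f z) powr ?q) \<le> \<beta>"
        unfolding \<beta>_def
      proof (rule compensated_inequality_cubes[OF I h(1) W \<zeta>(3)])
        show "psd_sym ((1/2) *\<^sub>R A (a z))" for z
          using A(2)[of "a z"] unfolding psd_sym_def
          by (auto simp: scaleR_matrix_vector_assoc[symmetric] transpose_def vec_eq_iff)
        show "det ((1/2) *\<^sub>R A (a z)) \<noteq> 0" for z using detA[of "a z"] by (simp add: det_scaleR)
        show "0 < f z" if "z \<in> I" for z using gp[OF that] L2p by (simp add: f_def)
        have "(\<Sum>z\<in>I. f z * h ^ CARD('n)) = L2 h / L2 h"
          unfolding f_def by (subst (2) L2) (simp add: sum_distrib_left sum_divide_distrib mult.commute)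
        then show "(\<Sum>z\<in>I. f z * h ^ CARD('n)) \<le> 1" using L2p by simp
        \<comment> \<open>Centres of overlapping bumps would have coordinates differing by less than
          \<open>h\<close>, while distinct points of h Z^d differ by at least \<open>h\<close> in
          some coordinate.\<close>
        show uniq: "z = w" if "0 < ?\<psi> z x" "0 < ?\<psi> w x" for z w x
        proof -
          have "z $ i = w $ i" for i
          proof -
            have "\<bar>a z $ i - a w $ i\<bar> < h" using near[OF that(1), of i] near[OF that(2), of i] by linarith
            also have "\<bar>a z $ i - a w $ i\<bar> = h * \<bar>real_of_int (z $ i) - real_of_int (w $ i)\<bar>"
              using h(1) by (simp add: a_def ivec_def abs_mult right_diff_distrib[symmetric])
            finally have "\<bar>real_of_int (z $ i) - real_of_int (w $ i)\<bar> < 1" using h(1) by simp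
            then show ?thesis by linarith
          qed
          then show ?thesis by (simp add: vec_eq_iff)
        qed
        fix x
        have qW: "0 \<le> \<zeta> x * (v \<bullet> (A x *v v))" for v
          using \<zeta>(4) A(2)[of x] by (simp add: psd_sym_def)
        have sy: "A y $ i $ j = A y $ j $ i" for y i j using psd_sym_entry_commute[OF A(2)] .
        show "psd_sym (\<zeta> x *\<^sub>R A x - (\<Sum>z\<in>I. ?\<psi> z x *\<^sub>R ((1/2) *\<^sub>R A (a z))))"
        proof (cases "\<exists>z\<in>I. 0 < ?\<psi> z x")
          case True
          then obtain z where z: "z \<in> I" "0 < ?\<psi> z x" by blast
          have "(\<Sum>w\<in>I. ?\<psi> w x *\<^sub>R ((1/2) *\<^sub>R A (a w))) = (\<Sum>w\<in>I. if w = z then ?\<psi> z x *\<^sub>R ((1/2) *\<^sub>R A (a z)) else 0)"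
          proof (intro sum.cong refl)
            fix w
            have "?\<psi> w x = 0" if "w \<noteq> z" using that uniq[OF _ z(2), of w] bump_nonneg[of "(1 / h) *\<^sub>R (x - a w)"] by (auto simp: less_eq_real_def)
            then show "?\<psi> w x *\<^sub>R ((1/2) *\<^sub>R A (a w)) = (if w = z then ?\<psi> z x *\<^sub>R ((1/2) *\<^sub>R A (a z)) else 0)" by simp
          qed
          also have "\<dots> = ?\<psi> z x *\<^sub>R ((1/2) *\<^sub>R A (a z))" using z(1) I by simp
          finally have eq: "(\<Sum>w\<in>I. ?\<psi> w x *\<^sub>R ((1/2) *\<^sub>R A (a w))) = ?\<psi> z x *\<^sub>R ((1/2) *\<^sub>R A (a z))" .
          have "norm (x - a z) \<le> (\<Sum>i\<in>UNIV. \<bar>(x - a z) $ i\<bar>)" by (rule norm_le_l1_cart)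
          also have "\<dots> \<le> ?d * h"
          proof -
            have "\<bar>(x - a z) $ i\<bar> \<le> h" for i using near[OF z(2), of i] h(1) by simp
            then show ?thesis using sum_bounded_above[of UNIV "\<lambda>i. \<bar>(x - a z) $ i\<bar>" h] by simp
          qed
          finally have nx: "norm (x - a z) \<le> ?d * h" .
          have dh: "?d * h < \<eta>" "?d * h < r - r0" using h by (auto simp: field_simps)
          have xr: "x \<in> cball 0 r" using nx dh(2) an[OF z(1)] norm_triangle_sub[of x "a z"] by simp
          have ar: "a z \<in> cball 0 r" using an[OF z(1)] g(4) by simp
          have dd: "dist x (a z) < \<eta>" using nx dh(1) by (simp add: dist_norm)
          show ?thesis unfolding eq
          proof (rule psd_symI)
            show "(\<zeta> x *\<^sub>R A x - ?\<psi> z x *\<^sub>R ((1/2) *\<^sub>R A (a z))) $ i $ j = (\<zeta> x *\<^sub>R A x - ?\<psi> z x *\<^sub>R ((1/2) *\<^sub>R A (a z))) $ j $ i" for i j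
              using sy[of x i j] sy[of "a z" i j] by simp
            fix v
            have "0 \<le> v \<bullet> (A (a z) *v v)" using A(2)[of "a z"] by (simp add: psd_sym_def)
            then have "?\<psi> z x * (1/2 * (v \<bullet> (A (a z) *v v))) \<le> 1 * (1/2 * (v \<bullet> (A (a z) *v v)))"
              by (intro mult_right_mono bump_le_1) simp
            also have "\<dots> \<le> 1 * (v \<bullet> (A x *v v))" using half[OF xr ar dd, of v] by simp
            also have "\<dots> \<le> \<zeta> x * (v \<bullet> (A x *v v))"
              using \<zeta>(5)[of x] xr A(2)[of x] by (intro mult_right_mono) (auto simp: psd_sym_def)
            finally show "0 \<le> v \<bullet> ((\<zeta> x *\<^sub>R A x - ?\<psi> z x *\<^sub>R ((1/2) *\<^sub>R A (a z))) *v v)"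
              by (simp add: matrix_vector_mult_diff_rdistrib inner_diff_right scaleR_matrix_vector_assoc[symmetric])
          qed
        next
          case False
          then have "?\<psi> w x = 0" if "w \<in> I" for w using that bump_nonneg[of "(1 / h) *\<^sub>R (x - a w)"] by (auto simp: less_eq_real_def)
          then have eq: "(\<Sum>w\<in>I. ?\<psi> w x *\<^sub>R ((1/2) *\<^sub>R A (a w))) = 0" by (intro sum.neutral) simp
          show ?thesis unfolding eq
            by (rule psd_symI) (use sy[of x] qW in \<open>auto simp: scaleR_matrix_vector_assoc[symmetric]\<close>)
        qed
      qed
      have cell_term: "h ^ CARD('n) * (det ((1/2) *\<^sub>R A (a z)) * f z) powr ?q = (h ^ CARD('n) * (g (a z) * G (a z))) * (1/2 * (1 / L2 h powr ?q))"
        if "z \<in> I" for z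
      proof -
        have "det ((1/2) *\<^sub>R A (a z)) * f z = (1/2) ^ CARD('n) * (det (A (a z)) * (g (a z) ^ CARD('n) / L2 h))"
          by (simp add: f_def det_scaleR)
        then have "(det ((1/2) *\<^sub>R A (a z)) * f z) powr ?q
            = ((1/2) ^ CARD('n)) powr ?q * (det (A (a z)) powr ?q * ((g (a z) ^ CARD('n)) powr ?q / L2 h powr ?q))"
          using detA[of "a z"] g(3)[of "a z"] L2p by (simp add: powr_mult powr_divide)
        also have "\<dots> = 1/2 * (G (a z) * (g (a z) / L2 h powr ?q))"
        proof -
          have 1: "((1/2::real) ^ CARD('n)) powr ?q = 1/2" "(g (a z) ^ CARD('n)) powr ?q = g (a z)"
            by (rule power_powr_inverse; use g(3) in simp)+
          show ?thesis unfolding 1 G_def ..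
        qed
        finally show ?thesis by simp
      qed
      have "(\<Sum>z\<in>I. h ^ CARD('n) * (det ((1/2) *\<^sub>R A (a z)) * f z) powr ?q) = L1 h * (1/2 * (1 / L2 h powr ?q))"
        unfolding L1 sum_distrib_left sum_distrib_right by (intro sum.cong refl cell_term)
      then have "?d * bump_mass TYPE('n) * (L1 h * (1/2 * (1 / L2 h powr ?q))) \<le> \<beta>" using core by simp
      then show ?thesis using L2p by (simp add: field_simps)
    qed
  qed
  have "?d * bump_mass TYPE('n) / 2 * (\<integral>x. g x * G x \<partial>lborel) \<le> \<beta> * (\<integral>x. g x ^ CARD('n) \<partial>lborel) powr ?q"
  proof (rule tendsto_le[of "at_right 0"])
    show "at_right (0::real) \<noteq> bot" by simp
    have L2nn: "0 \<le> L2 h" for h unfolding L2_def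
    proof -
      have "0 \<le> Sum_any (\<lambda>z. g ((h *\<^sub>R mat 1) *v ivec z) ^ CARD('n))"
        unfolding Sum_any.expand_set using g(3) by (intro sum_nonneg) simp
      then show "0 \<le> lattice_sum (h *\<^sub>R mat 1) (\<lambda>x. g x ^ CARD('n))" by (simp add: lattice_sum_def)
    qed
    \<comment> \<open>The limit of \<open>L2\<close> may be 0; the power still converges since
      \<open>L2\<close> is nonnegative and the exponent positive.\<close>
    show "((\<lambda>h. \<beta> * L2 h powr ?q) \<longlongrightarrow> \<beta> * (\<integral>x. g x ^ CARD('n) \<partial>lborel) powr ?q) (at_right 0)"
      by (intro tendsto_mult tendsto_const tendsto_powr'[OF lim2 tendsto_const]) (auto simp: L2nn)
    show "((\<lambda>h. ?d * bump_mass TYPE('n) / 2 * L1 h) \<longlongrightarrow> ?d * bump_mass TYPE('n) / 2 * (\<integral>x. g x * G x \<partial>lborel)) (at_right 0)"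
      by (intro tendsto_mult tendsto_const lim1)
    show "\<forall>\<^sub>F h in at_right 0. ?d * bump_mass TYPE('n) / 2 * L1 h \<le> \<beta> * L2 h powr ?q"
      unfolding eventually_at_right_field
    proof (intro exI[of _ "min (\<eta> / ?d) ((r - r0) / ?d)"] conjI allI impI)
      show "0 < min (\<eta> / ?d) ((r - r0) / ?d)" using \<eta>(1) g(4) by simp
    qed (rule main)
  qed
  then show ?thesis unfolding G_def \<beta>_def .
qed

section \<open>Trigonometric polynomials and separable kernels\<close>

text \<open>The phase \<open>c\<close> absorbs the sine, so the class is closed under
  \<open>partial\<close> and its members satisfy \<open>smooth_fun\<close>. Frequencies are
  arbitrary here; periodicity is imposed on the kernels separately.\<close>

inductive trig :: "(real^'n \<Rightarrow> real) \<Rightarrow> bool" where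
  trig_const: "trig (\<lambda>x. c)"
| trig_cos: "trig (\<lambda>x. cos (v \<bullet> x + c))"
| trig_add: "trig f \<Longrightarrow> trig g \<Longrightarrow> trig (\<lambda>x. f x + g x)"
| trig_mult: "trig f \<Longrightarrow> trig g \<Longrightarrow> trig (\<lambda>x. f x * g x)"

lemma trig_C1: "trig f \<Longrightarrow> C1 f \<and> (\<forall>j. trig (partial j f))"
proof (induction rule: trig.induct)
  case (trig_const c)
  then show ?case by (simp add: C1_const trig.trig_const)
next
  case (trig_cos v c)
  have "C1 (\<lambda>x. cos (v \<bullet> x + c))" "partial j (\<lambda>x. cos (v \<bullet> x + c)) = (\<lambda>x. - sin (v \<bullet> x + c) * v $ j)" for j
  proof -
    have d: "(cos has_real_derivative - sin t) (at t)" for t :: real by (auto intro!: derivative_eq_intros)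
    have c: "continuous_on UNIV (\<lambda>t::real. - sin t)" by (intro continuous_intros)
    show "C1 (\<lambda>x. cos (v \<bullet> x + c))" "partial j (\<lambda>x. cos (v \<bullet> x + c)) = (\<lambda>x. - sin (v \<bullet> x + c) * v $ j)"
      using C1_compose_inner[OF d c] by auto
  qed
  moreover have "(\<lambda>x. - sin (v \<bullet> x + c) * v $ j) = (\<lambda>x. cos (v \<bullet> x + (c + pi / 2)) * v $ j)" for j
    by (simp add: cos_add add.assoc[symmetric])
  ultimately show ?case by (simp add: trig.trig_const trig.trig_cos trig.trig_mult)
next
  case (trig_add f g)
  then show ?case by (simp add: C1_add trig.trig_add)
next
  case (trig_mult f g)
  then show ?case by (simp add: C1_mult trig.trig_add trig.trig_mult)
qed

lemma trig_C2: "trig f \<Longrightarrow> C2 f" by (simp add: C2_def trig_C1)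

lemma trig_continuous: "trig f \<Longrightarrow> continuous_on UNIV f" by (simp add: C1_continuous trig_C1)

lemma trig_smooth: assumes "trig f" shows "smooth_fun f"
proof -
  have "trig (iter_partial js f)" for js
    by (induction js) (use assms trig_C1 in auto)
  then show ?thesis unfolding smooth_fun_def using trig_C1 trig_continuous
    by (meson C1_def differentiable_at_withinI differentiable_on_def)
qed

lemma trig_bounded: "trig f \<Longrightarrow> \<exists>b. \<forall>x. \<bar>f x\<bar> \<le> b"
proof (induction rule: trig.induct)
  case (trig_const c) then show ?case by auto
next
  case (trig_cos v c) then show ?case by (intro exI[of _ 1]) simp
next
  case (trig_add f g)
  then obtain b c where "\<And>x. \<bar>f x\<bar> \<le> b" "\<And>x. \<bar>g x\<bar> \<le> c" by blast
  then have "\<bar>f x + g x\<bar> \<le> b + c" for x by (meson abs_triangle_ineq add_mono order_trans)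
  then show ?case by blast
next
  case (trig_mult f g)
  then obtain b c where bc: "\<And>x. \<bar>f x\<bar> \<le> b" "\<And>x. \<bar>g x\<bar> \<le> c" by blast
  have "\<bar>f x * g x\<bar> \<le> b * c" for x unfolding abs_mult
    using bc(1)[of x] bc(2)[of x] by (intro mult_mono) auto
  then show ?case by blast
qed

lemma trig_reflect: "trig f \<Longrightarrow> trig (\<lambda>y. f (x - y))"
proof (induction rule: trig.induct)
  case (trig_cos v c)
  have "(\<lambda>y. cos (v \<bullet> (x - y) + c)) = (\<lambda>y. cos ((- v) \<bullet> y + (v \<bullet> x + c)))"
    by (simp add: inner_diff_right algebra_simps)
  then show ?case using trig.trig_cos by metis
qed (auto intro: trig.intros)

lemma trig_prod: "(\<And>i. i \<in> S \<Longrightarrow> trig (f i)) \<Longrightarrow> trig (\<lambda>x. \<Prod>i\<in>S. f i x)"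
  by (induction S rule: infinite_finite_induct) (auto intro: trig.intros)

lemma trig_power: "trig f \<Longrightarrow> trig (\<lambda>x. f x ^ m)"
  by (induction m) (auto intro: trig.intros)

text \<open>For finite sums of products, exchanging integrals and differentiating under the integral
  sign reduce to linearity.\<close>

inductive separable :: "(real^'n \<Rightarrow> real^'n \<Rightarrow> real) \<Rightarrow> bool" where
  separable_mult: "trig p \<Longrightarrow> trig q \<Longrightarrow> separable (\<lambda>x y. p x * q y)"
| separable_add: "separable K \<Longrightarrow> separable L \<Longrightarrow> separable (\<lambda>x y. K x y + L x y)"

lemma separable_const: "separable (\<lambda>x y. c)"
  using separable_mult[OF trig_const[of c] trig_const[of 1]] by simp

lemma separable_times_basic: "separable K \<Longrightarrow> trig p \<Longrightarrow> trig q \<Longrightarrow> separable (\<lambda>x y. K x y * (p x * q y))"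
proof (induction rule: separable.induct)
  case (separable_mult p' q')
  then have "separable (\<lambda>x y. (p' x * p x) * (q' y * q y))" by (intro separable.separable_mult trig_mult)
  moreover have "(\<lambda>x y. (p' x * p x) * (q' y * q y)) = (\<lambda>x y. p' x * q' y * (p x * q y))" by (simp add: mult_ac)
  ultimately show ?case by simp
next
  case (separable_add K L)
  then show ?case using separable.separable_add[of "\<lambda>x y. K x y * (p x * q y)" "\<lambda>x y. L x y * (p x * q y)"]
    by (simp add: distrib_right)
qed

lemma separable_times: "separable L \<Longrightarrow> separable K \<Longrightarrow> separable (\<lambda>x y. K x y * L x y)"
proof (induction rule: separable.induct)
  case (separable_mult p q)
  then show ?case using separable_times_basic by blast
next
  case (separable_add L1 L2)
  then show ?case using separable.separable_add[of "\<lambda>x y. K x y * L1 x y" "\<lambda>x y. K x y * L2 x y"]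
    by (simp add: distrib_left)
qed

lemma separable_prod: "(\<And>i. i \<in> S \<Longrightarrow> separable (K i)) \<Longrightarrow> separable (\<lambda>x y. \<Prod>i\<in>S. K i x y)"
  by (induction S rule: infinite_finite_induct) (auto intro: separable_const separable_times)

lemma separable_power: "separable K \<Longrightarrow> separable (\<lambda>x y. K x y ^ m)"
  by (induction m) (auto intro: separable_const separable_times)

text \<open>The addition formula splits the translation kernel into two products; sums, products and
  powers of such kernels stay separable.\<close>

lemma separable_cos_diff: "separable (\<lambda>x y. cos (v \<bullet> (x - y)))"
proof -
  have "trig (\<lambda>x. sin (v \<bullet> x))"
  proof -
    have "trig (\<lambda>x. cos (v \<bullet> x + (- pi / 2)))" by (rule trig_cos)
    moreover have "cos (v \<bullet> x + (- pi / 2)) = sin (v \<bullet> x)" for x by (simp add: cos_diff)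
    ultimately show ?thesis by simp
  qed
  moreover have "trig (\<lambda>x. cos (v \<bullet> x))" using trig_cos[of v 0] by simp
  ultimately have "separable (\<lambda>x y. cos (v \<bullet> x) * cos (v \<bullet> y) + sin (v \<bullet> x) * sin (v \<bullet> y))"
    by (intro separable_add separable_mult)
  then show ?thesis by (simp add: inner_diff_right cos_diff)
qed

text \<open>The condition that separable kernels put on a weight. It treats Lebesgue measure and the
  measures representing the divergence alike.\<close>

definition trig_integrable :: "(real^'n) measure \<Rightarrow> (real^'n \<Rightarrow> real) \<Rightarrow> bool" where
  "trig_integrable M a \<longleftrightarrow> (\<forall>q. trig q \<longrightarrow> integrable M (\<lambda>y. a y * q y))"

lemma trig_integrableI:
  fixes M :: "(real^'n) measure"
  assumes a: "integrable M a" and s: "sets borel \<subseteq> sets M" "space M = UNIV"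
  shows "trig_integrable M a"
  unfolding trig_integrable_def
proof (intro allI impI)
  fix q :: "real^'n \<Rightarrow> real" assume q: "trig q"
  obtain b where b: "\<And>x. \<bar>q x\<bar> \<le> b" using trig_bounded[OF q] by blast
  have "q \<in> borel_measurable borel" by (rule borel_measurable_continuous_onI[OF trig_continuous[OF q]])
  then have qm: "q \<in> borel_measurable M"
    using s by (auto simp: measurable_def)
  show "integrable M (\<lambda>y. a y * q y)"
  proof (rule Bochner_Integration.integrable_bound)
    show "integrable M (\<lambda>y. b * a y)" using a by simp
    show "(\<lambda>y. a y * q y) \<in> borel_measurable M" using qm a by measurable
    show "AE y in M. norm (a y * q y) \<le> norm (b * a y)"
    proof (intro always_eventually allI)
      fix y
      have "\<bar>q y\<bar> * \<bar>a y\<bar> \<le> \<bar>b\<bar> * \<bar>a y\<bar>" using b[of y] by (intro mult_right_mono) auto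
      then show "norm (a y * q y) \<le> norm (b * a y)" by (simp add: abs_mult mult.commute)
    qed
  qed
qed

lemma separable_integral:
  assumes "separable K" "trig_integrable M a"
  shows "integrable M (\<lambda>y. a y * K x y)" "trig (\<lambda>x. \<integral>y. a y * K x y \<partial>M)"
    "integrable M (\<lambda>y. a y * partial j (\<lambda>x. K x y) x)"
    "partial j (\<lambda>x. \<integral>y. a y * K x y \<partial>M) x = (\<integral>y. a y * partial j (\<lambda>x. K x y) x \<partial>M)"
proof -
  have "(\<forall>x. integrable M (\<lambda>y. a y * K x y)) \<and> trig (\<lambda>x. \<integral>y. a y * K x y \<partial>M) \<and> (\<forall>y. C1 (\<lambda>x. K x y)) \<and>
    (\<forall>x j. integrable M (\<lambda>y. a y * partial j (\<lambda>x. K x y) x)) \<and>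
    (\<forall>x j. partial j (\<lambda>x. \<integral>y. a y * K x y \<partial>M) x = (\<integral>y. a y * partial j (\<lambda>x. K x y) x \<partial>M))"
    using assms
  proof (induction rule: separable.induct)
    case (separable_mult p q)
    have i: "integrable M (\<lambda>y. c * (a y * q y))" for c using separable_mult by (simp add: trig_integrable_def)
    have C: "C1 p" using trig_C1[OF separable_mult(1)] by simp
    have e1: "(\<lambda>x. \<integral>y. a y * (p x * q y) \<partial>M) = (\<lambda>x. (\<integral>y. a y * q y \<partial>M) * p x)"
    proof
      fix x
      have "(\<integral>y. a y * (p x * q y) \<partial>M) = (\<integral>y. p x * (a y * q y) \<partial>M)" by (simp add: mult_ac)
      then show "(\<integral>y. a y * (p x * q y) \<partial>M) = (\<integral>y. a y * q y \<partial>M) * p x" by (simp add: mult.commute)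
    qed
    have e2: "partial j (\<lambda>x. p x * q y) x = partial j p x * q y" for j x y
      using C1_cmult(2)[OF C, of j "q y"] by (simp add: mult.commute)
    have e3: "a y * (r * q y) = r * (a y * q y)" for y r by simp
    show ?case
    proof (intro conjI allI)
      show "integrable M (\<lambda>y. a y * (p x * q y))" for x using i by (simp add: e3)
      show "trig (\<lambda>x. \<integral>y. a y * (p x * q y) \<partial>M)" unfolding e1 by (intro trig.intros separable_mult)
      show "C1 (\<lambda>x. p x * q y)" for y using C1_cmult(1)[OF C, of "q y"] by (simp add: mult.commute)
      show "integrable M (\<lambda>y. a y * partial j (\<lambda>x. p x * q y) x)" for x j unfolding e2 using i by (simp add: e3)
      show "partial j (\<lambda>x. \<integral>y. a y * (p x * q y) \<partial>M) x = (\<integral>y. a y * partial j (\<lambda>x. p x * q y) x \<partial>M)" for x j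
      proof -
        have "(\<integral>y. a y * (partial j p x * q y) \<partial>M) = partial j p x * (\<integral>y. a y * q y \<partial>M)" by (simp add: e3)
        then show ?thesis unfolding e1 e2 C1_cmult(2)[OF C] by simp
      qed
    qed
  next
    case (separable_add K L)
    then have K: "\<And>x. integrable M (\<lambda>y. a y * K x y)" "trig (\<lambda>x. \<integral>y. a y * K x y \<partial>M)" "\<And>y. C1 (\<lambda>x. K x y)"
      "\<And>x j. integrable M (\<lambda>y. a y * partial j (\<lambda>x. K x y) x)"
      "\<And>x j. partial j (\<lambda>x. \<integral>y. a y * K x y \<partial>M) x = (\<integral>y. a y * partial j (\<lambda>x. K x y) x \<partial>M)"
     and L: "\<And>x. integrable M (\<lambda>y. a y * L x y)" "trig (\<lambda>x. \<integral>y. a y * L x y \<partial>M)" "\<And>y. C1 (\<lambda>x. L x y)"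
      "\<And>x j. integrable M (\<lambda>y. a y * partial j (\<lambda>x. L x y) x)"
      "\<And>x j. partial j (\<lambda>x. \<integral>y. a y * L x y \<partial>M) x = (\<integral>y. a y * partial j (\<lambda>x. L x y) x \<partial>M)" by blast+
    have s: "(\<lambda>x. \<integral>y. a y * (K x y + L x y) \<partial>M) = (\<lambda>x. (\<integral>y. a y * K x y \<partial>M) + (\<integral>y. a y * L x y \<partial>M))"
      using K(1) L(1) by (simp add: distrib_left)
    have p: "partial j (\<lambda>x. K x y + L x y) x = partial j (\<lambda>x. K x y) x + partial j (\<lambda>x. L x y) x" for j x y
      by (simp only: C1_add(2)[OF K(3) L(3)])
    show ?case
    proof (intro conjI allI)
      show "integrable M (\<lambda>y. a y * (K x y + L x y))" for x using K(1) L(1) by (simp add: distrib_left)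
      show "trig (\<lambda>x. \<integral>y. a y * (K x y + L x y) \<partial>M)" unfolding s by (intro trig_add K L)
      show "C1 (\<lambda>x. K x y + L x y)" for y by (intro C1_add K L)
      show "integrable M (\<lambda>y. a y * partial j (\<lambda>x. K x y + L x y) x)" for x j
        unfolding p using K(4) L(4) by (simp add: distrib_left)
      show "partial j (\<lambda>x. \<integral>y. a y * (K x y + L x y) \<partial>M) x = (\<integral>y. a y * partial j (\<lambda>x. K x y + L x y) x \<partial>M)" for x j
      proof -
        have "partial j (\<lambda>x. (\<integral>y. a y * K x y \<partial>M) + (\<integral>y. a y * L x y \<partial>M)) x
            = partial j (\<lambda>x. \<integral>y. a y * K x y \<partial>M) x + partial j (\<lambda>x. \<integral>y. a y * L x y \<partial>M) x"
          by (simp only: C1_add(2)[OF trig_C1[OF K(2), THEN conjunct1] trig_C1[OF L(2), THEN conjunct1]])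
        then show ?thesis unfolding s p using K(4,5) L(4,5) by (simp add: distrib_left)
      qed
    qed
  qed
  then show "integrable M (\<lambda>y. a y * K x y)" "trig (\<lambda>x. \<integral>y. a y * K x y \<partial>M)"
    "integrable M (\<lambda>y. a y * partial j (\<lambda>x. K x y) x)"
    "partial j (\<lambda>x. \<integral>y. a y * K x y \<partial>M) x = (\<integral>y. a y * partial j (\<lambda>x. K x y) x \<partial>M)" by auto
qed

lemma separable_integral_swap:
  assumes "separable K" and a: "trig_integrable M a" and g: "trig_integrable N g"
  shows "(\<integral>x. g x * (\<integral>y. a y * K x y \<partial>M) \<partial>N) = (\<integral>y. a y * (\<integral>x. g x * K x y \<partial>N) \<partial>M)"
    "integrable N (\<lambda>x. g x * (\<integral>y. a y * K x y \<partial>M))"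
    "integrable M (\<lambda>y. a y * (\<integral>x. g x * K x y \<partial>N))" "trig (\<lambda>y. \<integral>x. g x * K x y \<partial>N)"
    "integrable N (\<lambda>x. g x * K x y)"
proof -
  have "(\<forall>x. integrable M (\<lambda>y. a y * K x y)) \<and> (\<forall>y. integrable N (\<lambda>x. g x * K x y)) \<and>
      (\<integral>x. g x * (\<integral>y. a y * K x y \<partial>M) \<partial>N) = (\<integral>y. a y * (\<integral>x. g x * K x y \<partial>N) \<partial>M) \<and>
    integrable N (\<lambda>x. g x * (\<integral>y. a y * K x y \<partial>M)) \<and>
    integrable M (\<lambda>y. a y * (\<integral>x. g x * K x y \<partial>N)) \<and> trig (\<lambda>y. \<integral>x. g x * K x y \<partial>N)"
    using assms(1)
  proof (induction rule: separable.induct)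
    case (separable_mult p q)
    have i: "integrable M (\<lambda>y. a y * q y)" "integrable N (\<lambda>x. g x * p x)"
      using a g separable_mult by (auto simp: trig_integrable_def)
    have e: "a y * (p x * q y) = p x * (a y * q y)" "g x * (p x * q y) = (g x * p x) * q y" for x y by simp_all
    have e': "g x * (p x * c) = (g x * p x) * c" "a y * (c * q y) = c * (a y * q y)" for x y c by simp_all
    show ?case unfolding e Bochner_Integration.integral_mult_right_zero Bochner_Integration.integral_mult_left_zero e'
      using i separable_mult by (auto intro!: trig.intros simp: mult.commute)
  next
    case (separable_add K L)
    then show ?case by (auto simp: distrib_left intro!: trig_add)
  qed
  then show "(\<integral>x. g x * (\<integral>y. a y * K x y \<partial>M) \<partial>N) = (\<integral>y. a y * (\<integral>x. g x * K x y \<partial>N) \<partial>M)"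
    "integrable N (\<lambda>x. g x * (\<integral>y. a y * K x y \<partial>M))"
    "integrable M (\<lambda>y. a y * (\<integral>x. g x * K x y \<partial>N))" "trig (\<lambda>y. \<integral>x. g x * K x y \<partial>N)"
    "integrable N (\<lambda>x. g x * K x y)" by auto
qed

section \<open>Periodic approximate identities\<close>

lemma integrable_indicator_bounded:
  fixes f :: "'a::euclidean_space \<Rightarrow> real"
  assumes "continuous_on UNIV f" "S \<in> sets borel" "S \<subseteq> cball 0 R"
  shows "integrable lborel (\<lambda>x. indicat_real S x * f x)"
proof (rule Bochner_Integration.integrable_bound)
  show "integrable lborel (\<lambda>x. indicator (cball 0 R) x *\<^sub>R f x)"
    by (rule borel_integrable_compact) (use assms(1) continuous_on_subset in auto)
  show "(\<lambda>x. indicat_real S x * f x) \<in> borel_measurable lborel"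
    using assms(2) borel_measurable_continuous_onI[OF assms(1)] by (intro borel_measurable_times) auto
  show "AE x in lborel. norm (indicat_real S x * f x) \<le> norm (indicator (cball 0 R) x *\<^sub>R f x)"
    using assms(3) by (intro always_eventually) (auto simp: indicator_def)
qed

lemma integral_indicator_mono:
  fixes f :: "'a::euclidean_space \<Rightarrow> real"
  assumes "continuous_on UNIV f" "\<And>x. 0 \<le> f x" "S \<in> sets borel" "T \<in> sets borel" "S \<subseteq> T" "T \<subseteq> cball 0 R"
  shows "(\<integral>x. indicat_real S x * f x \<partial>lborel) \<le> (\<integral>x. indicat_real T x * f x \<partial>lborel)"
proof (rule Bochner_Integration.integral_mono)
  show "integrable lborel (\<lambda>x. indicat_real S x * f x)" "integrable lborel (\<lambda>x. indicat_real T x * f x)"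
    using integrable_indicator_bounded[OF assms(1,3)] integrable_indicator_bounded[OF assms(1,4,6)] assms(5,6) by auto
qed (use assms(2,5) in \<open>auto simp: indicator_def\<close>)

lemma integral_indicator_bounds:
  fixes f :: "'a::euclidean_space \<Rightarrow> real"
  assumes "continuous_on UNIV f" "S \<in> sets borel" "S \<subseteq> cball 0 R"
  shows "(\<And>x. x \<in> S \<Longrightarrow> f x \<le> c) \<Longrightarrow> (\<integral>x. indicat_real S x * f x \<partial>lborel) \<le> measure lborel S * c"
    "(\<And>x. x \<in> S \<Longrightarrow> c \<le> f x) \<Longrightarrow> measure lborel S * c \<le> (\<integral>x. indicat_real S x * f x \<partial>lborel)"
proof -
  have i: "integrable lborel (\<lambda>x. indicat_real S x * f x)" "integrable lborel (\<lambda>x. indicat_real S x * c)"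
    by (rule integrable_indicator_bounded[OF assms] integrable_indicator_bounded[OF continuous_on_const assms(2,3)])+
  have c: "(\<integral>x. indicat_real S x * c \<partial>lborel) = measure lborel S * c" by simp
  show "(\<integral>x. indicat_real S x * f x \<partial>lborel) \<le> measure lborel S * c" if "\<And>x. x \<in> S \<Longrightarrow> f x \<le> c"
    unfolding c[symmetric] by (rule Bochner_Integration.integral_mono[OF i]) (use that in \<open>auto simp: indicator_def\<close>)
  show "measure lborel S * c \<le> (\<integral>x. indicat_real S x * f x \<partial>lborel)" if "\<And>x. x \<in> S \<Longrightarrow> c \<le> f x"
    unfolding c[symmetric] by (rule Bochner_Integration.integral_mono[OF i(2,1)]) (use that in \<open>auto simp: indicator_def\<close>)
qed

text \<open>A weak approximate identity. The mass bound on balls serves upper estimates; mass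
  tending to 1 is asked only of balls of radius at most \<rho> about 0, since a periodic kernel
  concentrates at the other lattice points as well.\<close>

definition periodic_kernels :: "real^'n^'n \<Rightarrow> (nat \<Rightarrow> real^'n \<Rightarrow> real) \<Rightarrow> real \<Rightarrow> bool" where
  "periodic_kernels B K \<rho> \<longleftrightarrow> (\<forall>n. trig (K n)) \<and> (\<forall>n. separable (\<lambda>x y. K n (x - y))) \<and>
     (\<forall>n z. 0 \<le> K n z) \<and> (\<forall>n. periodic_wrt (lattice_of B) (K n)) \<and>
     (\<forall>R. \<exists>M. \<forall>n y. norm y \<le> R \<longrightarrow> (\<integral>x. indicat_real (cball 0 R) x * K n (x - y) \<partial>lborel) \<le> M) \<and>
     0 < \<rho> \<and> (\<forall>s. 0 < s \<longrightarrow> s \<le> \<rho> \<longrightarrow> (\<lambda>n. \<integral>x. indicat_real (cball 0 s) x * K n x \<partial>lborel) \<longlonglongrightarrow> 1)"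

text \<open>Powers of (1 + cos) / 2 are the de la Vallee Poussin kernels. Their product
  \<open>k\<close> in lattice coordinates has values in [0, 1] and equals 1 exactly on the lattice,
  so its powers, normalised by their mass near 0, concentrate there.\<close>

lemma periodic_kernels_exist:
  fixes B :: "real^'n^'n"
  assumes "invertible B"
  obtains K \<rho> where "periodic_kernels B K \<rho>"
proof -
  obtain N where N: "N ** B = mat 1" "B ** N = mat 1" using assms unfolding invertible_def by blast
  have NB: "N *v (B *v x) = x" "B *v (N *v x) = x" for x
    using N by (simp_all add: matrix_vector_mul_assoc)
  have Ni: "N $ i \<bullet> x = (N *v x) $ i" for i x by (simp add: matrix_vector_mul_component)
  define k where "k x = (\<Prod>i\<in>UNIV. (1/2) * (1 + cos ((2 * pi) *\<^sub>R N $ i \<bullet> x)))" for x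
  have tk: "trig k" unfolding k_def[abs_def]
  proof (intro trig_prod trig_mult trig_const trig_add)
    show "trig (\<lambda>x. cos ((2 * pi) *\<^sub>R N $ i \<bullet> x))" for i using trig_cos[of "(2 * pi) *\<^sub>R N $ i" 0] by simp
  qed
  have sk: "separable (\<lambda>x y. k (x - y))" unfolding k_def
    by (intro separable_prod separable_times separable_const separable_add separable_cos_diff)
  have ck: "continuous_on S k" for S using trig_continuous[OF tk] continuous_on_subset by blast
  have fac: "0 \<le> (1/2) * (1 + cos t)" "(1/2) * (1 + cos t) \<le> 1" for t :: real
  proof -
    have "0 \<le> 1 + cos t" using cos_ge_minus_one[of t] by linarith
    then show "0 \<le> (1/2) * (1 + cos t)" by simp
    show "(1/2) * (1 + cos t) \<le> 1" using cos_le_one[of t] by simp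
  qed
  have k0: "0 \<le> k x" for x unfolding k_def by (intro prod_nonneg) (use fac in auto)
  have k1: "k x \<le> 1" for x unfolding k_def by (intro prod_le_1) (use fac in auto)
  have k_one: "\<exists>z. x = B *v ivec z" if "k x = 1" for x
  proof -
    have "(1/2) * (1 + cos ((2 * pi) *\<^sub>R N $ i \<bullet> x)) = 1" for i
    proof (rule ccontr)
      assume "(1/2) * (1 + cos ((2 * pi) *\<^sub>R N $ i \<bullet> x)) \<noteq> 1"
      then have lt: "(1/2) * (1 + cos ((2 * pi) *\<^sub>R N $ i \<bullet> x)) < 1" using fac(2) by (simp add: less_le)
      have "k x = (1/2) * (1 + cos ((2 * pi) *\<^sub>R N $ i \<bullet> x)) * (\<Prod>i\<in>UNIV - {i}. (1/2) * (1 + cos ((2 * pi) *\<^sub>R N $ i \<bullet> x)))"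
        unfolding k_def by (rule prod.remove) auto
      also have "\<dots> \<le> (1/2) * (1 + cos ((2 * pi) *\<^sub>R N $ i \<bullet> x)) * 1"
        by (intro mult_left_mono prod_le_1 conjI fac)
      finally show False using lt that by simp
    qed
    then have "cos (2 * pi * (N *v x) $ i) = 1" for i by (simp add: Ni[symmetric])
    then have "\<exists>m::int. (N *v x) $ i = of_int m" for i by (auto simp: cos_one_2pi_int)
    then obtain m :: "'n \<Rightarrow> int" where m: "\<And>i. (N *v x) $ i = of_int (m i)" by metis
    have "N *v x = ivec (\<chi> i. m i)" by (simp add: vec_eq_iff ivec_def m)
    then show ?thesis by (metis NB(2))
  qed
  have k_shift: "k (x + B *v ivec z) = k x" for x z
  proof -
    have "cos ((2 * pi) *\<^sub>R N $ i \<bullet> (x + B *v ivec z)) = cos ((2 * pi) *\<^sub>R N $ i \<bullet> x)" for i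
    proof -
      have "(2 * pi) *\<^sub>R N $ i \<bullet> (x + B *v ivec z) = (2 * pi) *\<^sub>R N $ i \<bullet> x + 2 * pi * of_int (z $ i)"
        by (simp add: inner_add_right Ni NB ivec_def distrib_left)
      then show ?thesis by (simp add: cos_add)
    qed
    then show ?thesis by (simp add: k_def)
  qed
  have k_zero: "k 0 = 1" by (simp add: k_def)
  \<comment> \<open>Lattice coordinates in the closed ball of radius \<rho> are at most 1/2 in size,
    so 0 is the only lattice point in it.\<close>
  define \<rho> where "\<rho> = 1 / (2 * (1 + (\<Sum>i\<in>UNIV. norm (N $ i))))"
  have sN: "0 < 1 + (\<Sum>i\<in>UNIV. norm (N $ i))" by (simp add: add_pos_nonneg sum_nonneg)
  have \<rho>: "0 < \<rho>" using sN by (simp add: \<rho>_def)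
  have k_less: "k x < 1" if x: "norm x \<le> \<rho>" "x \<noteq> 0" for x
  proof (rule ccontr)
    assume "\<not> k x < 1"
    then have "k x = 1" using k1[of x] by simp
    then obtain z where z: "x = B *v ivec z" using k_one by blast
    have "z $ i = 0" for i
    proof -
      have "\<bar>real_of_int (z $ i)\<bar> = \<bar>N $ i \<bullet> x\<bar>" by (simp add: Ni z NB ivec_def)
      also have "\<dots> \<le> norm (N $ i) * norm x" by (rule Cauchy_Schwarz_ineq2)
      also have "\<dots> \<le> (1 + (\<Sum>i\<in>UNIV. norm (N $ i))) * \<rho>"
        using member_le_sum[of i UNIV "\<lambda>i. norm (N $ i)"] x(1) by (intro mult_mono) (auto simp: sum_nonneg)
      also have "\<dots> < 1" using sN by (simp add: \<rho>_def)
      finally show ?thesis by linarith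
    qed
    then have "ivec z = 0" by (simp add: ivec_def vec_eq_iff)
    then show False using x(2) z by simp
  qed
  define J where "J S n = (\<integral>x. indicat_real S x * k x ^ n \<partial>lborel)" for S n
  have ckn: "continuous_on UNIV (\<lambda>x. k x ^ n)" for n by (intro continuous_intros ck)
  have kn0: "0 \<le> k x ^ n" for x n by (simp add: k0)
  define Nn where "Nn n = J (cball 0 \<rho>) n" for n
  \<comment> \<open>The normaliser decays no faster than any geometric sequence of ratio
    \<open>q < 1\<close>, because \<open>k\<close> exceeds \<open>q\<close> on a ball around
    0.\<close>
  have Nlow: "\<exists>c>0. \<forall>n. c * q ^ n \<le> Nn n" if q: "0 \<le> q" "q < 1" for q
  proof -
    have op: "open {x. q < k x}" by (intro open_Collect_less continuous_intros ck)
    have "0 \<in> {x. q < k x}" using k_zero q(2) by simp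
    from open_contains_cball[THEN iffD1, OF op, rule_format, OF this]
    obtain s where s: "0 < s" "cball 0 s \<subseteq> {x. q < k x}" by blast
    define s' where "s' = min s \<rho>"
    have s': "0 < s'" "s' \<le> s" "s' \<le> \<rho>" using s(1) \<rho> by (auto simp: s'_def)
    have "measure lborel (cball (0::real^'n) s') * q ^ n \<le> Nn n" for n
    proof -
      have "measure lborel (cball (0::real^'n) s') * q ^ n \<le> J (cball 0 s') n" unfolding J_def
        by (rule integral_indicator_bounds(2)[OF ckn _ order_refl]) (use s s' q in \<open>auto intro!: power_mono simp: subset_iff less_imp_le\<close>)
      also have "\<dots> \<le> Nn n" unfolding Nn_def J_def
        by (rule integral_indicator_mono[OF ckn kn0 _ _ _ order_refl]) (use s' in auto)
      finally show ?thesis .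
    qed
    moreover have "0 < measure lborel (cball (0::real^'n) s')" using content_cball_pos[OF s'(1)] by simp
    ultimately show ?thesis by blast
  qed
  have Npos: "0 < Nn n" for n
  proof -
    obtain c where "0 < c" "c * (1/2) ^ n \<le> Nn n" using Nlow[of "1/2"] by auto
    moreover have "0 < c * (1/2) ^ n" using \<open>0 < c\<close> by simp
    ultimately show ?thesis by linarith
  qed
  define K where "K n x = (1 / Nn n) * k x ^ n" for n x
  have intK: "(\<integral>x. indicat_real S x * K n x \<partial>lborel) = J S n / Nn n" for S n
    unfolding J_def K_def by (subst integral_divide_zero[symmetric]) simp
  \<comment> \<open>By compactness a local bound is enough. Around a lattice point, periodicity
    compares the mass with \<open>Nn\<close>; around any other point \<open>k\<close> stays below
    some \<open>q < 1\<close>, and \<open>Nlow\<close> absorbs the n-th power of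
    \<open>q\<close>.\<close>
  have Jbound: "\<exists>M. \<forall>n. J (cball 0 R) n \<le> M * Nn n" for R
  proof -
    have loc: "\<exists>r M. 0 < r \<and> 0 \<le> M \<and> (\<forall>n. J (ball e r) n \<le> M * Nn n)" for e
    proof (cases "k e = 1")
      case True
      then obtain z where z: "e = B *v ivec z" using k_one by blast
      have "J (ball e \<rho>) n \<le> 1 * Nn n" for n
      proof -
        have "J (ball e \<rho>) n = (\<integral>x. indicat_real (ball e \<rho>) (x + e) * k (x + e) ^ n \<partial>lborel)"
          unfolding J_def
          by (rule lborel_integral_translate_measurable[symmetric])
            (auto intro!: borel_measurable_times borel_measurable_indicator borel_measurable_continuous_onI[OF ckn])
        also have "\<dots> = (\<integral>x. indicat_real (ball 0 \<rho>) x * k x ^ n \<partial>lborel)"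
        proof -
          have "indicat_real (ball e \<rho>) (x + e) = indicat_real (ball 0 \<rho>) x" for x
            by (simp add: indicator_def dist_norm)
          moreover have "k (x + e) = k x" for x unfolding z by (rule k_shift)
          ultimately show ?thesis by simp
        qed
        also have "\<dots> \<le> Nn n" unfolding Nn_def J_def
          by (rule integral_indicator_mono[OF ckn kn0 _ _ _ order_refl]) auto
        finally show ?thesis by simp
      qed
      then show ?thesis using \<rho> by (intro exI[of _ \<rho>] exI[of _ 1]) auto
    next
      case False
      define q where "q = (1 + k e) / 2"
      have q: "0 \<le> q" "q < 1" "k e < q" using k0[of e] k1[of e] False by (auto simp: q_def)
      have op: "open {x. k x < q}" by (intro open_Collect_less continuous_intros ck)
      have "e \<in> {x. k x < q}" using q(3) by simp
      from openE[OF op this] obtain r where r: "0 < r" "ball e r \<subseteq> {x. k x < q}" by blast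
      obtain c where c: "0 < c" "\<And>n. c * q ^ n \<le> Nn n" using Nlow[OF q(1,2)] by blast
      let ?v = "measure lborel (ball e r)"
      have "J (ball e r) n \<le> (?v / c) * Nn n" for n
      proof -
        have sub: "ball e r \<subseteq> cball 0 (norm e + r)"
        proof
          fix x assume "x \<in> ball e r"
          then show "x \<in> cball 0 (norm e + r)" using norm_triangle_sub[of x e] by (simp add: dist_norm norm_minus_commute)
        qed
        have "J (ball e r) n \<le> ?v * q ^ n" unfolding J_def
          by (rule integral_indicator_bounds(1)[OF ckn _ sub]) (use r k0 in \<open>auto intro!: power_mono simp: subset_iff less_imp_le\<close>)
        also have "\<dots> \<le> ?v * (Nn n / c)"
          using c(2)[of n] c(1) by (intro mult_left_mono) (auto simp: field_simps)
        finally show ?thesis by simp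
      qed
      then show ?thesis using r(1) c(1) by (intro exI[of _ r] exI[of _ "?v / c"]) auto
    qed
    then obtain r M where rM: "\<And>e. 0 < r e" "\<And>e. 0 \<le> M e" "\<And>e n. J (ball e (r e)) n \<le> M e * Nn n" by metis
    have "cball 0 R \<subseteq> (\<Union>e\<in>cball 0 R. ball e (r e))" using rM(1) by force
    then obtain D where D: "D \<subseteq> cball 0 R" "finite D" "cball 0 R \<subseteq> (\<Union>e\<in>D. ball e (r e))"
      by (rule compactE_image[OF compact_cball, of "cball 0 R" "\<lambda>e. ball e (r e)", rotated]) auto
    have "J (cball 0 R) n \<le> (\<Sum>e\<in>D. M e) * Nn n" for n
    proof -
      have i: "integrable lborel (\<lambda>x. indicat_real (ball e (r e)) x * k x ^ n)" for e
      proof (rule integrable_indicator_bounded[OF ckn])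
        show "ball e (r e) \<subseteq> cball 0 (norm e + r e)"
        proof
          fix x assume "x \<in> ball e (r e)"
          then show "x \<in> cball 0 (norm e + r e)" using norm_triangle_sub[of x e] by (simp add: dist_norm norm_minus_commute)
        qed
      qed simp
      have "J (cball 0 R) n \<le> (\<integral>x. (\<Sum>e\<in>D. indicat_real (ball e (r e)) x * k x ^ n) \<partial>lborel)"
        unfolding J_def
      proof (rule Bochner_Integration.integral_mono)
        show "integrable lborel (\<lambda>x. indicat_real (cball 0 R) x * k x ^ n)" by (rule integrable_indicator_bounded[OF ckn _ order_refl]) simp
        show "integrable lborel (\<lambda>x. \<Sum>e\<in>D. indicat_real (ball e (r e)) x * k x ^ n)" using i by auto
        fix x
        show "indicat_real (cball 0 R) x * k x ^ n \<le> (\<Sum>e\<in>D. indicat_real (ball e (r e)) x * k x ^ n)"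
        proof (cases "x \<in> cball 0 R")
          case True
          then obtain e where e: "e \<in> D" "x \<in> ball e (r e)" using D(3) by blast
          have "indicat_real (ball e (r e)) x * k x ^ n \<le> (\<Sum>e\<in>D. indicat_real (ball e (r e)) x * k x ^ n)"
            by (rule member_le_sum[OF e(1) _ D(2)]) (simp add: kn0)
          then show ?thesis using True e(2) by (simp add: indicator_def)
        next
          case False
          then show ?thesis using kn0 by (simp add: sum_nonneg)
        qed
      qed
      also have "\<dots> = (\<Sum>e\<in>D. J (ball e (r e)) n)" unfolding J_def using i by (rule Bochner_Integration.integral_sum)
      also have "\<dots> \<le> (\<Sum>e\<in>D. M e * Nn n)" by (intro sum_mono rM)
      finally show ?thesis by (simp add: sum_distrib_right)
    qed
    then show ?thesis by blast
  qed
  have cK: "continuous_on UNIV (K n)" for n unfolding K_def by (intro continuous_intros ck)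
  show ?thesis
  proof (rule that[of K \<rho>], unfold periodic_kernels_def, intro conjI allI impI)
    show "trig (K n)" for n unfolding K_def[abs_def] by (intro trig_mult trig_const trig_power tk)
    show "separable (\<lambda>x y. K n (x - y))" for n unfolding K_def by (intro separable_times separable_const separable_power sk)
    show K0: "0 \<le> K n z" for n z using Npos[of n] k0[of z] by (simp add: K_def)
    show "periodic_wrt (lattice_of B) (K n)" for n
      unfolding periodic_wrt_def
    proof (intro allI ballI)
      fix x g assume "g \<in> lattice_of B"
      then obtain z where "g = B *v (\<chi> i. real_of_int (z i))" by (auto simp: lattice_of_def)
      then have "g = B *v ivec (\<chi> i. z i)" by (simp add: ivec_def)
      then show "K n (x + g) = K n x" by (simp add: K_def k_shift)
    qed
    show "\<exists>M. \<forall>n y. norm y \<le> R \<longrightarrow> (\<integral>x. indicat_real (cball 0 R) x * K n (x - y) \<partial>lborel) \<le> M" for R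
    proof -
      \<comment> \<open>Translation by \<open>y\<close> keeps the ball of radius \<open>R\<close>
        inside the one of radius 2 R about 0.\<close>
      obtain M where M: "\<And>n. J (cball 0 (2 * R)) n \<le> M * Nn n" using Jbound by blast
      have "(\<integral>x. indicat_real (cball 0 R) x * K n (x - y) \<partial>lborel) \<le> M" if y: "norm y \<le> R" for n y
      proof -
        have "(\<integral>x. indicat_real (cball 0 R) x * K n (x - y) \<partial>lborel)
            = (\<integral>x. indicat_real (cball 0 R) (x + y) * K n (x + y - y) \<partial>lborel)"
        proof (rule lborel_integral_translate_measurable[symmetric, of "\<lambda>x. indicat_real (cball 0 R) x * K n (x - y)"])
          have "(\<lambda>x. K n (x - y)) \<in> borel_measurable borel"
            by (intro borel_measurable_continuous_onI continuous_on_compose2[OF cK] continuous_intros) auto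
          then show "(\<lambda>x. indicat_real (cball 0 R) x * K n (x - y)) \<in> borel_measurable borel"
            by (intro borel_measurable_times borel_measurable_indicator) auto
        qed
        also have "\<dots> = (\<integral>x. indicat_real (cball (- y) R) x * K n x \<partial>lborel)"
          by (simp add: indicator_def dist_norm norm_minus_commute algebra_simps)
        also have "\<dots> \<le> (\<integral>x. indicat_real (cball 0 (2 * R)) x * K n x \<partial>lborel)"
        proof (rule integral_indicator_mono[OF cK K0 _ _ _ order_refl])
          show "cball (- y) R \<subseteq> cball 0 (2 * R)"
          proof
            fix x assume "x \<in> cball (- y) R"
            then show "x \<in> cball 0 (2 * R)" using y norm_triangle_sub[of x "- y"] by (simp add: dist_norm norm_minus_commute)
          qed
        qed auto
        also have "\<dots> = J (cball 0 (2 * R)) n / Nn n" by (rule intK)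
        also have "\<dots> \<le> M" using M[of n] Npos[of n] by (simp add: pos_divide_le_eq)
        finally show ?thesis .
      qed
      then show ?thesis by blast
    qed
    show "0 < \<rho>" by (rule \<rho>)
    fix s :: real assume s: "0 < s" "s \<le> \<rho>"
    \<comment> \<open>A compact shell that avoids 0, so \<open>k\<close> stays below some
      \<open>q < 1\<close> on it.\<close>
    let ?A = "cball 0 \<rho> - ball 0 s :: (real^'n) set"
    have Ac: "compact ?A" by (intro compact_diff compact_cball open_ball)
    obtain q where q: "0 \<le> q" "q < 1" "\<And>x. x \<in> ?A \<Longrightarrow> k x \<le> q"
    proof (cases "?A = {}")
      case True
      then have "k x \<le> 0" if "x \<in> ?A" for x using that by blast
      then show ?thesis using that[of 0] by simp
    next
      case False
      then obtain w where w: "w \<in> ?A" "\<And>x. x \<in> ?A \<Longrightarrow> k x \<le> k w"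
        using continuous_attains_sup[OF Ac False ck] by blast
      have "k w < 1" using w(1) s by (intro k_less) auto
      then show ?thesis using that[of "k w"] w k0 by blast
    qed
    \<comment> \<open>Strictly between \<open>q\<close> and 1, so that the share of the shell in the
      mass decays like the powers of \<open>q / q'\<close>.\<close>
    define q' where "q' = (1 + q) / 2"
    have q': "0 < q'" "q' < 1" "q < q'" using q by (auto simp: q'_def)
    obtain c where c: "0 < c" "\<And>n. c * q' ^ n \<le> Nn n" using Nlow[of q'] q' by auto
    let ?v = "measure lborel ?A"
    have low: "1 - ?v / c * (q / q') ^ n \<le> J (cball 0 s) n / Nn n" for n
    proof -
      have i: "integrable lborel (\<lambda>x. indicat_real S x * k x ^ n)" if "S \<in> sets borel" "S \<subseteq> cball 0 \<rho>" for S
        using integrable_indicator_bounded[OF ckn that] .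
      have "Nn n \<le> (\<integral>x. indicat_real (cball 0 s) x * k x ^ n + indicat_real ?A x * k x ^ n \<partial>lborel)"
        unfolding Nn_def J_def
      proof (rule Bochner_Integration.integral_mono)
        show "integrable lborel (\<lambda>x. indicat_real (cball 0 \<rho>) x * k x ^ n)" by (rule i) auto
        show "integrable lborel (\<lambda>x. indicat_real (cball 0 s) x * k x ^ n + indicat_real ?A x * k x ^ n)"
          by (intro Bochner_Integration.integrable_add i) (use s in auto)
      qed (use kn0 in \<open>auto simp: indicator_def\<close>)
      also have "\<dots> = J (cball 0 s) n + J ?A n"
        unfolding J_def using s by (intro Bochner_Integration.integral_add i) auto
      finally have "Nn n \<le> J (cball 0 s) n + J ?A n" .
      moreover have "J ?A n \<le> ?v * q ^ n" unfolding J_def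
        by (rule integral_indicator_bounds(1)[OF ckn, where R=\<rho>]) (use q k0 in \<open>auto intro!: power_mono\<close>)
      moreover have "?v * q ^ n \<le> ?v / c * (q / q') ^ n * Nn n"
      proof -
        have "?v * q ^ n = ?v / c * (q / q') ^ n * (c * q' ^ n)" using c(1) q'(1) by (simp add: power_divide)
        also have "\<dots> \<le> ?v / c * (q / q') ^ n * Nn n" using c q(1) q'(1) by (intro mult_left_mono) auto
        finally show ?thesis .
      qed
      ultimately have "(1 - ?v / c * (q / q') ^ n) * Nn n \<le> J (cball 0 s) n"
        unfolding left_diff_distrib by linarith
      then show ?thesis using Npos[of n] by (simp only: pos_le_divide_eq)
    qed
    have up: "J (cball 0 s) n / Nn n \<le> 1" for n
    proof -
      have "J (cball 0 s) n \<le> Nn n" unfolding Nn_def J_def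
        by (rule integral_indicator_mono[OF ckn kn0 _ _ _ order_refl]) (use s in auto)
      then show ?thesis using Npos[of n] by simp
    qed
    have "(\<lambda>n. 1 - ?v / c * (q / q') ^ n) \<longlonglongrightarrow> 1 - ?v / c * 0"
      by (intro tendsto_intros LIMSEQ_power_zero) (use q q' in simp)
    then have lim: "(\<lambda>n. 1 - ?v / c * (q / q') ^ n) \<longlonglongrightarrow> 1" by simp
    show "(\<lambda>n. \<integral>x. indicat_real (cball 0 s) x * K n x \<partial>lborel) \<longlonglongrightarrow> 1"
      unfolding intK
      by (rule tendsto_sandwich[OF always_eventually always_eventually lim tendsto_const]) (use low up in auto)
  qed
qed

section \<open>Passage to the limit\<close>

text \<open>Domination asks only that \<zeta> be at least 1 on the ball, so a widened bump divided
  by its lower bound there serves in place of a plateau function.\<close>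

lemma cutoff_exists:
  fixes r :: real
  assumes "0 < r"
  obtains \<zeta> :: "real^'n \<Rightarrow> real" and R where "C2 \<zeta>" "supp_ball R \<zeta>" "r \<le> R" "\<And>x. 0 \<le> \<zeta> x" "\<And>x. norm x \<le> r \<Longrightarrow> 1 \<le> \<zeta> x"
proof -
  let ?c = "(\<Prod>i\<in>(UNIV::'n set). (3/4::real) ^ 3)"
  have c: "0 < ?c" by (intro prod_pos) simp
  let ?\<zeta> = "\<lambda>x::real^'n. (1 / ?c) * bump ((1 / (4 * r)) *\<^sub>R (x - 0))"
  have r4: "0 < 4 * r" using assms by simp
  show ?thesis
  proof (rule that[of ?\<zeta> "real CARD('n) * (4 * r)"])
    show "C2 ?\<zeta>" by (intro C2_cmult C2_bump_affine)
    show "supp_ball (real CARD('n) * (4 * r)) ?\<zeta>"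
      using supp_ball_mult(2)[OF supp_ball_bump_affine[OF r4, of "0::real^'n"], of "\<lambda>x. 1 / ?c"] by simp
    have "r * 1 \<le> 4 * r * real CARD('n)" using assms by (intro mult_mono) (auto simp: Suc_le_eq)
    then show "r \<le> real CARD('n) * (4 * r)" by (simp add: mult_ac)
    show "0 \<le> ?\<zeta> x" for x using c bump_nonneg[of "(1 / (4 * r)) *\<^sub>R (x - 0)"] by (intro mult_nonneg_nonneg) auto
    fix x :: "real^'n" assume x: "norm x \<le> r"
    have "?c \<le> bump ((1 / (4 * r)) *\<^sub>R (x - 0))" unfolding bump_def
    proof (intro prod_mono conjI power_mono)
      fix i
      have "\<bar>x $ i\<bar> \<le> r" using x component_le_norm_cart order_trans by blast
      then have "\<bar>2 * ((1 / (4 * r)) *\<^sub>R (x - 0)) $ i\<bar> \<le> 1/2" using assms by (simp add: abs_mult field_simps)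
      then have "(2 * ((1 / (4 * r)) *\<^sub>R (x - 0)) $ i)\<^sup>2 \<le> (1/2)\<^sup>2" by (metis abs_ge_zero power2_abs power_mono)
      then show "3/4 \<le> max 0 (1 - (2 * ((1 / (4 * r)) *\<^sub>R (x - 0)) $ i)\<^sup>2)" by (simp add: power2_eq_square)
    qed simp_all
    then have "(1 / ?c) * ?c \<le> ?\<zeta> x" using c by (intro mult_left_mono) auto
    then show "1 \<le> ?\<zeta> x" using c by simp
  qed
qed

text \<open>Concavity of \<open>det\<^sup>1\<^sup>/\<^sup>d\<close>: after the linear change of variables that turns \<open>X\<close> into the
  identity, \<open>d det\<^sup>1\<^sup>/\<^sup>d\<close> is bounded by the trace, which commutes with the integral.\<close>

lemma integral_det_powr_le:
  fixes a :: "'a \<Rightarrow> real^'n^'n" and X :: "real^'n^'n"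
  assumes psd: "\<And>y. psd_sym (a y)" and \<kappa>: "\<And>y. 0 \<le> \<kappa> y"
    and int: "\<And>i j. integrable M (\<lambda>y. a y $ i $ j * \<kappa> y)"
    and intG: "integrable M (\<lambda>y. det (a y) powr (1 / real CARD('n)) * \<kappa> y)"
    and X: "psd_sym X" "0 < det X"
    and le: "\<And>v. (\<Sum>i\<in>UNIV. \<Sum>j\<in>UNIV. v $ i * v $ j * (\<integral>y. a y $ i $ j * \<kappa> y \<partial>M)) \<le> v \<bullet> (X *v v)"
  shows "(\<integral>y. det (a y) powr (1 / real CARD('n)) * \<kappa> y \<partial>M) \<le> det X powr (1 / real CARD('n))"
proof -
  let ?d = "real CARD('n)"
  obtain T :: "real^'n^'n" where T: "X = T ** transpose T" using psd_sym_factor[OF X(1)] .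
  have detX: "det X = (det T)\<^sup>2" by (simp add: T det_mul det_transpose power2_eq_square)
  then have "det T \<noteq> 0" using X(2) by auto
  \<comment> \<open>\<open>S\<close> is the change of variables that takes \<open>X\<close> to the
    identity; its determinant factor is restored at the end.\<close>
  then obtain S where S: "T ** S = mat 1" "S ** T = mat 1" using det_nonzero_inverse by blast
  have detS: "det S * det T = 1" using S(2) by (metis det_I det_mul)
  have quad: "(S ** N ** transpose S) $ i $ i = (\<Sum>k\<in>UNIV. \<Sum>l\<in>UNIV. (S $ i) $ k * (S $ i) $ l * N $ k $ l)" for N :: "real^'n^'n" and i
  proof -
    have "(S ** N ** transpose S) $ i $ i = (\<Sum>l\<in>UNIV. \<Sum>k\<in>UNIV. (S $ i) $ k * (S $ i) $ l * N $ k $ l)"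
      by (simp add: matrix_matrix_mult_def transpose_def sum_distrib_left sum_distrib_right mult_ac)
    then show ?thesis by (subst sum.swap)
  qed
  \<comment> \<open>The trace bound is used for the conjugate of \<open>a y\<close> by
    \<open>S\<close>, whose trace is linear in \<open>a y\<close> and so passes through the
    integral.\<close>
  have tr: "?d * ((det S)\<^sup>2 powr (1 / ?d) * det (a y) powr (1 / ?d)) \<le> (\<Sum>i\<in>UNIV. (S ** a y ** transpose S) $ i $ i)" for y
  proof -
    obtain U :: "real^'n^'n" where U: "a y = U ** transpose U" using psd_sym_factor[OF psd] .
    have "psd_sym ((S ** U) ** transpose (S ** U))" by (rule psd_sym_mult_transpose)
    then have "psd_sym (S ** a y ** transpose S)" by (simp add: U matrix_transpose_mul matrix_mul_assoc)
    from psd_sym_det_le_trace[OF this] show ?thesis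
      using psd_sym_det_nonneg[OF psd[of y]]
      by (simp add: det_mul det_transpose powr_mult[symmetric] power2_eq_square mult_ac)
  qed
  have i1: "integrable M (\<lambda>y. (S ** a y ** transpose S) $ i $ i * \<kappa> y)" for i
    unfolding quad sum_distrib_right using int by (auto simp: mult.assoc)
  have "?d * ((det S)\<^sup>2 powr (1 / ?d) * (\<integral>y. det (a y) powr (1 / ?d) * \<kappa> y \<partial>M))
      = (\<integral>y. ?d * ((det S)\<^sup>2 powr (1 / ?d) * det (a y) powr (1 / ?d)) * \<kappa> y \<partial>M)"
    by (simp add: mult.assoc)
  also have "\<dots> \<le> (\<integral>y. (\<Sum>i\<in>UNIV. (S ** a y ** transpose S) $ i $ i * \<kappa> y) \<partial>M)"
  proof (rule Bochner_Integration.integral_mono)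
    show "integrable M (\<lambda>y. ?d * ((det S)\<^sup>2 powr (1 / ?d) * det (a y) powr (1 / ?d)) * \<kappa> y)"
      using intG by (simp add: mult.assoc)
    show "integrable M (\<lambda>y. \<Sum>i\<in>UNIV. (S ** a y ** transpose S) $ i $ i * \<kappa> y)" using i1 by auto
    show "?d * ((det S)\<^sup>2 powr (1 / ?d) * det (a y) powr (1 / ?d)) * \<kappa> y \<le> (\<Sum>i\<in>UNIV. (S ** a y ** transpose S) $ i $ i * \<kappa> y)" for y
      unfolding sum_distrib_right[symmetric] by (rule mult_right_mono[OF tr \<kappa>])
  qed
  also have "\<dots> = (\<Sum>i\<in>UNIV. \<Sum>k\<in>UNIV. \<Sum>l\<in>UNIV. (S $ i) $ k * (S $ i) $ l * (\<integral>y. a y $ k $ l * \<kappa> y \<partial>M))"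
  proof -
    have "(\<integral>y. (\<Sum>i\<in>UNIV. (S ** a y ** transpose S) $ i $ i * \<kappa> y) \<partial>M)
        = (\<Sum>i\<in>UNIV. \<integral>y. (\<Sum>k\<in>UNIV. \<Sum>l\<in>UNIV. (S $ i) $ k * (S $ i) $ l * (a y $ k $ l * \<kappa> y)) \<partial>M)"
      using i1 by (subst Bochner_Integration.integral_sum) (simp_all add: quad sum_distrib_right mult.assoc)
    then show ?thesis using int by (simp add: Bochner_Integration.integral_sum)
  qed
  also have "\<dots> \<le> (\<Sum>i\<in>UNIV. (S $ i) \<bullet> (X *v (S $ i)))" by (intro sum_mono le)
  also have "\<dots> = (\<Sum>i\<in>UNIV. (S ** X ** transpose S) $ i $ i)"
    by (intro sum.cong refl) (simp add: quad quadratic_form_sum mult_ac)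
  also have "S ** X ** transpose S = mat 1"
  proof -
    have "S ** X ** transpose S = (S ** T) ** transpose (S ** T)" by (simp add: T matrix_transpose_mul matrix_mul_assoc)
    then show ?thesis by (simp add: S)
  qed
  also have "(\<Sum>i\<in>(UNIV::'n set). (mat 1 :: real^'n^'n) $ i $ i) = ?d" by (simp add: mat_def)
  finally have 1: "(det S)\<^sup>2 powr (1 / ?d) * (\<integral>y. det (a y) powr (1 / ?d) * \<kappa> y \<partial>M) \<le> 1" by simp
  have "det X powr (1 / ?d) * (det S)\<^sup>2 powr (1 / ?d) = 1"
  proof -
    have "det X * (det S)\<^sup>2 = 1" using detS by (simp add: detX power_mult_distrib[symmetric] mult.commute)
    then show ?thesis using X(2) by (simp add: powr_mult[symmetric])
  qed
  then have "(\<integral>y. det (a y) powr (1 / ?d) * \<kappa> y \<partial>M)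
      = det X powr (1 / ?d) * ((det S)\<^sup>2 powr (1 / ?d) * (\<integral>y. det (a y) powr (1 / ?d) * \<kappa> y \<partial>M))"
    by (simp add: mult.assoc[symmetric])
  also have "\<dots> \<le> det X powr (1 / ?d) * 1" using 1 by (intro mult_left_mono) auto
  finally show ?thesis by simp
qed

text \<open>The periodic kernels meant here also pick up \<open>g\<close> at lattice translates of
  the point, so the convolution is only bounded below by \<open>g\<close> in the limit. The minimum
  with \<open>g\<close> turns this into convergence and supplies a bounded integrand.\<close>

lemma kernel_liminf:
  fixes K :: "nat \<Rightarrow> real^'n \<Rightarrow> real"
  assumes K: "\<And>n. continuous_on UNIV (K n)" "\<And>n z. 0 \<le> K n z" and \<rho>: "0 < \<rho>"
    and lim: "\<And>s. 0 < s \<Longrightarrow> s \<le> \<rho> \<Longrightarrow> (\<lambda>n. \<integral>x. indicat_real (cball 0 s) x * K n x \<partial>lborel) \<longlonglongrightarrow> 1"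
    and g: "continuous_on UNIV g" "supp_ball R g" "\<And>x. 0 \<le> g x"
  shows "(\<lambda>n. min (g y) (\<integral>x. g x * K n (x - y) \<partial>lborel)) \<longlonglongrightarrow> g y"
proof (rule tendstoI)
  fix e :: real assume e: "0 < e"
  define J where "J n = (\<integral>x. g x * K n (x - y) \<partial>lborel)" for n
  have cKs: "continuous_on UNIV (\<lambda>x. K n (x - y))" for n
    by (rule continuous_on_compose2[OF K(1)]) (auto intro!: continuous_intros)
  have ig: "integrable lborel (\<lambda>x. g x * K n (x - y))" for n
    by (intro integrable_continuous_supp_ball[where R=R] continuous_intros g cKs supp_ball_mult(1))
  have J0: "0 \<le> J n" for n unfolding J_def by (intro Bochner_Integration.integral_nonneg mult_nonneg_nonneg g K)
  have "\<forall>\<^sub>F n in sequentially. g y - e < J n"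
  proof (cases "g y - e / 2 \<le> 0")
    case True
    then have "g y - e < J n" for n using J0[of n] e by linarith
    then show ?thesis by simp
  next
    case False
    have "isCont g y" using g(1) by (simp add: continuous_on_eq_continuous_at)
    then obtain s0 where s0: "0 < s0" "\<And>x. dist x y < s0 \<Longrightarrow> dist (g x) (g y) < e / 2"
      using e unfolding continuous_at_eps_delta by (metis half_gt_zero)
    define s where "s = min (s0 / 2) \<rho>"
    have s: "0 < s" "s < s0" "s \<le> \<rho>" using s0(1) \<rho> by (auto simp: s_def)
    let ?c = "g y - e / 2"
    have low: "?c * (\<integral>x. indicat_real (cball 0 s) x * K n x \<partial>lborel) \<le> J n" for n
    proof -
      have m: "(\<lambda>x. indicat_real (cball 0 s) x * K n x) \<in> borel_measurable borel"
        by (intro borel_measurable_times borel_measurable_indicator borel_measurable_continuous_onI K(1)) auto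
      have sub: "cball y s \<subseteq> cball 0 (norm y + s)"
      proof
        fix x assume "x \<in> cball y s"
        then show "x \<in> cball 0 (norm y + s)" using norm_triangle_sub[of x y] by (simp add: dist_norm norm_minus_commute)
      qed
      have i: "integrable lborel (\<lambda>x. indicat_real (cball y s) x * K n (x - y))"
        by (rule integrable_indicator_bounded[OF cKs _ sub]) simp
      have "(\<integral>x. indicat_real (cball 0 s) x * K n x \<partial>lborel) = (\<integral>x. indicat_real (cball 0 s) (x + - y) * K n (x + - y) \<partial>lborel)"
        by (rule lborel_integral_translate_measurable[OF m, symmetric])
      also have "\<dots> = (\<integral>x. indicat_real (cball y s) x * K n (x - y) \<partial>lborel)"
        by (simp add: indicator_def dist_norm norm_minus_commute)
      finally have "?c * (\<integral>x. indicat_real (cball 0 s) x * K n x \<partial>lborel) = (\<integral>x. ?c * (indicat_real (cball y s) x * K n (x - y)) \<partial>lborel)"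
        by simp
      also have "\<dots> \<le> J n" unfolding J_def
      proof (rule Bochner_Integration.integral_mono)
        show "integrable lborel (\<lambda>x. ?c * (indicat_real (cball y s) x * K n (x - y)))" using i by simp
        fix x
        show "?c * (indicat_real (cball y s) x * K n (x - y)) \<le> g x * K n (x - y)"
        proof (cases "x \<in> cball y s")
          case True
          then have "dist x y < s0" using s(2) by (simp add: dist_commute)
          then have "?c \<le> g x" using s0(2)[of x] unfolding dist_real_def by linarith
          then show ?thesis using True K(2) by (simp add: mult_right_mono)
        qed (use g(3) K(2) in simp)
      qed (rule ig)
      finally show ?thesis .
    qed
    have "(\<lambda>n. ?c * (\<integral>x. indicat_real (cball 0 s) x * K n x \<partial>lborel)) \<longlonglongrightarrow> ?c * 1"
      by (intro tendsto_intros lim s)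
    moreover have "g y - e < ?c * 1" using e by simp
    ultimately have "\<forall>\<^sub>F n in sequentially. g y - e < ?c * (\<integral>x. indicat_real (cball 0 s) x * K n x \<partial>lborel)"
      by (rule order_tendstoD(1))
    then show ?thesis by (rule eventually_mono) (use low less_le_trans in blast)
  qed
  then show "\<forall>\<^sub>F n in sequentially. dist (min (g y) (\<integral>x. g x * K n (x - y) \<partial>lborel)) (g y) < e"
    by (rule eventually_mono) (use e in \<open>auto simp: J_def dist_real_def min_def abs_less_iff\<close>)
qed

text \<open>The bound is tested with continuous approximations of \<open>min G k\<close> to the power \<open>1/(d - 1)\<close>.\<close>

lemma powr_integrable_if_dual_bound:
  fixes G :: "'a::euclidean_space \<Rightarrow> real" and d :: nat
  assumes d: "2 \<le> d" and G: "integrable lebesgue G" "\<And>y. 0 \<le> G y" "\<And>y. r < norm y \<Longrightarrow> G y = 0" and C: "0 \<le> C"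
    and dual: "\<And>g. continuous_on UNIV g \<Longrightarrow> supp_ball (r + 1) g \<Longrightarrow> (\<And>x. 0 \<le> g x) \<Longrightarrow>
      (\<integral>y. G y * g y \<partial>lebesgue) \<le> C * (\<integral>x. g x ^ d \<partial>lborel) powr (1 / real d)"
  shows "integrable lebesgue (\<lambda>y. G y powr (real d / (real d - 1)))"
proof -
  \<comment> \<open>The exponent with d q = 1 + q = d / (d - 1): then the d-th power of
    \<open>w\<close> is the truncation to the power 1 + q, which lies below \<open>G\<close> times
    \<open>w\<close>.\<close>
  define q where "q = 1 / (real d - 1)"
  have d1: "1 \<le> real d - 1" using d by simp
  have q: "0 < q" "real d * q = 1 + q" "real d / (real d - 1) = 1 + q"
    using d1 by (auto simp: q_def field_simps)
  define h where "h k y = min (G y) (real k)" for k y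
  have h: "0 \<le> h k y" "h k y \<le> real k" "h k y \<le> G y" for k y using G(2) by (auto simp: h_def)
  define w where "w k y = h k y powr q" for k y
  have Gm: "G \<in> borel_measurable lebesgue" using G(1) by auto
  have hm: "h k \<in> borel_measurable lebesgue" for k unfolding h_def using Gm by measurable
  have wm: "w k \<in> borel_measurable lebesgue" for k unfolding w_def using hm[of k] by measurable
  have w0: "0 \<le> w k y" for k y by (simp add: w_def)
  define b where "b k = real k powr q" for k :: nat
  have wb: "w k y \<le> b k" for k y unfolding w_def b_def using h q by (intro powr_mono2) auto
  have wz: "w k y = 0" if "r < norm y" for k y using G(3)[OF that] by (simp add: w_def h_def)
  have wd: "w k y ^ d = h k y powr (1 + q)" for k y
  proof (cases "h k y = 0")
    case True then show ?thesis using d by (simp add: w_def)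
  next
    case False
    then have "0 < h k y" using h(1)[of k y] by simp
    then show ?thesis unfolding w_def q(2)[symmetric] by (simp add: powr_realpow[symmetric] powr_powr mult.commute)
  qed
  let ?cb = "cball 0 (r + 1) :: 'a set"
  have cbi: "integrable lebesgue (\<lambda>y. c * indicat_real ?cb y)" for c
    using lmeasurable_cball[of 0 "r + 1"] by (intro integrable_mult_right integrable_real_indicator) (auto simp: fmeasurable_def)
  \<comment> \<open>Confines the test functions to radius r + 1 and is 1 on the ball of radius
    \<open>r\<close>, outside which \<open>G\<close> vanishes.\<close>
  define cut where "cut y = max 0 (min 1 (r + 1 - norm y))" for y :: 'a
  have cut: "continuous_on UNIV cut" "0 \<le> cut y" "cut y \<le> 1" for y
    unfolding cut_def by (auto intro!: continuous_intros)
  have cut1: "cut y = 1" if "norm y \<le> r" for y using that by (simp add: cut_def)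
  have cut0: "cut y = 0" if "r + 1 \<le> norm y" for y using that by (simp add: cut_def)
  define m where "m k = (\<integral>y. h k y powr (1 + q) \<partial>lebesgue)" for k
  \<comment> \<open>Testing with \<open>w k\<close> bounds \<open>m k\<close> by a multiple of its
    own d-th root.\<close>
  have main: "integrable lebesgue (\<lambda>y. h k y powr (1 + q))" "m k \<le> C * m k powr (1 / real d)" for k
  proof -
    have "w k measurable_on UNIV"
      using wm[of k] by (simp add: measurable_on_iff_borel_measurable)
    then obtain N g where N: "negligible N" and gc: "\<And>n. continuous_on UNIV (g n)"
      and gl: "\<And>x. x \<notin> N \<Longrightarrow> (\<lambda>n. g n x) \<longlonglongrightarrow> w k x"
      unfolding measurable_on_def by auto
    \<comment> \<open>Clamping to [0, b k] does not change the limit, as \<open>w k\<close> takes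
      its values there, and it supplies the dominating function.\<close>
    define \<phi> where "\<phi> n y = min (max (g n y) 0) (b k) * cut y" for n y
    have b0: "0 \<le> b k" by (simp add: b_def)
    have \<phi>: "continuous_on UNIV (\<phi> n)" "0 \<le> \<phi> n y" "\<phi> n y \<le> b k" for n y
    proof -
      show "continuous_on UNIV (\<phi> n)" unfolding \<phi>_def by (intro continuous_intros gc cut)
      show "0 \<le> \<phi> n y" unfolding \<phi>_def using b0 cut(2) by (intro mult_nonneg_nonneg) auto
      have "min (max (g n y) 0) (b k) * cut y \<le> b k * 1" using b0 cut(2,3) by (intro mult_mono) auto
      then show "\<phi> n y \<le> b k" by (simp add: \<phi>_def)
    qed
    have s\<phi>: "supp_ball (r + 1) (\<phi> n)" for n using cut0 by (simp add: supp_ball_def \<phi>_def)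
    have \<phi>m: "\<phi> n \<in> borel_measurable lebesgue" for n
      using borel_measurable_continuous_onI[OF \<phi>(1)[of n]] by (simp add: measurable_completion)
    have \<phi>l: "(\<lambda>n. \<phi> n y) \<longlonglongrightarrow> w k y" if "y \<notin> N" for y
    proof -
      have "(\<lambda>n. \<phi> n y) \<longlonglongrightarrow> min (max (w k y) 0) (b k) * cut y"
        unfolding \<phi>_def by (intro tendsto_intros gl that)
      moreover have "min (max (w k y) 0) (b k) * cut y = w k y"
        using w0[of k y] wb[of k y] cut1[of y] wz[of y k] by (cases "norm y \<le> r") auto
      ultimately show ?thesis by simp
    qed
    have ae: "AE y in lebesgue. y \<notin> N"
      using N by (simp add: negligible_iff_null_sets AE_not_in)
    have \<phi>bd: "\<phi> n y ^ d \<le> b k ^ d * indicat_real ?cb y" for n y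
    proof (cases "y \<in> ?cb")
      case True then show ?thesis using \<phi>(2,3) by (simp add: power_mono)
    next
      case False
      then have "\<phi> n y = 0" using s\<phi>[of n] by (simp add: supp_ball_def)
      then show ?thesis using d False by (simp add: power_0_left)
    qed
    have lim1: "(\<lambda>n. \<integral>y. G y * \<phi> n y \<partial>lebesgue) \<longlonglongrightarrow> (\<integral>y. G y * w k y \<partial>lebesgue)"
    proof (rule integral_dominated_convergence)
      show "(\<lambda>y. G y * w k y) \<in> borel_measurable lebesgue" using Gm wm[of k] by measurable
      show "(\<lambda>y. G y * \<phi> n y) \<in> borel_measurable lebesgue" for n using Gm \<phi>m[of n] by measurable
      show "integrable lebesgue (\<lambda>y. G y * b k)" using G(1) by simp
      show "AE y in lebesgue. (\<lambda>n. G y * \<phi> n y) \<longlonglongrightarrow> G y * w k y"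
        using ae by eventually_elim (intro tendsto_intros \<phi>l)
      show "AE y in lebesgue. norm (G y * \<phi> n y) \<le> G y * b k" for n
        using G(2) \<phi>(2,3) by (intro always_eventually allI) (simp add: abs_mult mult_left_mono)
    qed
    have lim2: "(\<lambda>n. \<integral>y. \<phi> n y ^ d \<partial>lebesgue) \<longlonglongrightarrow> (\<integral>y. w k y ^ d \<partial>lebesgue)"
    proof (rule integral_dominated_convergence)
      show "(\<lambda>y. w k y ^ d) \<in> borel_measurable lebesgue" using wm[of k] by measurable
      show "(\<lambda>y. \<phi> n y ^ d) \<in> borel_measurable lebesgue" for n using \<phi>m[of n] by measurable
      show "integrable lebesgue (\<lambda>y. b k ^ d * indicat_real ?cb y)" by (rule cbi)
      show "AE y in lebesgue. (\<lambda>n. \<phi> n y ^ d) \<longlonglongrightarrow> w k y ^ d"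
        using ae by eventually_elim (intro tendsto_intros \<phi>l)
      show "AE y in lebesgue. norm (\<phi> n y ^ d) \<le> b k ^ d * indicat_real ?cb y" for n
        using \<phi>bd \<phi>(2) by (intro always_eventually allI) simp
    qed
    have lb: "(\<integral>y. \<phi> n y ^ d \<partial>lebesgue) = (\<integral>y. \<phi> n y ^ d \<partial>lborel)" for n
      by (rule integral_completion) (use borel_measurable_continuous_onI[OF \<phi>(1)[of n]] in simp)
    have "(\<integral>y. G y * w k y \<partial>lebesgue) \<le> C * (\<integral>y. w k y ^ d \<partial>lebesgue) powr (1 / real d)"
    proof (rule LIMSEQ_le[OF lim1])
      show "(\<lambda>n. C * (\<integral>y. \<phi> n y ^ d \<partial>lebesgue) powr (1 / real d)) \<longlonglongrightarrow> C * (\<integral>y. w k y ^ d \<partial>lebesgue) powr (1 / real d)"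
        using d \<phi>(2) by (intro tendsto_mult tendsto_const tendsto_powr'[OF lim2 tendsto_const])
          (auto intro!: always_eventually Bochner_Integration.integral_nonneg)
      show "\<exists>N. \<forall>n\<ge>N. (\<integral>y. G y * \<phi> n y \<partial>lebesgue) \<le> C * (\<integral>y. \<phi> n y ^ d \<partial>lebesgue) powr (1 / real d)"
        unfolding lb using dual[OF \<phi>(1) s\<phi> \<phi>(2)] by blast
    qed
    then have le: "(\<integral>y. G y * w k y \<partial>lebesgue) \<le> C * m k powr (1 / real d)" by (simp add: wd m_def)
    have hp: "h k y powr (1 + q) \<le> G y * w k y" for y
    proof -
      have "h k y powr (1 + q) = h k y * w k y" using h(1)[of k y] by (cases "h k y = 0") (simp_all add: w_def powr_add)
      then show ?thesis using h(3) w0 by (simp add: mult_right_mono)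
    qed
    have Gw: "integrable lebesgue (\<lambda>y. G y * w k y)"
    proof (rule Bochner_Integration.integrable_bound)
      show "integrable lebesgue (\<lambda>y. G y * b k)" using G(1) by simp
      show "(\<lambda>y. G y * w k y) \<in> borel_measurable lebesgue" using Gm wm[of k] by measurable
      show "AE y in lebesgue. norm (G y * w k y) \<le> norm (G y * b k)"
        using G(2) w0 wb b0 by (intro always_eventually allI) (simp add: abs_mult mult_left_mono)
    qed
    show hi: "integrable lebesgue (\<lambda>y. h k y powr (1 + q))"
    proof (rule Bochner_Integration.integrable_bound[OF Gw])
      show "(\<lambda>y. h k y powr (1 + q)) \<in> borel_measurable lebesgue" using hm[of k] by measurable
      show "AE y in lebesgue. norm (h k y powr (1 + q)) \<le> norm (G y * w k y)"
        using hp by (intro always_eventually allI) (simp add: order_trans[OF hp abs_ge_self])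
    qed
    have "m k \<le> (\<integral>y. G y * w k y \<partial>lebesgue)" unfolding m_def
      by (rule Bochner_Integration.integral_mono[OF hi Gw hp])
    then show "m k \<le> C * m k powr (1 / real d)" using le by linarith
  qed
  have m0: "0 \<le> m k" for k unfolding m_def by (intro Bochner_Integration.integral_nonneg) simp
  \<comment> \<open>The truncated power is integrable, so the d-th root of \<open>m k\<close> can be
    cancelled; the resulting bound is the same for all \<open>k\<close>.\<close>
  have mb: "m k \<le> C powr (1 + q)" for k
  proof (cases "m k = 0")
    case False
    then have mp: "0 < m k" using m0[of k] by simp
    have e: "m k powr (1 - 1 / real d) * m k powr (1 / real d) = m k" using mp by (simp add: powr_add[symmetric])
    have "m k powr (1 - 1 / real d) \<le> C"
    proof -
      have "m k powr (1 - 1 / real d) * m k powr (1 / real d) \<le> C * m k powr (1 / real d)" using main(2)[of k] e by simp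
      then show ?thesis using mp by simp
    qed
    then have "(m k powr (1 - 1 / real d)) powr (1 + q) \<le> C powr (1 + q)" using q by (intro powr_mono2) auto
    moreover have "(1 - 1 / real d) * (1 + q) = 1" using d1 by (simp add: q_def field_simps)
    ultimately show ?thesis using mp by (simp add: powr_powr)
  qed simp
  have mono: "h k y powr (1 + q) \<le> h l y powr (1 + q)" if "k \<le> l" for k l y
    using that h q by (intro powr_mono2) (auto simp: h_def)
  have "incseq m" unfolding incseq_def m_def
    by (intro allI impI Bochner_Integration.integral_mono main mono)
  then obtain L where L: "m \<longlonglongrightarrow> L" using incseq_convergent mb by metis
  have "integrable lebesgue (\<lambda>y. G y powr (1 + q))"
  proof (rule integrable_monotone_convergence[where f="\<lambda>k y. h k y powr (1 + q)" and x=L])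
    show "integrable lebesgue (\<lambda>y. h k y powr (1 + q))" for k by (rule main)
    show "AE y in lebesgue. mono (\<lambda>k. h k y powr (1 + q))" using mono by (auto simp: mono_def)
    show "AE y in lebesgue. (\<lambda>k. h k y powr (1 + q)) \<longlonglongrightarrow> G y powr (1 + q)"
    proof (intro always_eventually allI)
      fix y
      obtain k0 where "G y \<le> real k0" using real_arch_simple by blast
      then have "\<forall>\<^sub>F k in sequentially. h k y powr (1 + q) = G y powr (1 + q)"
        unfolding eventually_sequentially h_def by (intro exI[of _ k0]) (auto simp: min_def)
      then show "(\<lambda>k. h k y powr (1 + q)) \<longlonglongrightarrow> G y powr (1 + q)" by (rule tendsto_eventually)
    qed
    show "(\<lambda>k. \<integral>y. h k y powr (1 + q) \<partial>lebesgue) \<longlonglongrightarrow> L"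
      using L m_def[abs_def] by simp
    show "(\<lambda>y. G y powr (1 + q)) \<in> borel_measurable lebesgue" using Gm by measurable
  qed
  then show ?thesis by (simp add: q(3))
qed

section \<open>Compensated integrability\<close>

text \<open>Test the form with the i-th unit vector plus and minus the j-th. The trace thereby
  controls all entries that appear when the cutoff is differentiated.\<close>

lemma psd_sym_entry_le_trace:
  fixes W :: "real^'n^'n"
  assumes "psd_sym W" shows "\<bar>W $ i $ j\<bar> \<le> (\<Sum>k\<in>UNIV. W $ k $ k)"
proof -
  have d0: "0 \<le> W $ k $ k" for k by (rule psd_sym_diag_nonneg[OF assms])
  have le: "W $ k $ k \<le> (\<Sum>k\<in>UNIV. W $ k $ k)" for k by (rule member_le_sum) (use d0 in auto)
  have q: "0 \<le> W $ i $ i + 2 * s * W $ i $ j + s * s * W $ j $ j" for s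
  proof -
    let ?v = "axis i 1 + s *\<^sub>R axis j (1::real)"
    have "0 \<le> ?v \<bullet> (W *v ?v)" using assms by (simp add: psd_sym_def)
    also have "\<dots> = W $ i $ i + 2 * s * W $ i $ j + s * s * W $ j $ j"
      using psd_sym_entry_commute[OF assms, of i j]
      by (simp add: matrix_vector_right_distrib matrix_vector_mult_scaleR inner_add_left inner_add_right
          inner_axis' inner_axis matrix_vector_mul_component algebra_simps)
    finally show ?thesis .
  qed
  show ?thesis using q[of 1] q[of "-1"] le[of i] le[of j] by (simp add: abs_le_iff)
qed

lemma fund_cell_image: "fund_cell B = (*v) B ` unit_cell"
  by (simp add: fund_cell_def unit_cell_def)

lemma fund_cell_bounded: "bounded (fund_cell B)"
  unfolding fund_cell_image bounded_iff using unit_cell_image_bound by blast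

lemma fund_cell_borel:
  fixes B :: "real^'n^'n"
  assumes "invertible B" shows "fund_cell B \<in> sets borel"
proof -
  obtain N where N: "N ** B = mat 1" "B ** N = mat 1" using assms unfolding invertible_def by blast
  have NB: "N *v (B *v x) = x" "B *v (N *v x) = x" for x using N by (simp_all add: matrix_vector_mul_assoc)
  have "fund_cell B = (\<Inter>i. {x. 0 \<le> (N *v x) $ i} \<inter> {x. (N *v x) $ i < 1})"
  proof (intro equalityI subsetI)
    fix x assume "x \<in> (\<Inter>i. {x. 0 \<le> (N *v x) $ i} \<inter> {x. (N *v x) $ i < 1})"
    then have "N *v x \<in> unit_cell" by (auto simp: unit_cell_def)
    then show "x \<in> fund_cell B" unfolding fund_cell_image using NB(2)[of x] by (metis image_eqI)
  qed (auto simp: fund_cell_def NB)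
  moreover have c: "continuous_on UNIV (\<lambda>x. (N *v x) $ i)" for i
    by (intro continuous_intros linear_continuous_on matrix_vector_mul_bounded_linear)
  have "{x. 0 \<le> (N *v x) $ i} \<inter> {x. (N *v x) $ i < 1} \<in> sets borel" for i
    by (intro sets.Int borel_closed closed_Collect_le borel_open open_Collect_less c continuous_on_const)
  ultimately show ?thesis by (auto intro: sets.finite_INT)
qed

lemma torus_measure_integral_le:
  fixes Y :: "(real^'n) set"
  assumes m: "torus_measure Y m" and Y: "Y \<in> sets borel"
    and f: "integrable m f" "\<And>y. y \<in> Y \<Longrightarrow> f y \<le> c"
  shows "(\<integral>y. f y \<partial>m) \<le> c * measure m UNIV"
proof -
  have s: "sets m = sets borel" and fm: "finite_measure m" and n: "emeasure m (UNIV - Y) = 0"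
    using m by (auto simp: torus_measure_def)
  have sp: "space m = UNIV" using sets_eq_imp_space_eq[OF s] by simp
  have "AE y in m. y \<in> Y"
    by (rule AE_I[of _ _ "UNIV - Y"]) (use n Y s sp in auto)
  then have "AE y in m. f y \<le> c" by eventually_elim (rule f(2))
  moreover have "integrable m (\<lambda>y. c)" using fm by (simp add: finite_measure.integrable_const)
  ultimately have "(\<integral>y. f y \<partial>m) \<le> (\<integral>y. c \<partial>m)" by (intro integral_mono_AE f(1))
  then show ?thesis by (simp add: sp mult.commute)
qed

text \<open>\<open>a\<close> is the tensor cut off to one cell; its convolution with a periodic
  kernel over the whole space is the mollification on the torus. The constant comes from a bound on
  the divergence of the localised mollified tensors that depends neither on \<open>n\<close> nor on
  \<open>g\<close>.\<close>

lemma weighted_determinant_bound: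
  fixes B :: "real^'n^'n" and A :: "real^'n \<Rightarrow> real^'n^'n"
  assumes inv: "invertible B" and psd: "\<And>x. psd_sym (A x)"
    and int: "\<And>i j. (\<lambda>x. A x $ i $ j) absolutely_integrable_on fund_cell B"
    and dv: "div_is_bounded_measure B A"
    and r: "0 < r" "fund_cell B \<subseteq> cball 0 r"
  defines "a \<equiv> \<lambda>y. indicat_real (fund_cell B) y *\<^sub>R A y"
  defines "G \<equiv> \<lambda>y. det (a y) powr (1 / real CARD('n))"
  shows "integrable lebesgue G"
    "\<exists>C\<ge>0. \<forall>g. continuous_on UNIV g \<longrightarrow> supp_ball (r + 1) g \<longrightarrow> (\<forall>x. 0 \<le> g x) \<longrightarrow>
      (\<integral>y. G y * g y \<partial>lebesgue) \<le> C * (\<integral>x. g x ^ CARD('n) \<partial>lborel) powr (1 / real CARD('n))"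
proof -
  let ?d = "real CARD('n)"
  let ?Y = "fund_cell B"
  have apsd: "psd_sym (a y)" for y
    using psd[of y] unfolding a_def psd_sym_def
    by (auto simp: scaleR_matrix_vector_assoc[symmetric] transpose_def vec_eq_iff indicator_def)
  have ai: "integrable lebesgue (\<lambda>y. a y $ i $ j)" for i j
    using int[of i j] by (simp add: a_def set_integrable_def)
  have Gm: "G \<in> borel_measurable lebesgue"
  proof -
    have "(\<lambda>y. a y $ i $ j) \<in> borel_measurable lebesgue" for i j using ai[of i j] by auto
    then have "(\<lambda>y. det (a y)) \<in> borel_measurable lebesgue" unfolding det_def
      by (intro borel_measurable_sum borel_measurable_times borel_measurable_const borel_measurable_prod)
    then show ?thesis unfolding G_def by measurable
  qed
  have G0: "0 \<le> G y" for y by (simp add: G_def)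
  \<comment> \<open>Plain integrability follows from the trace; it is the dual bound that raises the
    exponent.\<close>
  show iG: "integrable lebesgue G"
  proof (rule Bochner_Integration.integrable_bound[OF _ Gm])
    show "integrable lebesgue (\<lambda>y. \<Sum>i\<in>UNIV. a y $ i $ i)" using ai by auto
    show "AE y in lebesgue. norm (G y) \<le> norm (\<Sum>i\<in>UNIV. a y $ i $ i)"
    proof (intro always_eventually allI)
      fix y
      have "1 * G y \<le> ?d * G y" using G0 by (intro mult_right_mono) (auto simp: Suc_le_eq)
      then have "G y \<le> (\<Sum>i\<in>UNIV. a y $ i $ i)" using psd_sym_det_le_trace[OF apsd[of y]] by (simp add: G_def)
      then show "norm (G y) \<le> norm (\<Sum>i\<in>UNIV. a y $ i $ i)" using G0[of y] by simp
    qed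
  qed
  obtain K :: "nat \<Rightarrow> real^'n \<Rightarrow> real" and \<rho> where ker: "periodic_kernels B K \<rho>"
    by (rule periodic_kernels_exist[OF inv])
  have K: "trig (K n)" "separable (\<lambda>x y. K n (x - y))" "0 \<le> K n z" "periodic_wrt (lattice_of B) (K n)" for n z
    using ker unfolding periodic_kernels_def by simp_all
  have KM: "\<exists>M. \<forall>n y. norm y \<le> R \<longrightarrow> (\<integral>x. indicat_real (cball 0 R) x * K n (x - y) \<partial>lborel) \<le> M" for R
    using ker unfolding periodic_kernels_def by blast
  have \<rho>: "0 < \<rho>" "0 < s \<Longrightarrow> s \<le> \<rho> \<Longrightarrow> (\<lambda>n. \<integral>x. indicat_real (cball 0 s) x * K n x \<partial>lborel) \<longlonglongrightarrow> 1" for s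
    using ker unfolding periodic_kernels_def by simp_all
  obtain mp mn where tp: "\<And>i. torus_measure ?Y (mp i)" "\<And>i. torus_measure ?Y (mn i)"
    and dm: "\<And>\<phi> i. smooth_fun \<phi> \<Longrightarrow> periodic_wrt (lattice_of B) \<phi> \<Longrightarrow>
      - integral ?Y (\<lambda>x. \<Sum>j\<in>UNIV. A x $ i $ j * partial j \<phi> x) = (\<integral>x. \<phi> x \<partial>mp i) - (\<integral>x. \<phi> x \<partial>mn i)"
    using dv unfolding div_is_bounded_measure_def by blast
  \<comment> \<open>The test functions live in radius r + 1, and the inequality for smooth tensors
    wants a cutoff that is at least 1 on a strictly larger ball.\<close>
  have "0 < r + 2" using r by simp
  then obtain \<zeta> :: "real^'n \<Rightarrow> real" and R where \<zeta>: "C2 \<zeta>" "supp_ball R \<zeta>" "r + 2 \<le> R" "\<And>x. 0 \<le> \<zeta> x" "\<And>x. norm x \<le> r + 2 \<Longrightarrow> 1 \<le> \<zeta> x"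
    by (rule cutoff_exists) blast
  obtain M where M: "\<And>n y. norm y \<le> R \<Longrightarrow> (\<integral>x. indicat_real (cball 0 R) x * K n (x - y) \<partial>lborel) \<le> M"
    using KM[of R] by blast
  have Mn: "0 \<le> M"
  proof -
    have "0 \<le> (\<integral>x. indicat_real (cball 0 R) x * K 0 (x - 0) \<partial>lborel)"
      using K(3) by (intro Bochner_Integration.integral_nonneg) simp
    then show ?thesis using M[of 0 0] r \<zeta>(3) by simp
  qed
  have YR: "norm y \<le> R" if "y \<in> ?Y" for y using r(2) that \<zeta>(3) by force
  obtain z0 where z0: "0 < z0" "\<And>x. \<bar>\<zeta> x\<bar> \<le> z0" using supp_ball_bounded[OF C2_continuous[OF \<zeta>(1)] \<zeta>(2)] by blast
  have "\<exists>Z>0. \<forall>x. \<bar>partial j \<zeta> x\<bar> \<le> Z" for j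
    by (rule supp_ball_bounded[OF C1_continuous_partial[OF C2_C1(1)[OF \<zeta>(1)]] supp_ball_partial[OF \<zeta>(2)]]) blast
  then obtain Zj where Zj: "\<And>j x. \<bar>partial j \<zeta> x\<bar> \<le> Zj j" by metis
  define Z where "Z = (\<Sum>j\<in>UNIV. \<bar>Zj j\<bar>)"
  have Z: "\<bar>partial j \<zeta> x\<bar> \<le> Z" for j x
    using Zj[where j=j and x=x] member_le_sum[of j UNIV "\<lambda>j. \<bar>Zj j\<bar>"] unfolding Z_def by force
  have Z0: "0 \<le> Z" by (simp add: Z_def sum_nonneg)
  have ta: "trig_integrable lebesgue (\<lambda>y. a y $ i $ j)" for i j
    by (rule trig_integrableI[OF ai]) auto
  have tG: "trig_integrable lebesgue G"
    by (rule trig_integrableI[OF iG]) auto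
  have tm: "trig_integrable (mp i) (\<lambda>y. 1)" "trig_integrable (mn i) (\<lambda>y. 1)" for i
    using tp[of i] sets_eq_imp_space_eq[of "mp i" borel] sets_eq_imp_space_eq[of "mn i" borel]
    by (auto intro!: trig_integrableI simp: torus_measure_def finite_measure.integrable_const)
  let ?I = "indicat_real (cball 0 R :: (real^'n) set)"
  have iI: "integrable lborel ?I"
    using emeasure_bounded_finite[OF bounded_cball, of "0::real^'n" R] by (intro integrable_real_indicator) auto
  have tI: "trig_integrable lborel ?I" by (rule trig_integrableI[OF iI]) auto
  let ?vol = "measure lborel (cball (0::real^'n) R)"
  define mass where "mass = (\<Sum>i\<in>UNIV. measure (mp i) UNIV + measure (mn i) UNIV)"
  define trm where "trm = (\<Sum>k\<in>UNIV. M * (\<integral>y. a y $ k $ k \<partial>lebesgue) + ?vol)"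
  \<comment> \<open>The product rule: the cutoff times the divergence, bounded by the mass of the
    measures, and the derivative of the cutoff times the tensor, bounded by its trace.\<close>
  define \<beta> where "\<beta> = z0 * (M * mass) + ?d * (Z * (?d * trm))"
  have ak0: "0 \<le> a y $ k $ k" for y k by (rule psd_sym_diag_nonneg[OF apsd])
  have \<beta>0: "0 \<le> \<beta>"
    unfolding \<beta>_def mass_def trm_def using z0(1) Mn Z0 ak0
    by (intro add_nonneg_nonneg mult_nonneg_nonneg sum_nonneg Bochner_Integration.integral_nonneg) auto
  \<comment> \<open>The identity added to the mollified tensor makes it uniformly positive without changing its divergence.\<close>
  have bound: "(\<integral>y. G y * (\<integral>x. g x * K n (x - y) \<partial>lborel) \<partial>lebesgue)
      \<le> 2 * \<beta> / (?d * bump_mass TYPE('n)) * (\<integral>x. g x ^ CARD('n) \<partial>lborel) powr (1 / ?d)"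
    if g: "continuous_on UNIV g" "supp_ball (r + 1) g" "\<And>x. 0 \<le> g x" for g n
  proof -
    define \<alpha> where "\<alpha> i j x = (\<integral>y. a y $ i $ j * K n (x - y) \<partial>lebesgue)" for i j x
    define An where "An x = (\<chi> i j. \<alpha> i j x + (if i = j then 1 else 0))" for x
    have ka: "integrable lebesgue (\<lambda>y. a y $ i $ j * K n (x - y))" for i j x
      by (rule separable_integral(1)[OF K(2) ta])
    have t\<alpha>: "trig (\<alpha> i j)" for i j unfolding \<alpha>_def[abs_def] by (rule separable_integral(2)[OF K(2) ta])
    have Ane: "An x $ i $ j = \<alpha> i j x + (if i = j then 1 else 0)" for x i j by (simp add: An_def)
    have tAn: "trig (\<lambda>x. An x $ i $ j)" for i j unfolding Ane by (intro trig_add t\<alpha> trig_const)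
    have quad: "(\<Sum>i\<in>UNIV. \<Sum>j\<in>UNIV. v $ i * v $ j * \<alpha> i j x) = (\<integral>y. (v \<bullet> (a y *v v)) * K n (x - y) \<partial>lebesgue)" for v x
    proof -
      have "(\<integral>y. (v \<bullet> (a y *v v)) * K n (x - y) \<partial>lebesgue)
          = (\<integral>y. (\<Sum>i\<in>UNIV. \<Sum>j\<in>UNIV. v $ i * v $ j * (a y $ i $ j * K n (x - y))) \<partial>lebesgue)"
        unfolding quadratic_form_sum sum_distrib_right
        by (intro Bochner_Integration.integral_cong sum.cong refl) (simp add: mult_ac)
      then show ?thesis using ka by (simp add: Bochner_Integration.integral_sum \<alpha>_def)
    qed
    have quad0: "0 \<le> (\<Sum>i\<in>UNIV. \<Sum>j\<in>UNIV. v $ i * v $ j * \<alpha> i j x)" for v x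
      unfolding quad using apsd K(3) by (intro Bochner_Integration.integral_nonneg mult_nonneg_nonneg) (auto simp: psd_sym_def)
    have quadA: "v \<bullet> (An x *v v) = (\<Sum>i\<in>UNIV. \<Sum>j\<in>UNIV. v $ i * v $ j * \<alpha> i j x) + v \<bullet> v" for v x
    proof -
      have "v \<bullet> (An x *v v) = (\<Sum>i\<in>UNIV. \<Sum>j\<in>UNIV. v $ i * v $ j * \<alpha> i j x + (if i = j then v $ i * v $ j else 0))"
        unfolding quadratic_form_sum Ane by (intro sum.cong refl) (simp add: algebra_simps)
      then show ?thesis by (simp add: sum.distrib inner_vec_def)
    qed
    have Age: "v \<bullet> v \<le> v \<bullet> (An x *v v)" for x v using quad0[of v x] by (simp add: quadA)
    have Apsd: "psd_sym (An x)" for x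
    proof (rule psd_symI)
      show "An x $ i $ j = An x $ j $ i" for i j
        using psd_sym_entry_commute[OF apsd] by (simp add: Ane \<alpha>_def)
      show "0 \<le> v \<bullet> (An x *v v)" for v using Age[of v x] inner_ge_zero[of v] by linarith
    qed
    define P where "P i x = (\<integral>y. 1 * K n (x - y) \<partial>mp i) + (\<integral>y. 1 * K n (x - y) \<partial>mn i)" for i x
    \<comment> \<open>The test function is \<open>K n (x - y)\<close> in the variable
      \<open>y\<close>: a derivative in \<open>x\<close> is minus one in \<open>y\<close>, which
      cancels the sign in the weak divergence. As the kernel is nonnegative, the two measures add up
      in \<open>P\<close>.\<close>
    have divA: "\<bar>\<Sum>j\<in>UNIV. partial j (\<lambda>x. An x $ i $ j) x\<bar> \<le> P i x" for i x
    proof -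
      let ?\<phi> = "\<lambda>y. K n (x - y)"
      have C: "C1 (K n)" using trig_C1[OF K(1)] by blast
      have p1: "partial j (\<lambda>x. K n (x - y)) x = partial j (K n) (x - y)" for j y
        using C1_affine(2)[OF C, where c=1 and b="- y" and j=j] by simp
      have p2: "partial j ?\<phi> y = - partial j (K n) (x - y)" for j y
        using C1_affine(2)[OF C, where c="-1" and b=x and j=j] by simp
      have kp: "integrable lebesgue (\<lambda>y. a y $ i $ j * partial j (K n) (x - y))" for j
        using separable_integral(3)[OF K(2)[of n] ta[of i j], where j=j and x=x] by (simp add: p1)
      have "partial j (\<lambda>x. An x $ i $ j) x = (\<integral>y. a y $ i $ j * partial j (K n) (x - y) \<partial>lebesgue)" for j
      proof -
        have "partial j (\<lambda>x. An x $ i $ j) x = partial j (\<alpha> i j) x"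
          unfolding Ane C1_add(2)[OF trig_C1[OF t\<alpha>, THEN conjunct1] C1_const(1)] by (simp add: C1_const)
        also have "\<dots> = (\<integral>y. a y $ i $ j * partial j (\<lambda>x. K n (x - y)) x \<partial>lebesgue)"
          unfolding \<alpha>_def[abs_def] by (rule separable_integral(4)[OF K(2) ta])
        finally show ?thesis by (simp add: p1)
      qed
      then have "(\<Sum>j\<in>UNIV. partial j (\<lambda>x. An x $ i $ j) x)
          = (\<integral>y. (\<Sum>j\<in>UNIV. a y $ i $ j * partial j (K n) (x - y)) \<partial>lebesgue)"
        using kp by (simp add: Bochner_Integration.integral_sum)
      also have "\<dots> = - (\<integral>y. indicat_real ?Y y *\<^sub>R (\<Sum>j\<in>UNIV. A y $ i $ j * partial j ?\<phi> y) \<partial>lebesgue)"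
        by (simp add: p2 a_def sum_negf sum_distrib_left mult.assoc)
      also have "\<dots> = - integral ?Y (\<lambda>y. \<Sum>j\<in>UNIV. A y $ i $ j * partial j ?\<phi> y)"
      proof -
        have "set_integrable lebesgue ?Y (\<lambda>y. \<Sum>j\<in>UNIV. A y $ i $ j * partial j ?\<phi> y)"
        proof -
          have "integrable lebesgue (\<lambda>y. - (\<Sum>j\<in>UNIV. a y $ i $ j * partial j (K n) (x - y)))" using kp by auto
          then show ?thesis by (simp add: set_integrable_def p2 a_def sum_negf sum_distrib_left mult.assoc)
        qed
        from set_lebesgue_integral_eq_integral(2)[OF this] show ?thesis by (simp add: set_lebesgue_integral_def)
      qed
      also have "\<dots> = (\<integral>y. ?\<phi> y \<partial>mp i) - (\<integral>y. ?\<phi> y \<partial>mn i)"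
      proof (rule dm)
        show "smooth_fun ?\<phi>" by (rule trig_smooth[OF trig_reflect[OF K(1)]])
        show "periodic_wrt (lattice_of B) ?\<phi>"
          unfolding periodic_wrt_def
        proof (intro allI ballI)
          fix y h assume "h \<in> lattice_of B"
          then have "K n ((x - (y + h)) + h) = K n (x - (y + h))" using K(4)[of n] unfolding periodic_wrt_def by blast
          then show "K n (x - (y + h)) = K n (x - y)" by simp
        qed
      qed
      finally have e: "(\<Sum>j\<in>UNIV. partial j (\<lambda>x. An x $ i $ j) x) = (\<integral>y. ?\<phi> y \<partial>mp i) - (\<integral>y. ?\<phi> y \<partial>mn i)" .
      have "0 \<le> (\<integral>y. ?\<phi> y \<partial>mp i)" "0 \<le> (\<integral>y. ?\<phi> y \<partial>mn i)"
        using K(3) by (auto intro!: Bochner_Integration.integral_nonneg)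
      then show ?thesis unfolding e P_def by simp
    qed
    define t where "t x = (\<Sum>k\<in>UNIV. An x $ k $ k)" for x
    \<comment> \<open>Exchanging the integrals leaves the mass of the kernel over the ball of radius
      \<open>R\<close>, seen from points of the cell, which is at most \<open>M\<close>.\<close>
    have iP: "integrable lborel (\<lambda>x. ?I x * P i x)" "(\<integral>x. ?I x * P i x \<partial>lborel) \<le> M * (measure (mp i) UNIV + measure (mn i) UNIV)" for i
    proof -
      note s1 = separable_integral_swap[OF K(2)[of n] tm(1)[of i] tI] and s2 = separable_integral_swap[OF K(2)[of n] tm(2)[of i] tI]
      show "integrable lborel (\<lambda>x. ?I x * P i x)" unfolding P_def distrib_left
        using s1(2) s2(2) by (rule Bochner_Integration.integrable_add)
      have "(\<integral>x. ?I x * P i x \<partial>lborel) = (\<integral>y. 1 * (\<integral>x. ?I x * K n (x - y) \<partial>lborel) \<partial>mp i) + (\<integral>y. 1 * (\<integral>x. ?I x * K n (x - y) \<partial>lborel) \<partial>mn i)"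
        unfolding P_def distrib_left s1(1)[symmetric] s2(1)[symmetric]
        using s1(2) s2(2) by (rule Bochner_Integration.integral_add)
      also have "\<dots> \<le> M * measure (mp i) UNIV + M * measure (mn i) UNIV"
        by (intro add_mono torus_measure_integral_le[OF _ fund_cell_borel[OF inv]] tp s1(3) s2(3)) (use M YR in auto)
      finally show "(\<integral>x. ?I x * P i x \<partial>lborel) \<le> M * (measure (mp i) UNIV + measure (mn i) UNIV)" by (simp add: distrib_left)
    qed
    have it: "integrable lborel (\<lambda>x. ?I x * t x)" "(\<integral>x. ?I x * t x \<partial>lborel) \<le> trm"
    proof -
      have e: "?I x * t x = (\<Sum>k\<in>UNIV. ?I x * \<alpha> k k x + ?I x)" for x
        by (simp add: t_def Ane sum_distrib_left distrib_left)
      have s: "integrable lborel (\<lambda>x. ?I x * \<alpha> k k x)" "(\<integral>x. ?I x * \<alpha> k k x \<partial>lborel) \<le> M * (\<integral>y. a y $ k $ k \<partial>lebesgue)" for k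
      proof -
        note sw = separable_integral_swap[OF K(2)[of n] ta[of k k] tI]
        show "integrable lborel (\<lambda>x. ?I x * \<alpha> k k x)" unfolding \<alpha>_def by (rule sw(2))
        have "(\<integral>x. ?I x * \<alpha> k k x \<partial>lborel) = (\<integral>y. a y $ k $ k * (\<integral>x. ?I x * K n (x - y) \<partial>lborel) \<partial>lebesgue)"
          unfolding \<alpha>_def by (rule sw(1))
        also have "\<dots> \<le> (\<integral>y. a y $ k $ k * M \<partial>lebesgue)"
        proof (rule Bochner_Integration.integral_mono)
          show "integrable lebesgue (\<lambda>y. a y $ k $ k * (\<integral>x. ?I x * K n (x - y) \<partial>lborel))" by (rule sw(3))
          show "integrable lebesgue (\<lambda>y. a y $ k $ k * M)" using ai by simp
          show "a y $ k $ k * (\<integral>x. ?I x * K n (x - y) \<partial>lborel) \<le> a y $ k $ k * M" for y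
            using M[of y n] YR[of y] ak0[of y k] by (cases "y \<in> ?Y") (auto simp: a_def intro: mult_left_mono)
        qed
        finally show "(\<integral>x. ?I x * \<alpha> k k x \<partial>lborel) \<le> M * (\<integral>y. a y $ k $ k \<partial>lebesgue)" by (simp add: mult.commute)
      qed
      show "integrable lborel (\<lambda>x. ?I x * t x)" unfolding e using s(1) iI by auto
      have "(\<integral>x. ?I x * t x \<partial>lborel) = (\<Sum>k\<in>UNIV. (\<integral>x. ?I x * \<alpha> k k x \<partial>lborel) + ?vol)"
        unfolding e using s(1) iI by (simp add: Bochner_Integration.integral_sum)
      also have "\<dots> \<le> trm" unfolding trm_def by (intro sum_mono add_right_mono s(2))
      finally show "(\<integral>x. ?I x * t x \<partial>lborel) \<le> trm" .
    qed
    let ?W = "\<lambda>x. \<zeta> x *\<^sub>R An x"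
    have rowb: "\<bar>div_row ?W i x\<bar> \<le> z0 * (?I x * P i x) + Z * (?d * (?I x * t x))" for i x
    proof (cases "norm x \<le> R")
      case True
      have C: "C1 (\<lambda>x. An x $ i $ j)" for j using trig_C1[OF tAn] by blast
      have "partial j (\<lambda>x. ?W x $ i $ j) x = \<zeta> x * partial j (\<lambda>x. An x $ i $ j) x + partial j \<zeta> x * An x $ i $ j" for j
        using C1_mult(2)[OF C2_C1(1)[OF \<zeta>(1)] C[of j], of j] by simp
      then have "div_row ?W i x = \<zeta> x * (\<Sum>j\<in>UNIV. partial j (\<lambda>x. An x $ i $ j) x) + (\<Sum>j\<in>UNIV. partial j \<zeta> x * An x $ i $ j)"
        by (simp add: div_row_def sum.distrib sum_distrib_left)
      moreover have "\<bar>\<zeta> x * (\<Sum>j\<in>UNIV. partial j (\<lambda>x. An x $ i $ j) x)\<bar> \<le> z0 * P i x"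
        unfolding abs_mult by (intro mult_mono z0 divA) (use z0 in auto)
      moreover have "\<bar>\<Sum>j\<in>UNIV. partial j \<zeta> x * An x $ i $ j\<bar> \<le> (\<Sum>j\<in>(UNIV::'n set). Z * t x)"
      proof (rule order_trans[OF sum_abs sum_mono])
        fix j
        show "\<bar>partial j \<zeta> x * An x $ i $ j\<bar> \<le> Z * t x"
          unfolding abs_mult t_def by (intro mult_mono Z psd_sym_entry_le_trace Apsd Z0) auto
      qed
      ultimately have "\<bar>div_row ?W i x\<bar> \<le> z0 * P i x + (\<Sum>j\<in>(UNIV::'n set). Z * t x)" by linarith
      then show ?thesis using True by (simp add: mult.left_commute)
    next
      case False
      have "supp_ball R (div_row ?W i)"
        unfolding div_row_def[abs_def] using \<zeta>(2)
        by (intro supp_ball_sum supp_ball_partial) (simp add: supp_ball_def)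
      then show ?thesis using False by (simp add: supp_ball_def)
    qed
    have W2: "C2_supp R ?W" unfolding C2_supp_def
      using C2_mult[OF \<zeta>(1) trig_C2[OF tAn]] supp_ball_mult(1)[OF \<zeta>(2)] by simp
    have "(\<Sum>i\<in>UNIV. \<integral>x. \<bar>div_row ?W i x\<bar> \<partial>lborel) \<le> (\<Sum>i\<in>UNIV. z0 * (M * (measure (mp i) UNIV + measure (mn i) UNIV)) + Z * (?d * trm))"
    proof (rule sum_mono)
      fix i
      have "(\<integral>x. \<bar>div_row ?W i x\<bar> \<partial>lborel) \<le> (\<integral>x. z0 * (?I x * P i x) + Z * (?d * (?I x * t x)) \<partial>lborel)"
      proof (rule Bochner_Integration.integral_mono)
        show "integrable lborel (\<lambda>x. \<bar>div_row ?W i x\<bar>)"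
          using integrable_continuous_supp_ball[OF C1_continuous[OF div_row_C1(1)[OF W2]] div_row_C1(2)[OF W2]] by (rule integrable_abs)
        show "integrable lborel (\<lambda>x. z0 * (?I x * P i x) + Z * (?d * (?I x * t x)))" using iP(1) it(1) by simp
      qed (rule rowb)
      also have "\<dots> = z0 * (\<integral>x. ?I x * P i x \<partial>lborel) + Z * (?d * (\<integral>x. ?I x * t x \<partial>lborel))" using iP(1) it(1) by simp
      also have "\<dots> \<le> z0 * (M * (measure (mp i) UNIV + measure (mn i) UNIV)) + Z * (?d * trm)"
        using z0(1) Z0 by (intro add_mono mult_left_mono iP(2) it(2)) auto
      finally show "(\<integral>x. \<bar>div_row ?W i x\<bar> \<partial>lborel) \<le> z0 * (M * (measure (mp i) UNIV + measure (mn i) UNIV)) + Z * (?d * trm)" .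
    qed
    also have "\<dots> = \<beta>" 
      unfolding \<beta>_def mass_def sum.distrib[of "\<lambda>i. z0 * _ i"] sum_distrib_left by simp
    finally have b: "(\<Sum>i\<in>UNIV. \<integral>x. \<bar>div_row ?W i x\<bar> \<partial>lborel) \<le> \<beta>" .
    let ?L = "(\<integral>x. g x ^ CARD('n) \<partial>lborel) powr (1 / ?d)"
    have "?d * bump_mass TYPE('n) / 2 * (\<integral>x. g x * det (An x) powr (1 / ?d) \<partial>lborel)
      \<le> (\<Sum>i\<in>UNIV. \<integral>x. \<bar>div_row ?W i x\<bar> \<partial>lborel) * ?L"
      by (rule compensated_inequality_smooth[OF trig_C2[OF tAn] Apsd Age \<zeta>(1,2) _ \<zeta>(4,5) g(1,2,3)])
        (use r(1) \<zeta>(3) in auto)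
    also have "\<dots> \<le> \<beta> * ?L" using b by (rule mult_right_mono) simp
    finally have c: "?d * bump_mass TYPE('n) / 2 * (\<integral>x. g x * det (An x) powr (1 / ?d) \<partial>lborel) \<le> \<beta> * ?L" .
    have dpos: "0 < det (An x)" for x by (rule det_pos_if_ge_identity[OF Apsd Age])
    have cd: "continuous_on UNIV (\<lambda>x. det (An x) powr (1 / ?d))"
    proof -
      have "continuous_on UNIV (\<lambda>x. det (An x))"
        unfolding det_def by (intro continuous_intros trig_continuous tAn)
      then show ?thesis by (intro continuous_on_powr continuous_on_const) (use dpos in \<open>auto simp: less_imp_neq[symmetric]\<close>)
    qed
    have ig: "integrable lborel g" by (rule integrable_continuous_supp_ball[OF g(1,2)])
    have tg: "trig_integrable lborel g" by (rule trig_integrableI[OF ig]) auto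
    note sG = separable_integral_swap[OF K(2)[of n] tG tg]
    have "(\<integral>y. G y * (\<integral>x. g x * K n (x - y) \<partial>lborel) \<partial>lebesgue) = (\<integral>x. g x * (\<integral>y. G y * K n (x - y) \<partial>lebesgue) \<partial>lborel)"
      by (rule sG(1)[symmetric])
    also have "\<dots> \<le> (\<integral>x. g x * det (An x) powr (1 / ?d) \<partial>lborel)"
    proof (rule Bochner_Integration.integral_mono[OF sG(2)])
      show "integrable lborel (\<lambda>x. g x * det (An x) powr (1 / ?d))"
        by (intro integrable_continuous_supp_ball[where R="r + 1"] continuous_on_mult g cd supp_ball_mult(1))
      fix x
      have "(\<integral>y. G y * K n (x - y) \<partial>lebesgue) \<le> det (An x) powr (1 / ?d)"
        unfolding G_def
      \<comment> \<open>\<open>An x\<close> exceeds the mollified tensor by the identity: an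
        admissible majorant with positive determinant.\<close>
      proof (rule integral_det_powr_le[OF apsd K(3) ka _ Apsd dpos])
        show "integrable lebesgue (\<lambda>y. det (a y) powr (1 / ?d) * K n (x - y))"
          using separable_integral(1)[OF K(2) tG] by (simp add: G_def)
        show "(\<Sum>i\<in>UNIV. \<Sum>j\<in>UNIV. v $ i * v $ j * (\<integral>y. a y $ i $ j * K n (x - y) \<partial>lebesgue)) \<le> v \<bullet> (An x *v v)" for v
          unfolding quadA by (simp add: \<alpha>_def)
      qed
      then show "g x * (\<integral>y. G y * K n (x - y) \<partial>lebesgue) \<le> g x * det (An x) powr (1 / ?d)"
        using g(3) by (rule mult_left_mono)
    qed
    also have "\<dots> \<le> 2 * \<beta> / (?d * bump_mass TYPE('n)) * ?L"
      using c bump_mass_pos[where 'n='n] by (simp add: field_simps)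
    finally show ?thesis .
  qed
  show "\<exists>C\<ge>0. \<forall>g. continuous_on UNIV g \<longrightarrow> supp_ball (r + 1) g \<longrightarrow> (\<forall>x. 0 \<le> g x) \<longrightarrow>
      (\<integral>y. G y * g y \<partial>lebesgue) \<le> C * (\<integral>x. g x ^ CARD('n) \<partial>lborel) powr (1 / ?d)"
  proof (intro exI conjI allI impI)
    show "0 \<le> 2 * \<beta> / (?d * bump_mass TYPE('n))" using \<beta>0 bump_mass_pos[where 'n='n] by simp
    fix g :: "real^'n \<Rightarrow> real" assume g: "continuous_on UNIV g" "supp_ball (r + 1) g" "\<forall>x. 0 \<le> g x"
    have g0: "0 \<le> g x" for x using g(3) by blast
    define J where "J n y = (\<integral>x. g x * K n (x - y) \<partial>lborel)" for n y
    have tg: "trig_integrable lborel g"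
      by (rule trig_integrableI[OF integrable_continuous_supp_ball[OF g(1,2)]]) auto
    have tJ: "trig (J n)" for n unfolding J_def[abs_def] by (rule separable_integral_swap(4)[OF K(2) tG tg])
    have J0: "0 \<le> J n y" for n y unfolding J_def using g(3) K(3) by (intro Bochner_Integration.integral_nonneg) simp
    obtain b where b: "0 < b" "\<And>x. \<bar>g x\<bar> \<le> b" using supp_ball_bounded[OF g(1,2)] by blast
    have gm: "g \<in> borel_measurable lebesgue" using borel_measurable_continuous_onI[OF g(1)] by (simp add: measurable_completion)
    have Jm: "J n \<in> borel_measurable lebesgue" for n
      using borel_measurable_continuous_onI[OF trig_continuous[OF tJ]] by (simp add: measurable_completion)
    have cK: "continuous_on UNIV (K n)" for n by (rule trig_continuous[OF K(1)])
    \<comment> \<open>The minimum tends to \<open>g\<close> itself and is dominated by the constant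
      \<open>b\<close>; lying below \<open>J n\<close>, it inherits the bound.\<close>
    have "(\<lambda>n. \<integral>y. G y * min (g y) (J n y) \<partial>lebesgue) \<longlonglongrightarrow> (\<integral>y. G y * g y \<partial>lebesgue)"
    proof (rule integral_dominated_convergence)
      show "(\<lambda>y. G y * g y) \<in> borel_measurable lebesgue" by (rule borel_measurable_times[OF Gm gm])
      show "(\<lambda>y. G y * min (g y) (J n y)) \<in> borel_measurable lebesgue" for n by (intro borel_measurable_times borel_measurable_min Gm gm Jm)
      show "integrable lebesgue (\<lambda>y. G y * b)" using iG by simp
      show "AE y in lebesgue. (\<lambda>n. G y * min (g y) (J n y)) \<longlonglongrightarrow> G y * g y"
        unfolding J_def using g
        by (intro always_eventually allI tendsto_intros kernel_liminf[OF cK K(3) \<rho>]) auto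
      show "AE y in lebesgue. norm (G y * min (g y) (J n y)) \<le> G y * b" for n
      proof (intro always_eventually allI)
        fix y
        have "\<bar>min (g y) (J n y)\<bar> \<le> b" using g0[of y] J0[of n y] b(2)[of y] by linarith
        then have "G y * \<bar>min (g y) (J n y)\<bar> \<le> G y * b" using G0[of y] by (rule mult_left_mono)
        moreover have "norm (G y * min (g y) (J n y)) = G y * \<bar>min (g y) (J n y)\<bar>"
          using abs_of_nonneg[OF G0[of y]] by (simp only: real_norm_def abs_mult)
        ultimately show "norm (G y * min (g y) (J n y)) \<le> G y * b" by simp
      qed
    qed
    moreover have "(\<integral>y. G y * min (g y) (J n y) \<partial>lebesgue)
        \<le> 2 * \<beta> / (?d * bump_mass TYPE('n)) * (\<integral>x. g x ^ CARD('n) \<partial>lborel) powr (1 / ?d)" for n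
    proof -
      have iGJ: "integrable lebesgue (\<lambda>y. G y * J n y)" by (rule tG[unfolded trig_integrable_def, rule_format, OF tJ])
      have "(\<integral>y. G y * min (g y) (J n y) \<partial>lebesgue) \<le> (\<integral>y. G y * J n y \<partial>lebesgue)"
      proof (rule Bochner_Integration.integral_mono[OF _ iGJ])
        show "integrable lebesgue (\<lambda>y. G y * min (g y) (J n y))"
        proof (rule Bochner_Integration.integrable_bound[OF iGJ])
          show "(\<lambda>y. G y * min (g y) (J n y)) \<in> borel_measurable lebesgue" by (intro borel_measurable_times borel_measurable_min Gm gm Jm)
          show "AE y in lebesgue. norm (G y * min (g y) (J n y)) \<le> norm (G y * J n y)"
          proof (intro always_eventually allI)
            fix y
            have "\<bar>min (g y) (J n y)\<bar> \<le> \<bar>J n y\<bar>" using g0[of y] J0[of n y] by linarith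
            then show "norm (G y * min (g y) (J n y)) \<le> norm (G y * J n y)"
              unfolding real_norm_def abs_mult by (rule mult_left_mono) simp
          qed
        qed
        show "G y * min (g y) (J n y) \<le> G y * J n y" for y using G0 by (intro mult_left_mono) auto
      qed
      also have "\<dots> \<le> 2 * \<beta> / (?d * bump_mass TYPE('n)) * (\<integral>x. g x ^ CARD('n) \<partial>lborel) powr (1 / ?d)"
        unfolding J_def by (rule bound[OF g(1,2) g0])
      finally show ?thesis .
    qed
    ultimately show "(\<integral>y. G y * g y \<partial>lebesgue) \<le> 2 * \<beta> / (?d * bump_mass TYPE('n)) * (\<integral>x. g x ^ CARD('n) \<partial>lborel) powr (1 / ?d)"
      by (intro LIMSEQ_le_const2) auto
  qed
qed

theorem theorem2p2:
  fixes B :: "real^'n^'n"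
    and A :: "real^'n \<Rightarrow> real^'n^'n"
  assumes "CARD('n) \<ge> 2"
    and "invertible B"
    and "\<And>x. psd_sym (A x)"
    and "periodic_wrt (lattice_of B) A"
    and "\<And>i j. (\<lambda>x. A x $ i $ j) absolutely_integrable_on fund_cell B"
    and "div_is_bounded_measure B A"
  shows "(\<lambda>x. det (A x) powr (1 / (real CARD('n) - 1))) absolutely_integrable_on fund_cell B"
proof -
  let ?d = "real CARD('n)"
  obtain r where r: "0 < r" "fund_cell B \<subseteq> cball 0 r"
    using fund_cell_bounded[of B] unfolding bounded_pos by force
  \<comment> \<open>Cut off to the cell, the root is defined on the whole space and vanishes outside
    radius \<open>r\<close>, the setting of the duality argument.\<close>
  define G where "G y = det (indicat_real (fund_cell B) y *\<^sub>R A y) powr (1 / ?d)" for y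
  have G: "G y = indicat_real (fund_cell B) y * det (A y) powr (1 / ?d)" for y
    by (simp add: G_def det_scaleR indicator_def power_0_left)
  note W = weighted_determinant_bound[OF assms(2,3,5,6) r, folded G_def]
  obtain C where C: "0 \<le> C" "\<And>g. continuous_on UNIV g \<Longrightarrow> supp_ball (r + 1) g \<Longrightarrow> (\<And>x. 0 \<le> g x) \<Longrightarrow>
      (\<integral>y. G y * g y \<partial>lebesgue) \<le> C * (\<integral>x. g x ^ CARD('n) \<partial>lborel) powr (1 / ?d)"
    using W(2) by blast
  have "integrable lebesgue (\<lambda>y. G y powr (?d / (?d - 1)))"
  proof (rule powr_integrable_if_dual_bound[OF assms(1) _ _ _ C])
    show "integrable lebesgue G" using W(1) by (simp add: G_def[abs_def])
    show "0 \<le> G y" for y by (simp add: G_def)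
    show "G y = 0" if "r < norm y" for y 
    proof -
      have "y \<notin> fund_cell B" using r(2) that by force
      then show ?thesis by (simp add: G)
    qed
  qed
  \<comment> \<open>The exponents combine as 1 / d times d / (d - 1).\<close>
  moreover have "G y powr (?d / (?d - 1)) = indicat_real (fund_cell B) y *\<^sub>R (det (A y) powr (1 / (?d - 1)))" for y
    by (simp add: G indicator_def powr_powr)
  ultimately show ?thesis by (simp add: set_integrable_def)
qed

end
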